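(* Let $M^m$, $N^n$ be $\mathcal C^\infty$ manifolds with $m<n$ and $M$ compact, let $g$ be a Riemannian metric on $N$, and let $\mathfrak C$ be a regularity class as described in the context. Let $f:\mathrm{Emb}(M,N)\to\mathbb R$ be a smooth function invariant by diffeomorphisms of $M$ (i.e. $f(x)=f(y)$ whenever $x,y\in\mathrm{Emb}(M,N)$ are equivalent), and assume that $x:M\to N$ is a $\mathcal C^\infty$ embedding such that $[x]$ is a critical point of $f$ in $\widetilde{\mathrm{Emb}}(M,N)$. Then the second variation $\mathrm d^2\big(f\circ\widetilde\Phi_x^{-1}\big)(0)$ coincides with the restriction of the second variation $\mathrm d^2\big(f\circ\Phi_x^{-1}\big)(0)$ to the space $\mathbf\Gamma(x^\perp)$ of $\mathfrak C$-sections of the normal bundle $x^\perp$.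
   Context: "Smooth" means $\mathcal C^\infty$. Regularity class. $\mathfrak C(M,\mathbb R)$ is a Banach space of maps $M\to\mathbb R$ with $\mathcal C^\infty(M,\mathbb R)\subset\mathfrak C(M,\mathbb R)\subset\mathcal C^1(M,\mathbb R)$, where the first inclusion is dense and the second is continuous; it is stable under right composition with maps in $\mathcal C^\infty(M,M)$ and under left composition with functions in $\mathcal C^\infty(\mathbb R,\mathbb R)$, and for every $f\in\mathcal C^\infty(\mathbb R,\mathbb R)$ the map $\mathfrak C(M,\mathbb R)\ni h\mapsto f\circ h\in\mathfrak C(M,\mathbb R)$ is smooth. Set $\mathfrak C(M,\mathbb R^d)=\bigoplus_{i=1}^d\mathfrak C(M,\mathbb R)$. $\mathfrak C(M,N)$ is the set of maps $f:M\to N$ with $\phi\circ f\in\mathfrak C(M,\mathbb R^d)$ for a (any) smooth embedding $\phi:N\to\mathbb R^d$, with the Banach manifold structure induced from the submanifold $\{h\in\mathfrak C(M,\mathbb R^d):h(M)\subset\phi(N)\}$ (independent of $\phi$). For a smooth vector bundle $E\to M$, $\mathbf\Gamma(E)$ is the Banach space of sections of class $\mathfrak C$ of $E$; as part of the setting, left composition with smooth fiber-preserving maps between vector bundles over $M$ induces smooth maps between the spaces of $\mathfrak C$-sections. Embeddings. $\mathrm{Emb}(M,N)$ is the open subset of $\mathfrak C(M,N)$ consisting of embeddings. Two embeddings $x,y\in\mathrm{Emb}(M,N)$ are equivalent if $y=x\circ\phi$ for some $\mathcal C^1$-diffeomorphism $\phi:M\to M$; $[x]$ is the equivalence class of $x$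 in $\mathrm{Emb}(M,N)$, and $\widetilde{\mathrm{Emb}}(M,N)=\{[x]:x\in\mathrm{Emb}(M,N)\}$. An invariant $f$ induces a function on $\widetilde{\mathrm{Emb}}(M,N)$, again denoted $f$. Charts. Let $\exp$ be the exponential map of $g$ and $x:M\to N$ a smooth embedding. The chart $\Phi_x$ of $\mathrm{Emb}(M,N)$ around $x$ is $\Phi_x(y)=u$, where $u\in\mathbf\Gamma(x^*(TN))$ lies in a suitable open neighborhood of the zero section and $y(p)=\exp_{x(p)}(u(p))$ for all $p\in M$ (here one uses an open neighborhood of the zero section of $x^*(TN)$ which $(p,v)\mapsto(p,\exp_{x(p)}v)$ maps diffeomorphically onto an open neighborhood of the graph of $x$ in $M\times N$). Let $x^\perp\subset x^*(TN)$ be the normal bundle of $x$, and choose an open $U\subset x^\perp$ containing the zero section and an open $V\subset N$ containing $x(M)$ such that $\exp|_U:U\to V$ is a diffeomorphism. $\mathbf\Gamma(x^\perp;U)$ is the open set of $u\in\mathbf\Gamma(x^\perp)$ with image in $U$. Define $\widetilde\Psi_x:\mathbf\Gamma(x^\perp;U)\to\widetilde{\mathrm{Emb}}(M,N)$ by $\widetilde\Psi_x(u)=[y]$, $y(p)=\exp_{x(p)}(u(p))$. For suitable choices of neighborhoods, $\widetilde\Psi_x$ is a bijection from an open subset $\widetilde{\mathcal W}_x$ of $\mathbf\Gamma(x^\perp)$ containing the zero section onto a subset $\widetilde{\mathcal U}_x\subset\widetilde{\mathrm{Emb}}(M,N)$ which is the image under $y\mapsto[y]$ of an open neighborhood of $x$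 in $\mathrm{Emb}(M,N)$; its inverse is the chart $\widetilde\Phi_x:\widetilde{\mathcal U}_x\to\widetilde{\mathcal W}_x$. Both charts are centered: $\Phi_x(x)=0$ and $\widetilde\Phi_x([x])=0$. Critical points. For $f$ as in the claim, $[y]\in\widetilde{\mathrm{Emb}}(M,N)$ is a critical point of $f$ in $\widetilde{\mathrm{Emb}}(M,N)$ if, given a smooth embedding $z:M\to N$ with $[y]\in\widetilde{\mathcal U}_z$, the point $\widetilde\Phi_z([y])$ is a critical point of the smooth function $f\circ\widetilde\Phi_z^{-1}$ (this does not depend on the choice of $z$). *)

theory Defs
  imports
    "HOL-Analysis.Analysis"
    "HOL-Library.Function_Algebras"
    "HOL-Library.Extended_Nat"
begin

section \<open>Function spaces as real vector spaces\<close>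

instantiation "fun" :: (type, real_vector) real_vector
begin

definition scaleR_fun :: "real \<Rightarrow> ('a \<Rightarrow> 'b) \<Rightarrow> 'a \<Rightarrow> 'b" where
  "scaleR_fun c f = (\<lambda>x. c *\<^sub>R f x)"

instance
  by standard (simp_all add: scaleR_fun_def fun_eq_iff scaleR_add_right scaleR_add_left)

end

section \<open>Normed spaces on a carrier set and Frechet derivatives between them\<close>

text \<open>The Banach spaces of sections below depend on an embedding, so they are carried by subsets of
  function types. Nothing is assumed about the value of the norm outside the carrier.\<close>

record 'a normed_sp =
  vecs :: "'a set"
  nrm :: "'a \<Rightarrow> real"

definition ndist :: "'a::real_vector normed_sp \<Rightarrow> 'a \<Rightarrow> 'a \<Rightarrow> real" where
  "ndist X u v = (if u \<in> vecs X \<and> v \<in> vecs X then nrm X (u - v) else 0)"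

definition ntop :: "'a::real_vector normed_sp \<Rightarrow> 'a topology" where
  "ntop X = Metric_space.mtopology (vecs X) (ndist X)"

definition banach_space :: "'a::real_vector normed_sp \<Rightarrow> bool" where
  "banach_space X \<longleftrightarrow>
     subspace (vecs X) \<and>
     (\<forall>u\<in>vecs X. 0 \<le> nrm X u \<and> (nrm X u = 0 \<longleftrightarrow> u = 0)) \<and>
     (\<forall>u\<in>vecs X. \<forall>a. nrm X (a *\<^sub>R u) = \<bar>a\<bar> * nrm X u) \<and>
     (\<forall>u\<in>vecs X. \<forall>v\<in>vecs X. nrm X (u + v) \<le> nrm X u + nrm X v) \<and>
     Metric_space.mcomplete (vecs X) (ndist X)"

definition real_sp :: "real normed_sp" where
  "real_sp = \<lparr>vecs = UNIV, nrm = norm\<rparr>"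

definition restrict_sp :: "'a normed_sp \<Rightarrow> 'a set \<Rightarrow> 'a normed_sp" where
  "restrict_sp X G = \<lparr>vecs = vecs X \<inter> G, nrm = nrm X\<rparr>"

text \<open>Bounded linear maps with the operator norm, and bounded \<open>k\<close>-linear maps with the usual norm.
  Maps are normalised to vanish on arguments outside the domain, so that equality of functions is
  equality of operators. A \<open>k\<close>-linear map takes the list of its \<open>k\<close> arguments.\<close>

definition blin :: "'a::real_vector normed_sp \<Rightarrow> 'b::real_vector normed_sp \<Rightarrow> ('a \<Rightarrow> 'b) normed_sp" where
  "blin X Y = \<lparr>
     vecs = {L. (\<forall>v. v \<notin> vecs X \<longrightarrow> L v = 0) \<and>
                (\<forall>v\<in>vecs X. L v \<in> vecs Y) \<and>
                (\<forall>v\<in>vecs X. \<forall>w\<in>vecs X. \<forall>a. L (a *\<^sub>R v + w) = a *\<^sub>R L v + L w) \<and>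
                (\<exists>K. \<forall>v\<in>vecs X. nrm Y (L v) \<le> K * nrm X v)},
     nrm = (\<lambda>L. Sup {nrm Y (L v) | v. v \<in> vecs X \<and> nrm X v \<le> 1})\<rparr>"

definition mlin :: "nat \<Rightarrow> 'a::real_vector normed_sp \<Rightarrow> 'b::real_vector normed_sp \<Rightarrow>
    ('a list \<Rightarrow> 'b) normed_sp" where
  "mlin k X Y = \<lparr>
     vecs = {A. (\<forall>vs. \<not> (length vs = k \<and> set vs \<subseteq> vecs X) \<longrightarrow> A vs = 0) \<and>
                (\<forall>vs. length vs = k \<and> set vs \<subseteq> vecs X \<longrightarrow> A vs \<in> vecs Y) \<and>
                (\<forall>vs i v w a. length vs = k \<and> set vs \<subseteq> vecs X \<and> i < k \<and> v \<in> vecs X \<and> w \<in> vecs X \<longrightarrow>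
                   A (vs[i := a *\<^sub>R v + w]) = a *\<^sub>R A (vs[i := v]) + A (vs[i := w])) \<and>
                (\<exists>K. \<forall>vs. length vs = k \<and> set vs \<subseteq> vecs X \<longrightarrow>
                   nrm Y (A vs) \<le> K * prod_list (map (nrm X) vs))},
     nrm = (\<lambda>A. Sup {nrm Y (A vs) | vs. length vs = k \<and> (\<forall>v\<in>set vs. v \<in> vecs X \<and> nrm X v \<le> 1)})\<rparr>"

definition has_fderiv :: "'a::real_vector normed_sp \<Rightarrow> 'b::real_vector normed_sp \<Rightarrow> 'a set \<Rightarrow>
    ('a \<Rightarrow> 'b) \<Rightarrow> 'a \<Rightarrow> ('a \<Rightarrow> 'b) \<Rightarrow> bool" where
  "has_fderiv X Y W F u L \<longleftrightarrow>
     L \<in> vecs (blin X Y) \<and>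
     (\<forall>e>0. \<exists>d>0. \<forall>h\<in>vecs X. u + h \<in> W \<and> nrm X h < d \<longrightarrow>
        nrm Y (F (u + h) - F u - L h) \<le> e * nrm X h)"

text \<open>\<open>F\<close> is of class \<open>C\<close>-infinity on the open set \<open>W\<close>: \<open>D k\<close> is the \<open>k\<close>-th derivative, as a map from
  \<open>W\<close> to the space of \<open>k\<close>-linear maps, under the isomorphism \<open>L(X, L\<^sup>k(X;Y)) = L\<^sup>k\<^sup>+\<^sup>1(X;Y)\<close>.\<close>

definition banach_smooth :: "'a::real_vector normed_sp \<Rightarrow> 'b::real_vector normed_sp \<Rightarrow> 'a set \<Rightarrow>
    ('a \<Rightarrow> 'b) \<Rightarrow> bool" where
  "banach_smooth X Y W F \<longleftrightarrow>
     openin (ntop X) W \<and> F ` W \<subseteq> vecs Y \<and>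
     (\<exists>D :: nat \<Rightarrow> 'a \<Rightarrow> 'a list \<Rightarrow> 'b.
        (\<forall>u\<in>W. D 0 u = (\<lambda>vs. if vs = [] then F u else 0)) \<and>
        (\<forall>k. \<forall>u\<in>W. D k u \<in> vecs (mlin k X Y) \<and>
           has_fderiv X (mlin k X Y) W (D k) u (\<lambda>h vs. D (Suc k) u (h # vs))))"

definition has_second_fderiv :: "'a::real_vector normed_sp \<Rightarrow> 'b::real_vector normed_sp \<Rightarrow> 'a set \<Rightarrow>
    ('a \<Rightarrow> 'b) \<Rightarrow> 'a \<Rightarrow> ('a \<Rightarrow> 'a \<Rightarrow> 'b) \<Rightarrow> bool" where
  "has_second_fderiv X Y W F u B \<longleftrightarrow>
     (\<exists>W' dF. openin (ntop X) W' \<and> u \<in> W' \<and> W' \<subseteq> W \<and>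
        (\<forall>a\<in>W'. has_fderiv X Y W F a (dF a)) \<and> has_fderiv X (blin X Y) W' dF u B)"

definition second_fderiv :: "'a::real_vector normed_sp \<Rightarrow> 'b::real_vector normed_sp \<Rightarrow> 'a set \<Rightarrow>
    ('a \<Rightarrow> 'b) \<Rightarrow> 'a \<Rightarrow> 'a \<Rightarrow> 'a \<Rightarrow> 'b" where
  "second_fderiv X Y W F u = (THE B. has_second_fderiv X Y W F u B)"

text \<open>Submanifolds of a Banach space \<open>X\<close>: a slice chart straightens \<open>S\<close> to a closed complemented
  subspace \<open>G\<close> (the range of a bounded projection). A function on an open subset \<open>T\<close> of the
  submanifold is smooth if it is smooth in slice charts around all points.\<close>

definition complemented :: "'a::real_vector normed_sp \<Rightarrow> 'a set \<Rightarrow> bool" where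
  "complemented X G \<longleftrightarrow> (\<exists>P\<in>vecs (blin X X). P ` vecs X = G \<and> (\<forall>v\<in>G. P v = v))"

definition slice_chart :: "'a::real_vector normed_sp \<Rightarrow> 'a set \<Rightarrow> 'a set \<Rightarrow> ('a \<Rightarrow> 'a) \<Rightarrow> 'a set \<Rightarrow> bool" where
  "slice_chart X S W \<kappa> G \<longleftrightarrow>
     banach_smooth X X W \<kappa> \<and> inj_on \<kappa> W \<and> banach_smooth X X (\<kappa> ` W) (inv_into W \<kappa>) \<and>
     complemented X G \<and> \<kappa> ` (W \<inter> S) = \<kappa> ` W \<inter> G"

definition smooth_on_submanifold :: "'a::real_vector normed_sp \<Rightarrow> 'a set \<Rightarrow> 'a set \<Rightarrow> ('a \<Rightarrow> real) \<Rightarrow> bool" where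
  "smooth_on_submanifold X S T f \<longleftrightarrow>
     (\<forall>s\<in>T. \<exists>W \<kappa> G. slice_chart X S W \<kappa> G \<and> s \<in> W \<and> W \<inter> S \<subseteq> T \<and>
        banach_smooth (restrict_sp X G) real_sp (\<kappa> ` W \<inter> G) (f \<circ> inv_into W \<kappa>))"

section \<open>Finite-dimensional manifolds\<close>

primrec higher_differentiable_on ::
    "'a::real_normed_vector set \<Rightarrow> ('a \<Rightarrow> 'b::real_normed_vector) \<Rightarrow> nat \<Rightarrow> bool" where
  "higher_differentiable_on S f 0 \<longleftrightarrow> continuous_on S f"
| "higher_differentiable_on S f (Suc k) \<longleftrightarrow>
     (\<forall>x\<in>S. f differentiable (at x)) \<and>
     (\<forall>v. higher_differentiable_on S (\<lambda>x. frechet_derivative f (at x) v) k)"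

text \<open>Class \<open>C\<^sup>r\<close> on an open subset of a finite-dimensional space, \<open>r = \<infinity>\<close> allowed.\<close>

definition smooth_on :: "enat \<Rightarrow> 'a::real_normed_vector set \<Rightarrow> ('a \<Rightarrow> 'b::real_normed_vector) \<Rightarrow> bool" where
  "smooth_on r S f \<longleftrightarrow> (\<forall>k. enat k \<le> r \<longrightarrow> higher_differentiable_on S f k)"

type_synonym ('a, 'e) chart = "'a set \<times> ('a \<Rightarrow> 'e)"

text \<open>The model space is any inner product space of dimension \<open>n\<close>; unlike the class
  \<open>euclidean_space\<close> this includes \<open>n = 0\<close>. Hausdorff and second countable are imposed through the
  type class of the underlying space.\<close>

definition smooth_manifold ::
    "('a::{t2_space,second_countable_topology}, 'e::real_inner) chart set \<Rightarrow> nat \<Rightarrow> bool" where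
  "smooth_manifold A n \<longleftrightarrow>
     (\<exists>B :: 'e set. finite B \<and> independent B \<and> span B = UNIV \<and> card B = n) \<and>
     (\<Union>(U, c)\<in>A. U) = UNIV \<and>
     (\<forall>(U, c)\<in>A. open U \<and> open (c ` U) \<and> homeomorphism U (c ` U) c (inv_into U c) \<and>
        (\<forall>(V, k)\<in>A. smooth_on \<infinity> (c ` (U \<inter> V)) (k \<circ> inv_into U c)))"

definition std_atlas :: "('v, 'v) chart set" where
  "std_atlas = {(UNIV, id)}"

definition prod_atlas :: "('a, 'e) chart set \<Rightarrow> ('b, 'f) chart set \<Rightarrow> ('a \<times> 'b, 'e \<times> 'f) chart set" where
  "prod_atlas A B = {(U \<times> V, map_prod c k) | U c V k. (U, c) \<in> A \<and> (V, k) \<in> B}"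

text \<open>Maps of class \<open>C\<^sup>r\<close> on an arbitrary subset \<open>S\<close> of a manifold: locally the restriction of a
  \<open>C\<^sup>r\<close> map of an open set. For open \<open>S\<close> and for submanifolds \<open>S\<close> (such as the total space of a
  subbundle) this is the usual notion.\<close>

definition Cmap :: "enat \<Rightarrow> ('a::topological_space, 'e::real_normed_vector) chart set \<Rightarrow>
    ('b::topological_space, 'f::real_normed_vector) chart set \<Rightarrow> 'a set \<Rightarrow> ('a \<Rightarrow> 'b) \<Rightarrow> bool" where
  "Cmap r A B S f \<longleftrightarrow>
     (\<forall>p\<in>S. \<exists>(U, c)\<in>A. \<exists>(V, k)\<in>B. p \<in> U \<and> f p \<in> V \<and>
        (\<exists>Q F. open Q \<and> c p \<in> Q \<and> smooth_on r Q F \<and>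
           (\<forall>q\<in>S \<inter> U. c q \<in> Q \<longrightarrow> f q \<in> V \<and> k (f q) = F (c q))))"

definition Cdiffeo :: "enat \<Rightarrow> ('a::topological_space, 'e::real_normed_vector) chart set \<Rightarrow>
    ('b::topological_space, 'f::real_normed_vector) chart set \<Rightarrow> 'a set \<Rightarrow> 'b set \<Rightarrow> ('a \<Rightarrow> 'b) \<Rightarrow> bool" where
  "Cdiffeo r A B S T f \<longleftrightarrow> bij_betw f S T \<and> Cmap r A B S f \<and> Cmap r B A T (inv_into S f)"

definition Cembedding :: "enat \<Rightarrow> ('a::topological_space, 'e::real_normed_vector) chart set \<Rightarrow>
    ('b::topological_space, 'f::real_normed_vector) chart set \<Rightarrow> ('a \<Rightarrow> 'b) \<Rightarrow> bool" where
  "Cembedding r A B y \<longleftrightarrow>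
     Cmap r A B UNIV y \<and>
     (\<forall>(U, c)\<in>A. \<forall>(V, k)\<in>B. \<forall>p\<in>U. y p \<in> V \<longrightarrow>
        inj (frechet_derivative (k \<circ> y \<circ> inv_into U c) (at (c p)))) \<and>
     (\<exists>z. homeomorphism UNIV (range y) y z)"

section \<open>Tangent spaces, Riemannian metric and exponential map\<close>

text \<open>A smooth embedding \<open>\<phi> : N \<rightarrow> R\<^sup>d\<close> is used throughout to realise \<open>T\<^sub>qN\<close> as the subspace
  \<open>d\<phi>\<^sub>q(T\<^sub>qN)\<close> of \<open>R\<^sup>d\<close>, i.e. \<open>tangent_image AN \<phi> q\<close>; likewise \<open>dx\<^sub>p(T\<^sub>pM)\<close> is
  \<open>tangent_image AM (\<phi> \<circ> x) p\<close>. The metric, which lives on the abstract manifold \<open>N\<close>, is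
  transported accordingly.\<close>

definition tangent_image :: "('a, 'e::real_normed_vector) chart set \<Rightarrow> ('a \<Rightarrow> 'd::real_normed_vector) \<Rightarrow>
    'a \<Rightarrow> 'd set" where
  "tangent_image A h p =
     {frechet_derivative (h \<circ> inv_into U c) (at (c p)) w | U c w. (U, c) \<in> A \<and> p \<in> U}"

definition metric_coeff :: "('n \<Rightarrow> 'd::real_normed_vector) \<Rightarrow> ('n \<Rightarrow> 'd \<Rightarrow> 'd \<Rightarrow> real) \<Rightarrow>
    ('n, 'f::real_normed_vector) chart \<Rightarrow> 'f \<Rightarrow> 'f \<Rightarrow> 'f \<Rightarrow> real" where
  "metric_coeff \<phi> g = (\<lambda>(V, k) a v w.
     g (inv_into V k a) (frechet_derivative (\<phi> \<circ> inv_into V k) (at a) v)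
                        (frechet_derivative (\<phi> \<circ> inv_into V k) (at a) w))"

definition riemannian_metric :: "('n, 'f::real_normed_vector) chart set \<Rightarrow>
    ('n \<Rightarrow> 'd::real_normed_vector) \<Rightarrow> ('n \<Rightarrow> 'd \<Rightarrow> 'd \<Rightarrow> real) \<Rightarrow> bool" where
  "riemannian_metric AN \<phi> g \<longleftrightarrow>
     (\<forall>q. \<forall>u\<in>tangent_image AN \<phi> q. \<forall>v\<in>tangent_image AN \<phi> q. \<forall>w\<in>tangent_image AN \<phi> q. \<forall>a.
        g q (a *\<^sub>R u + v) w = a * g q u w + g q v w \<and> g q v w = g q w v \<and> (u \<noteq> 0 \<longrightarrow> 0 < g q u u)) \<and>
     (\<forall>(V, k)\<in>AN. \<forall>v w. smooth_on \<infinity> (k ` V) (\<lambda>a. metric_coeff \<phi> g (V, k) a v w))"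

text \<open>Christoffel symbols of the first kind of the Levi-Civita connection, as a trilinear form.\<close>

definition christoffel :: "('n \<Rightarrow> 'd::real_normed_vector) \<Rightarrow> ('n \<Rightarrow> 'd \<Rightarrow> 'd \<Rightarrow> real) \<Rightarrow>
    ('n, 'f::real_normed_vector) chart \<Rightarrow> 'f \<Rightarrow> 'f \<Rightarrow> 'f \<Rightarrow> 'f \<Rightarrow> real" where
  "christoffel \<phi> g ch a u v w =
     (frechet_derivative (\<lambda>b. metric_coeff \<phi> g ch b v w) (at a) u +
      frechet_derivative (\<lambda>b. metric_coeff \<phi> g ch b u w) (at a) v -
      frechet_derivative (\<lambda>b. metric_coeff \<phi> g ch b u v) (at a) w) / 2"

definition geodesic_on :: "('n::topological_space, 'f::real_normed_vector) chart set \<Rightarrow>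
    ('n \<Rightarrow> 'd::real_normed_vector) \<Rightarrow> ('n \<Rightarrow> 'd \<Rightarrow> 'd \<Rightarrow> real) \<Rightarrow> real set \<Rightarrow> (real \<Rightarrow> 'n) \<Rightarrow> bool" where
  "geodesic_on AN \<phi> g J \<gamma> \<longleftrightarrow>
     open J \<and> is_interval J \<and> Cmap \<infinity> std_atlas AN J \<gamma> \<and>
     (\<forall>t\<in>J. \<forall>(V, k)\<in>AN. \<gamma> t \<in> V \<longrightarrow>
        (let \<sigma> = k \<circ> \<gamma>; \<sigma>' = (\<lambda>s. vector_derivative \<sigma> (at s)) in
         \<forall>w. metric_coeff \<phi> g (V, k) (\<sigma> t) (vector_derivative \<sigma>' (at t)) w
              + christoffel \<phi> g (V, k) (\<sigma> t) (\<sigma>' t) (\<sigma>' t) w = 0))"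

definition exp_rel :: "('n::topological_space, 'f::real_normed_vector) chart set \<Rightarrow>
    ('n \<Rightarrow> 'd::real_normed_vector) \<Rightarrow> ('n \<Rightarrow> 'd \<Rightarrow> 'd \<Rightarrow> real) \<Rightarrow> 'n \<Rightarrow> 'd \<Rightarrow> 'n \<Rightarrow> bool" where
  "exp_rel AN \<phi> g q v r \<longleftrightarrow>
     (\<exists>J \<gamma>. geodesic_on AN \<phi> g J \<gamma> \<and> {0..1} \<subseteq> J \<and> \<gamma> 0 = q \<and>
        ((\<phi> \<circ> \<gamma>) has_vector_derivative v) (at 0) \<and> \<gamma> 1 = r)"

definition exp_map :: "('n::topological_space, 'f::real_normed_vector) chart set \<Rightarrow>
    ('n \<Rightarrow> 'd::real_normed_vector) \<Rightarrow> ('n \<Rightarrow> 'd \<Rightarrow> 'd \<Rightarrow> real) \<Rightarrow> 'n \<Rightarrow> 'd \<Rightarrow> 'n" where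
  "exp_map AN \<phi> g q v = (THE r. exp_rel AN \<phi> g q v r)"

section \<open>Vector bundles and sections of class \<open>C\<close>\<close>

text \<open>A smooth vector bundle over \<open>M\<close> is given as a smooth subbundle of a trivial bundle: \<open>E p\<close> is the
  fibre over \<open>p\<close>, and there are local smooth frames.\<close>

definition smooth_bundle :: "('m::topological_space, 'e::real_normed_vector) chart set \<Rightarrow>
    ('m \<Rightarrow> 'd::real_normed_vector set) \<Rightarrow> bool" where
  "smooth_bundle AM E \<longleftrightarrow>
     (\<forall>p. \<exists>Q r (s :: nat \<Rightarrow> 'm \<Rightarrow> 'd). open Q \<and> p \<in> Q \<and>
        (\<forall>i<r. Cmap \<infinity> AM std_atlas Q (s i)) \<and>
        (\<forall>q\<in>Q. inj_on (\<lambda>i. s i q) {..<r} \<and> independent ((\<lambda>i. s i q) ` {..<r}) \<and>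
           span ((\<lambda>i. s i q) ` {..<r}) = E q))"

abbreviation total :: "('m \<Rightarrow> 'd set) \<Rightarrow> ('m \<times> 'd) set" where
  "total E \<equiv> Sigma UNIV E"

definition pullback_TN :: "('n, 'f::real_normed_vector) chart set \<Rightarrow> ('n \<Rightarrow> 'd::real_normed_vector) \<Rightarrow>
    ('m \<Rightarrow> 'n) \<Rightarrow> 'm \<Rightarrow> 'd set" where
  "pullback_TN AN \<phi> x p = tangent_image AN \<phi> (x p)"

definition normal_bundle :: "('m, 'e::real_normed_vector) chart set \<Rightarrow> ('n, 'f::real_normed_vector) chart set \<Rightarrow>
    ('n \<Rightarrow> 'd::real_normed_vector) \<Rightarrow> ('n \<Rightarrow> 'd \<Rightarrow> 'd \<Rightarrow> real) \<Rightarrow> ('m \<Rightarrow> 'n) \<Rightarrow> 'm \<Rightarrow> 'd set" where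
  "normal_bundle AM AN \<phi> g x p =
     {v \<in> pullback_TN AN \<phi> x p. \<forall>w\<in>tangent_image AM (\<phi> \<circ> x) p. g (x p) v w = 0}"

text \<open>\<open>C\<close> is the Banach space of real-valued maps of class \<open>C\<close> on \<open>M\<close>. The fifth conjunct
  expresses continuity of the inclusion into \<open>C\<^sup>1(M)\<close>, whose topology is given by the seminorms
  taken in charts over compact sets.\<close>

definition regularity_class ::
    "('m::topological_space, 'e::real_normed_vector) chart set \<Rightarrow> ('m \<Rightarrow> real) normed_sp \<Rightarrow> bool" where
  "regularity_class AM C \<longleftrightarrow>
     banach_space C \<and>
     {h. Cmap \<infinity> AM std_atlas UNIV h} \<subseteq> vecs C \<and>
     vecs C \<subseteq> {h. Cmap 1 AM std_atlas UNIV h} \<and>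
     (\<forall>h\<in>vecs C. \<forall>e>0. \<exists>s. Cmap \<infinity> AM std_atlas UNIV s \<and> nrm C (h - s) < e) \<and>
     (\<forall>(U, c)\<in>AM. \<forall>K. compact K \<and> K \<subseteq> U \<longrightarrow>
        (\<exists>b. \<forall>h\<in>vecs C. \<forall>p\<in>K. \<bar>h p\<bar> \<le> b * nrm C h \<and>
           onorm (frechet_derivative (h \<circ> inv_into U c) (at (c p))) \<le> b * nrm C h)) \<and>
     (\<forall>h\<in>vecs C. \<forall>\<psi>. Cmap \<infinity> AM AM UNIV \<psi> \<longrightarrow> h \<circ> \<psi> \<in> vecs C) \<and>
     (\<forall>f :: real \<Rightarrow> real. smooth_on \<infinity> UNIV f \<longrightarrow>
        (\<forall>h\<in>vecs C. f \<circ> h \<in> vecs C) \<and> banach_smooth C C (vecs C) (\<lambda>h. f \<circ> h))"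

text \<open>The direct sum of \<open>d\<close> copies of \<open>C\<close>, and the closed subspaces of sections of subbundles.\<close>

definition vec_class :: "('m \<Rightarrow> real) normed_sp \<Rightarrow> ('m \<Rightarrow> 'd::euclidean_space) normed_sp" where
  "vec_class C = \<lparr>
     vecs = {h. \<forall>b\<in>Basis. (\<lambda>p. h p \<bullet> b) \<in> vecs C},
     nrm = (\<lambda>h. \<Sum>b\<in>Basis. nrm C (\<lambda>p. h p \<bullet> b))\<rparr>"

definition sections :: "('m \<Rightarrow> real) normed_sp \<Rightarrow> ('m \<Rightarrow> 'd::euclidean_space set) \<Rightarrow>
    ('m \<Rightarrow> 'd) normed_sp" where
  "sections C E = restrict_sp (vec_class C) {u. \<forall>p. u p \<in> E p}"

section \<open>Embeddings of class \<open>C\<close> and unparameterized embeddings\<close>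

definition class_maps :: "('m \<Rightarrow> real) normed_sp \<Rightarrow> ('n \<Rightarrow> 'd::euclidean_space) \<Rightarrow> ('m \<Rightarrow> 'n) set" where
  "class_maps C \<phi> = {y. \<phi> \<circ> y \<in> vecs (vec_class C)}"

definition Emb :: "('m::topological_space, 'e::real_normed_vector) chart set \<Rightarrow>
    ('n::topological_space, 'f::real_normed_vector) chart set \<Rightarrow> ('m \<Rightarrow> real) normed_sp \<Rightarrow>
    ('n \<Rightarrow> 'd::euclidean_space) \<Rightarrow> ('m \<Rightarrow> 'n) set" where
  "Emb AM AN C \<phi> = {y \<in> class_maps C \<phi>. Cembedding 1 AM AN y}"

definition open_in_Emb :: "('m::topological_space, 'e::real_normed_vector) chart set \<Rightarrow>
    ('n::topological_space, 'f::real_normed_vector) chart set \<Rightarrow> ('m \<Rightarrow> real) normed_sp \<Rightarrow>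
    ('n \<Rightarrow> 'd::euclidean_space) \<Rightarrow> ('m \<Rightarrow> 'n) set \<Rightarrow> bool" where
  "open_in_Emb AM AN C \<phi> \<U> \<longleftrightarrow>
     (\<exists>\<G>. openin (ntop (vec_class C)) \<G> \<and> \<U> = {y \<in> Emb AM AN C \<phi>. \<phi> \<circ> y \<in> \<G>})"

text \<open>Smoothness for the manifold structure that \<open>y \<mapsto> \<phi> \<circ> y\<close> induces from the submanifold
  \<open>{h. h(M) \<subseteq> \<phi>(N)}\<close> of the Banach space of \<open>R\<^sup>d\<close>-valued maps.\<close>

definition smooth_on_Emb :: "('m::topological_space, 'e::real_normed_vector) chart set \<Rightarrow>
    ('n::topological_space, 'f::real_normed_vector) chart set \<Rightarrow> ('m \<Rightarrow> real) normed_sp \<Rightarrow>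
    ('n \<Rightarrow> 'd::euclidean_space) \<Rightarrow> (('m \<Rightarrow> 'n) \<Rightarrow> real) \<Rightarrow> bool" where
  "smooth_on_Emb AM AN C \<phi> f \<longleftrightarrow>
     smooth_on_submanifold (vec_class C) {h \<in> vecs (vec_class C). range h \<subseteq> range \<phi>}
       ((\<lambda>y. \<phi> \<circ> y) ` Emb AM AN C \<phi>) (\<lambda>h. f (inv \<phi> \<circ> h))"

definition emb_equiv :: "('m::topological_space, 'e::real_normed_vector) chart set \<Rightarrow>
    ('m \<Rightarrow> 'n) \<Rightarrow> ('m \<Rightarrow> 'n) \<Rightarrow> bool" where
  "emb_equiv AM x y \<longleftrightarrow> (\<exists>\<psi>. Cdiffeo 1 AM AM UNIV UNIV \<psi> \<and> y = x \<circ> \<psi>)"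

definition emb_class :: "('m::topological_space, 'e::real_normed_vector) chart set \<Rightarrow>
    ('n::topological_space, 'f::real_normed_vector) chart set \<Rightarrow> ('m \<Rightarrow> real) normed_sp \<Rightarrow>
    ('n \<Rightarrow> 'd::euclidean_space) \<Rightarrow> ('m \<Rightarrow> 'n) \<Rightarrow> ('m \<Rightarrow> 'n) set" where
  "emb_class AM AN C \<phi> x = {y \<in> Emb AM AN C \<phi>. emb_equiv AM x y}"

definition diff_invariant :: "('m::topological_space, 'e::real_normed_vector) chart set \<Rightarrow>
    ('n::topological_space, 'f::real_normed_vector) chart set \<Rightarrow> ('m \<Rightarrow> real) normed_sp \<Rightarrow>
    ('n \<Rightarrow> 'd::euclidean_space) \<Rightarrow> (('m \<Rightarrow> 'n) \<Rightarrow> real) \<Rightarrow> bool" where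
  "diff_invariant AM AN C \<phi> f \<longleftrightarrow>
     (\<forall>x\<in>Emb AM AN C \<phi>. \<forall>y\<in>Emb AM AN C \<phi>. emb_equiv AM x y \<longrightarrow> f x = f y)"

text \<open>The function induced on classes by an invariant \<open>f\<close>.\<close>

definition on_classes :: "(('m \<Rightarrow> 'n) \<Rightarrow> real) \<Rightarrow> ('m \<Rightarrow> 'n) set \<Rightarrow> real" where
  "on_classes f c = the_elem (f ` c)"

section \<open>Charts and critical points\<close>

text \<open>\<open>Psi\<close> and \<open>Psi_tilde\<close> are the inverses of the charts \<open>\<Phi>\<^sub>x\<close> and of the charts of classes of
  embeddings.\<close>

definition Psi :: "('n::topological_space, 'f::real_normed_vector) chart set \<Rightarrow>
    ('n \<Rightarrow> 'd::real_normed_vector) \<Rightarrow> ('n \<Rightarrow> 'd \<Rightarrow> 'd \<Rightarrow> real) \<Rightarrow> ('m \<Rightarrow> 'n) \<Rightarrow> ('m \<Rightarrow> 'd) \<Rightarrow> 'm \<Rightarrow> 'n" where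
  "Psi AN \<phi> g x u = (\<lambda>p. exp_map AN \<phi> g (x p) (u p))"

definition Psi_tilde :: "('m::topological_space, 'e::real_normed_vector) chart set \<Rightarrow>
    ('n::topological_space, 'f::real_normed_vector) chart set \<Rightarrow> ('m \<Rightarrow> real) normed_sp \<Rightarrow>
    ('n \<Rightarrow> 'd::euclidean_space) \<Rightarrow> ('n \<Rightarrow> 'd \<Rightarrow> 'd \<Rightarrow> real) \<Rightarrow> ('m \<Rightarrow> 'n) \<Rightarrow> ('m \<Rightarrow> 'd) \<Rightarrow> ('m \<Rightarrow> 'n) set" where
  "Psi_tilde AM AN C \<phi> g x u = emb_class AM AN C \<phi> (Psi AN \<phi> g x u)"

text \<open>\<open>W\<close> is an admissible target of the chart \<open>\<Phi>\<^sub>x\<close>: its sections take values in an open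
  neighbourhood \<open>Q\<close> of the zero section of \<open>x\<^sup>*TN\<close> on which \<open>(p, v) \<mapsto> (p, exp v)\<close> is a
  diffeomorphism onto an open neighbourhood of the graph of \<open>x\<close>.\<close>

definition emb_chart :: "('m::topological_space, 'e::real_normed_vector) chart set \<Rightarrow>
    ('n::topological_space, 'f::real_normed_vector) chart set \<Rightarrow> ('m \<Rightarrow> real) normed_sp \<Rightarrow>
    ('n \<Rightarrow> 'd::euclidean_space) \<Rightarrow> ('n \<Rightarrow> 'd \<Rightarrow> 'd \<Rightarrow> real) \<Rightarrow> ('m \<Rightarrow> 'n) \<Rightarrow> ('m \<Rightarrow> 'd) set \<Rightarrow> bool" where
  "emb_chart AM AN C \<phi> g x W \<longleftrightarrow>
     openin (ntop (sections C (pullback_TN AN \<phi> x))) W \<and> 0 \<in> W \<and>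
     open_in_Emb AM AN C \<phi> (Psi AN \<phi> g x ` W) \<and>
     (\<exists>Q T. openin (top_of_set (total (pullback_TN AN \<phi> x))) Q \<and> UNIV \<times> {0} \<subseteq> Q \<and>
        (\<forall>(p, v)\<in>Q. \<exists>r. exp_rel AN \<phi> g (x p) v r) \<and>
        open T \<and> range (\<lambda>p. (p, x p)) \<subseteq> T \<and>
        Cdiffeo \<infinity> (prod_atlas AM std_atlas) (prod_atlas AM AN) Q T
          (\<lambda>(p, v). (p, exp_map AN \<phi> g (x p) v)) \<and>
        (\<forall>u\<in>W. \<forall>p. (p, u p) \<in> Q))"

text \<open>\<open>W\<close> is an admissible target of the chart around \<open>[x]\<close>: its sections take values in an open
  neighbourhood \<open>Q\<close> of the zero section of the normal bundle on which \<open>exp\<close> is a diffeomorphism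
  onto an open set \<open>V\<close> containing the image of \<open>x\<close>.\<close>

definition class_chart :: "('m::topological_space, 'e::real_normed_vector) chart set \<Rightarrow>
    ('n::topological_space, 'f::real_normed_vector) chart set \<Rightarrow> ('m \<Rightarrow> real) normed_sp \<Rightarrow>
    ('n \<Rightarrow> 'd::euclidean_space) \<Rightarrow> ('n \<Rightarrow> 'd \<Rightarrow> 'd \<Rightarrow> real) \<Rightarrow> ('m \<Rightarrow> 'n) \<Rightarrow> ('m \<Rightarrow> 'd) set \<Rightarrow> bool" where
  "class_chart AM AN C \<phi> g x W \<longleftrightarrow>
     openin (ntop (sections C (normal_bundle AM AN \<phi> g x))) W \<and> 0 \<in> W \<and>
     Psi AN \<phi> g x ` W \<subseteq> Emb AM AN C \<phi> \<and>
     inj_on (Psi_tilde AM AN C \<phi> g x) W \<and>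
     (\<exists>\<U>. open_in_Emb AM AN C \<phi> \<U> \<and> x \<in> \<U> \<and>
        Psi_tilde AM AN C \<phi> g x ` W = emb_class AM AN C \<phi> ` \<U>) \<and>
     (\<exists>Q V. openin (top_of_set (total (normal_bundle AM AN \<phi> g x))) Q \<and> UNIV \<times> {0} \<subseteq> Q \<and>
        (\<forall>(p, v)\<in>Q. \<exists>r. exp_rel AN \<phi> g (x p) v r) \<and>
        open V \<and> range x \<subseteq> V \<and>
        Cdiffeo \<infinity> (prod_atlas AM std_atlas) AN Q V (\<lambda>(p, v). exp_map AN \<phi> g (x p) v) \<and>
        (\<forall>u\<in>W. \<forall>p. (p, u p) \<in> Q))"

text \<open>Criticality of a class does not depend on the chart; it is required here for some chart.\<close>

definition critical_class :: "('m::topological_space, 'e::real_normed_vector) chart set \<Rightarrow>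
    ('n::topological_space, 'f::real_normed_vector) chart set \<Rightarrow> ('m \<Rightarrow> real) normed_sp \<Rightarrow>
    ('n \<Rightarrow> 'd::euclidean_space) \<Rightarrow> ('n \<Rightarrow> 'd \<Rightarrow> 'd \<Rightarrow> real) \<Rightarrow> (('m \<Rightarrow> 'n) \<Rightarrow> real) \<Rightarrow> ('m \<Rightarrow> 'n) set \<Rightarrow> bool" where
  "critical_class AM AN C \<phi> g f c \<longleftrightarrow>
     (\<exists>z W. Cembedding \<infinity> AM AN z \<and> class_chart AM AN C \<phi> g z W \<and>
        c \<in> Psi_tilde AM AN C \<phi> g z ` W \<and>
        has_fderiv (sections C (normal_bundle AM AN \<phi> g z)) real_sp W
          (on_classes f \<circ> Psi_tilde AM AN C \<phi> g z)
          (inv_into W (Psi_tilde AM AN C \<phi> g z) c) 0)"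

end

theory Submission
  imports Defs
begin

text \<open>An invariant function takes the value \<open>f y\<close> on the class of \<open>y\<close>, so \<open>f\<close> composed with the inverse
  of the chart around \<open>[x]\<close> is \<open>u \<mapsto> f (exp u)\<close> on small normal sections, which is the restriction of
  \<open>f\<close> composed with the inverse of \<open>\<Phi>\<^sub>x\<close>. Second derivatives restrict to closed subspaces, hence all
  that remains is that the latter function is twice differentiable at \<open>0\<close>. For this, \<open>exp\<close> is
  precomposed with a smooth fibre-preserving map of the pullback bundle into a small disc bundle that
  is the identity near the zero section; the resulting fibre map is defined on the whole bundle and
  induces a smooth map of spaces of sections, which is then composed with slice charts.\<close>

section \<open>Higher differentiability\<close>

lemma higher_differentiable_on_Suc_imp:
  "higher_differentiable_on S f (Suc k) \<Longrightarrow> higher_differentiable_on S f k"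
proof (induction k arbitrary: f)
  case 0
  then show ?case
    by (auto intro!: continuous_at_imp_continuous_on differentiable_imp_continuous_within)
qed simp

lemma higher_differentiable_on_subset:
  "higher_differentiable_on T f k \<Longrightarrow> S \<subseteq> T \<Longrightarrow> higher_differentiable_on S f k"
proof (induction k arbitrary: f)
  case 0
  then show ?case by (simp add: continuous_on_subset)
next
  case (Suc k)
  then show ?case unfolding higher_differentiable_on.simps by blast
qed

lemma frechet_derivative_cong_open:
  assumes "open S" "x \<in> S" "\<And>y. y \<in> S \<Longrightarrow> f y = g y"
  shows "frechet_derivative f (at x) = frechet_derivative g (at x)"
proof -
  have "(f has_derivative D) (at x) \<longleftrightarrow> (g has_derivative D) (at x)" for D
    using assms by (metis has_derivative_transform_within_open)
  then show ?thesis by (simp add: frechet_derivative_def)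
qed

lemma differentiable_cong_open:
  assumes "open S" "x \<in> S" "\<And>y. y \<in> S \<Longrightarrow> f y = g y" "f differentiable (at x)"
  shows "g differentiable (at x)"
proof -
  obtain D where "(f has_derivative D) (at x)"
    using assms(4) by (auto simp: differentiable_def)
  then have "(g has_derivative D) (at x)"
    by (rule has_derivative_transform_within_open) (use assms(1-3) in auto)
  then show ?thesis by (auto simp: differentiable_def)
qed

lemma higher_differentiable_on_cong:
  assumes "higher_differentiable_on S f k" "open S" "\<And>x. x \<in> S \<Longrightarrow> f x = g x"
  shows "higher_differentiable_on S g k"
  using assms
proof (induction k arbitrary: f g)
  case 0
  then show ?case by (metis continuous_on_cong higher_differentiable_on.simps(1))
next
  case (Suc k)
  note eq = Suc.prems(3)
  have "higher_differentiable_on S (\<lambda>x. frechet_derivative g (at x) v) k" for v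
  proof (rule Suc.IH[OF _ \<open>open S\<close>])
    show "higher_differentiable_on S (\<lambda>x. frechet_derivative f (at x) v) k"
      using Suc.prems(1) by simp
    show "frechet_derivative f (at x) v = frechet_derivative g (at x) v" if "x \<in> S" for x
      by (rule fun_cong[OF frechet_derivative_cong_open[OF \<open>open S\<close> that eq]])
  qed
  moreover have "g differentiable (at x)" if "x \<in> S" for x
    by (rule differentiable_cong_open[OF \<open>open S\<close> that eq]) (use Suc.prems(1) that in simp_all)
  ultimately show ?case by simp
qed

lemma higher_differentiable_on_SucI:
  assumes "open S" "\<And>x. x \<in> S \<Longrightarrow> (f has_derivative D x) (at x)"
    and "\<And>v. higher_differentiable_on S (\<lambda>x. D x v) k"
  shows "higher_differentiable_on S f (Suc k)"
proof -
  have "frechet_derivative f (at x) = D x" if "x \<in> S" for x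
    using assms(2)[OF that] by (metis frechet_derivative_at)
  then have "higher_differentiable_on S (\<lambda>x. frechet_derivative f (at x) v) k" for v
    by (intro higher_differentiable_on_cong[OF assms(3)[of v] assms(1)]) simp
  with assms(2) show ?thesis by (auto simp: differentiable_def)
qed

lemma higher_differentiable_on_has_derivative:
  assumes "higher_differentiable_on S f (Suc k)" "x \<in> S"
  shows "(f has_derivative frechet_derivative f (at x)) (at x)"
proof -
  have "f differentiable (at x)" using assms by simp
  then show ?thesis by (rule frechet_derivative_works[THEN iffD1])
qed

lemma higher_differentiable_on_local:
  assumes "\<And>x. x \<in> S \<Longrightarrow> \<exists>T. open T \<and> x \<in> T \<and> higher_differentiable_on T f k"
  shows "higher_differentiable_on S f k"
  using assms
proof (induction k arbitrary: f)
  case 0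
  have "continuous (at x) f" if "x \<in> S" for x
  proof -
    obtain T where "open T" "x \<in> T" "continuous_on T f"
      using 0(1)[OF \<open>x \<in> S\<close>] by auto
    then show ?thesis by (metis continuous_on_eq_continuous_at)
  qed
  then show ?case by (simp add: continuous_at_imp_continuous_on)
next
  case (Suc k)
  have "higher_differentiable_on S (\<lambda>x. frechet_derivative f (at x) v) k" for v
  proof (rule Suc.IH)
    fix x assume "x \<in> S"
    then obtain T where "open T" "x \<in> T" "higher_differentiable_on T f (Suc k)"
      using Suc.prems(1) by blast
    then show "\<exists>T. open T \<and> x \<in> T \<and> higher_differentiable_on T (\<lambda>x. frechet_derivative f (at x) v) k"
      by auto
  qed
  moreover have "f differentiable (at x)" if "x \<in> S" for x
    using Suc.prems(1)[OF that] by auto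
  ultimately show ?case by simp
qed

lemma higher_differentiable_on_const: "open S \<Longrightarrow> higher_differentiable_on S (\<lambda>x. c) k"
proof (induction k arbitrary: c)
  case (Suc k)
  then show ?case by (intro higher_differentiable_on_SucI[of S _ "\<lambda>x v. 0"]) auto
qed simp

lemma higher_differentiable_on_add:
  assumes "open S" "higher_differentiable_on S f k" "higher_differentiable_on S g k"
  shows "higher_differentiable_on S (\<lambda>x. f x + g x) k"
  using assms
proof (induction k arbitrary: f g)
  case 0
  then show ?case by (auto intro: continuous_intros)
next
  case (Suc k)
  show ?case
  proof (rule higher_differentiable_on_SucI[OF \<open>open S\<close>])
    show "((\<lambda>x. f x + g x) has_derivative
        (\<lambda>v. frechet_derivative f (at x) v + frechet_derivative g (at x) v)) (at x)" if "x \<in> S" for x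
      using Suc.prems that by (intro derivative_intros higher_differentiable_on_has_derivative) auto
  qed (use Suc in auto)
qed

lemma higher_differentiable_on_sum:
  assumes "open S" "finite I" "\<And>i. i \<in> I \<Longrightarrow> higher_differentiable_on S (f i) k"
  shows "higher_differentiable_on S (\<lambda>x. \<Sum>i\<in>I. f i x) k"
  using assms(2,3)
proof (induction I)
  case empty
  then show ?case using higher_differentiable_on_const[OF assms(1)] by simp
next
  case (insert i I)
  then show ?case by (simp add: higher_differentiable_on_add[OF assms(1)])
qed

lemma higher_differentiable_on_bounded_linear_left:
  assumes "bounded_linear L" "open S" "higher_differentiable_on S f k"
  shows "higher_differentiable_on S (\<lambda>x. L (f x)) k"
  using assms(2,3)
proof (induction k arbitrary: f)
  case 0
  then show ?case
    using assms(1) by (simp add: bounded_linear.continuous_on)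
next
  case (Suc k)
  show ?case
  proof (rule higher_differentiable_on_SucI[OF \<open>open S\<close>])
    show "((\<lambda>x. L (f x)) has_derivative (\<lambda>v. L (frechet_derivative f (at x) v))) (at x)"
      if "x \<in> S" for x
      using Suc.prems that
      by (intro bounded_linear.has_derivative[OF assms(1)] higher_differentiable_on_has_derivative) auto
  qed (use Suc in auto)
qed

lemma higher_differentiable_on_bounded_linear:
  assumes "bounded_linear L" "open S"
  shows "higher_differentiable_on S L k"
proof (cases k)
  case 0
  then show ?thesis using assms(1) by (simp add: linear_continuous_on)
next
  case (Suc j)
  show ?thesis unfolding Suc
    by (rule higher_differentiable_on_SucI[OF assms(2), of _ "\<lambda>x. L"])
      (use assms in \<open>auto intro: bounded_linear_imp_has_derivative higher_differentiable_on_const\<close>)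
qed

lemma higher_differentiable_on_bilinear:
  assumes "bounded_bilinear b" "open S" "higher_differentiable_on S f k" "higher_differentiable_on S g k"
  shows "higher_differentiable_on S (\<lambda>x. b (f x) (g x)) k"
  using assms(2-)
proof (induction k arbitrary: f g)
  case 0
  then show ?case
    using bounded_bilinear.continuous_on[OF assms(1)] by auto
next
  case (Suc k)
  show ?case
  proof (rule higher_differentiable_on_SucI[OF \<open>open S\<close>])
    show "((\<lambda>x. b (f x) (g x)) has_derivative
        (\<lambda>v. b (f x) (frechet_derivative g (at x) v) + b (frechet_derivative f (at x) v) (g x))) (at x)"
      if "x \<in> S" for x
      using Suc.prems that
      by (intro bounded_bilinear.FDERIV[OF assms(1)] higher_differentiable_on_has_derivative) auto
    show "higher_differentiable_on S
        (\<lambda>x. b (f x) (frechet_derivative g (at x) v) + b (frechet_derivative f (at x) v) (g x)) k" for v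
      using Suc.prems by (intro higher_differentiable_on_add Suc.IH)
        (auto intro: higher_differentiable_on_Suc_imp)
  qed
qed

text \<open>The model spaces need not be of class \<open>euclidean_space\<close>; all that the chain rule for higher
  derivatives requires is a finite basis with continuous coordinates.\<close>

definition coordinates :: "'a::real_normed_vector set \<Rightarrow> ('a \<Rightarrow> 'a \<Rightarrow> real) \<Rightarrow> bool" where
  "coordinates B c \<longleftrightarrow> finite B \<and> (\<forall>b\<in>B. bounded_linear (c b)) \<and> (\<forall>v. (\<Sum>b\<in>B. c b v *\<^sub>R b) = v)"

lemma coordinates_euclidean: "coordinates (Basis :: 'a::euclidean_space set) (\<lambda>b v. v \<bullet> b)"
  unfolding coordinates_def
proof (intro conjI ballI allI)
  show "bounded_linear (\<lambda>v. v \<bullet> b)" for b :: 'a by (rule bounded_linear_inner_left)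
  show "(\<Sum>b\<in>Basis. (v \<bullet> b) *\<^sub>R b) = v" for v :: 'a by (rule euclidean_representation)
qed (rule finite_Basis)

lemma coordinates_real_inner:
  fixes B :: "'a::real_inner set"
  assumes "finite B" "span B = UNIV"
  obtains B' :: "'a set" and c where "coordinates B' c"
proof -
  obtain D :: "'a set" where D: "finite D" "span D = UNIV" "pairwise orthogonal D"
    using basis_orthogonal[OF assms(1)] assms(2) by auto
  define c where "c b v = (v \<bullet> b) / (b \<bullet> b)" for b v :: 'a
  have "(\<Sum>b\<in>D. c b v *\<^sub>R b) = v" for v
  proof -
    define w where "w = v - (\<Sum>b\<in>D. c b v *\<^sub>R b)"
    have "w \<bullet> d = 0" if "d \<in> D" for d
    proof -
      have "(\<Sum>b\<in>D. c b v * (b \<bullet> d)) = (\<Sum>b\<in>D. if b = d then c d v * (d \<bullet> d) else 0)"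
        using D(3) that by (intro sum.cong) (auto simp: pairwise_def orthogonal_def)
      also have "\<dots> = v \<bullet> d"
        using D(1) that by (simp add: c_def)
      finally show ?thesis by (simp add: w_def inner_diff_left inner_sum_left)
    qed
    moreover have "w \<in> span D" by (simp add: D)
    ultimately have "orthogonal w w"
      by (metis orthogonal_def orthogonal_to_span)
    then show ?thesis by (simp add: orthogonal_def w_def)
  qed
  moreover have "bounded_linear (c b)" for b
    unfolding c_def by (intro bounded_linear_divide bounded_linear_compose[OF _ bounded_linear_inner_left] bounded_linear_const_mult) 
  ultimately have "coordinates D c" using D by (simp add: coordinates_def)
  then show ?thesis by (rule that)
qed

lemma coordinates_prod:
  fixes B :: "'a::real_normed_vector set" and D :: "'b::real_normed_vector set"
  assumes "coordinates B c" "coordinates D d"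
  obtains B' :: "('a \<times> 'b) set" and c' where "coordinates B' c'"
proof -
  define e where "e z v = (if z \<in> (\<lambda>b. (b, 0)) ` B then c (fst z) (fst v) else 0) +
     (if z \<in> Pair 0 ` D then d (snd z) (snd v) else 0)" for z v :: "'a \<times> 'b"
  let ?E = "(\<lambda>b. (b, 0)) ` B \<union> Pair 0 ` D"
  have fin: "finite ?E" using assms by (simp add: coordinates_def)
  have "(\<Sum>z\<in>?E. e z v *\<^sub>R z) = v" for v
  proof -
    have "(\<Sum>z\<in>?E. e z v *\<^sub>R z) =
        (\<Sum>z\<in>?E. if z \<in> (\<lambda>b. (b, 0)) ` B then c (fst z) (fst v) *\<^sub>R z else 0) +
        (\<Sum>z\<in>?E. if z \<in> Pair 0 ` D then d (snd z) (snd v) *\<^sub>R z else 0)"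
      unfolding e_def by (subst sum.distrib[symmetric]) (rule sum.cong, auto simp: scaleR_add_left)
    also have "\<dots> = (\<Sum>z\<in>(\<lambda>b. (b, 0)) ` B. c (fst z) (fst v) *\<^sub>R z) +
        (\<Sum>z\<in>Pair 0 ` D. d (snd z) (snd v) *\<^sub>R z)"
      by (intro arg_cong2[of _ _ _ _ "(+)"] sum.mono_neutral_cong_right fin) auto
    also have "\<dots> = (\<Sum>b\<in>B. c b (fst v) *\<^sub>R (b, 0)) + (\<Sum>b\<in>D. d b (snd v) *\<^sub>R (0, b))"
      by (subst (1 2) sum.reindex) (auto simp: inj_on_def)
    also have "\<dots> = v"
      using assms by (simp add: prod_eq_iff coordinates_def fst_sum snd_sum)
    finally show ?thesis .
  qed
  moreover have "bounded_linear (e z)" if "z \<in> ?E" for z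
  proof -
    have "bounded_linear (\<lambda>v. c b (fst v))" if "b \<in> B" for b
      by (rule bounded_linear_compose[OF _ bounded_linear_fst]) (use assms that in \<open>auto simp: coordinates_def\<close>)
    moreover have "bounded_linear (\<lambda>v. d b (snd v))" if "b \<in> D" for b
      by (rule bounded_linear_compose[OF _ bounded_linear_snd]) (use assms that in \<open>auto simp: coordinates_def\<close>)
    ultimately show ?thesis
      unfolding e_def
      by (intro bounded_linear_add; cases "z \<in> (\<lambda>b. (b, 0)) ` B"; cases "z \<in> Pair 0 ` D")
        (auto intro: bounded_linear_zero)
  qed
  ultimately have "coordinates ?E e" using fin by (simp add: coordinates_def)
  then show ?thesis by (rule that)
qed

lemma higher_differentiable_on_compose:
  fixes g :: "'a::real_normed_vector \<Rightarrow> 'b::real_normed_vector" and B :: "'b set"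
    and f :: "'b \<Rightarrow> 'c::real_normed_vector"
  assumes "coordinates B c" "open S" "open T" "g ` S \<subseteq> T"
    and "higher_differentiable_on T f k" "higher_differentiable_on S g k"
  shows "higher_differentiable_on S (\<lambda>x. f (g x)) k"
  using assms(5,6)
proof (induction k arbitrary: f)
  case 0
  then show ?case using assms(4) continuous_on_compose2 by fastforce
next
  case (Suc k)
  define D where "D x = frechet_derivative g (at x)" for x
  define E where "E y = frechet_derivative f (at y)" for y
  have D: "(g has_derivative D x) (at x)" if "x \<in> S" for x
    unfolding D_def using Suc.prems(2) that by (rule higher_differentiable_on_has_derivative)
  have E: "(f has_derivative E (g x)) (at (g x))" if "x \<in> S" for x
    unfolding E_def using assms(4) that
    by (intro higher_differentiable_on_has_derivative[OF Suc.prems(1)]) blast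
  have D_smooth: "higher_differentiable_on S (\<lambda>x. D x v) k" for v
    using Suc.prems(2) by (simp add: D_def)
  have E_smooth: "higher_differentiable_on T (\<lambda>y. E y b) k" for b
    using Suc.prems(1) by (simp add: E_def)
  have "((\<lambda>x. f (g x)) has_derivative (\<lambda>v. \<Sum>b\<in>B. c b (D x v) *\<^sub>R E (g x) b)) (at x)"
    if x: "x \<in> S" for x
  proof -
    have lin: "linear (E (g x))" using E[OF x] by (rule has_derivative_linear)
    have "E (g x) v = (\<Sum>b\<in>B. c b v *\<^sub>R E (g x) b)" for v
    proof -
      have "E (g x) v = E (g x) (\<Sum>b\<in>B. c b v *\<^sub>R b)"
        using assms(1) by (simp add: coordinates_def)
      then show ?thesis by (simp add: linear_sum[OF lin] linear_scale[OF lin])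
    qed
    then have "(\<lambda>v. E (g x) (D x v)) = (\<lambda>v. \<Sum>b\<in>B. c b (D x v) *\<^sub>R E (g x) b)" by (rule ext)
    then show ?thesis using has_derivative_compose[where f = g and g = f, OF D[OF x] E[OF x]] by simp
  qed
  moreover have "higher_differentiable_on S (\<lambda>x. \<Sum>b\<in>B. c b (D x v) *\<^sub>R E (g x) b) k" for v
  proof (rule higher_differentiable_on_sum[OF \<open>open S\<close>])
    fix b assume "b \<in> B"
    then have cb: "bounded_linear (c b)" using assms(1) by (simp add: coordinates_def)
    have 1: "higher_differentiable_on S (\<lambda>x. c b (D x v)) k"
      by (rule higher_differentiable_on_bounded_linear_left[OF cb \<open>open S\<close> D_smooth])
    have 2: "higher_differentiable_on S (\<lambda>x. E (g x) b) k"
      by (rule Suc.IH[OF E_smooth higher_differentiable_on_Suc_imp[OF Suc.prems(2)]])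
    show "higher_differentiable_on S (\<lambda>x. c b (D x v) *\<^sub>R E (g x) b) k"
      by (rule higher_differentiable_on_bilinear[OF bounded_bilinear_scaleR \<open>open S\<close> 1 2])
  qed (use assms(1) in \<open>simp add: coordinates_def\<close>)
  ultimately show ?case by (rule higher_differentiable_on_SucI[OF \<open>open S\<close>])
qed

lemma higher_differentiable_on_real_derivative:
  fixes f :: "real \<Rightarrow> real"
  assumes "open S" "\<And>x. x \<in> S \<Longrightarrow> (f has_real_derivative f' x) (at x)" "higher_differentiable_on S f' k"
  shows "higher_differentiable_on S f (Suc k)"
proof (rule higher_differentiable_on_SucI[OF assms(1)])
  show "(f has_derivative (\<lambda>v. f' x * v)) (at x)" if "x \<in> S" for x
    using assms(2)[OF that] by (simp add: has_field_derivative_def)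
  show "higher_differentiable_on S (\<lambda>x. f' x * v) k" for v
    by (rule higher_differentiable_on_bounded_linear_left[OF bounded_linear_mult_left assms(1,3)])
qed

lemma higher_differentiable_on_exp: "open S \<Longrightarrow> higher_differentiable_on S (exp :: real \<Rightarrow> real) k"
proof (induction k)
  case 0
  then show ?case by (simp add: continuous_on_exp)
next
  case (Suc k)
  show ?case
    by (rule higher_differentiable_on_real_derivative[of S exp exp]) (use Suc in \<open>auto intro: DERIV_exp\<close>)
qed

definition flat :: "nat \<Rightarrow> real \<Rightarrow> real" where
  "flat n t = (if t \<le> 0 then 0 else (1 / t) ^ n * exp (- (1 / t)))"

lemma flat_has_real_derivative:
  "(flat n has_real_derivative flat (n + 2) t - real n * flat (n + 1) t) (at t)"
proof -
  consider "t < 0" | "t > 0" | "t = 0" by linarith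
  then show ?thesis
  proof cases
    case 1
    have "(flat n has_real_derivative 0) (at t)"
      by (rule has_field_derivative_transform_within_open[of "\<lambda>_. 0" _ _ "{..<0}"])
        (use 1 in \<open>auto simp: flat_def\<close>)
    then show ?thesis using 1 by (simp add: flat_def)
  next
    case 2
    have "((\<lambda>t. (1 / t) ^ n * exp (- (1 / t))) has_real_derivative
        flat (n + 2) t - real n * flat (n + 1) t) (at t)"
      using 2 by (auto intro!: derivative_eq_intros
          simp: flat_def field_simps power2_eq_square) (cases n; simp add: field_simps)
    then show ?thesis
      by (rule has_field_derivative_transform_within_open[of _ _ _ "{0<..}"])
        (use 2 in \<open>auto simp: flat_def\<close>)
  next
    case 3
    have "((\<lambda>y. y ^ (n + 1) / exp y) \<longlongrightarrow> (0::real)) at_top"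
      by (rule tendsto_power_div_exp_0)
    then have "((\<lambda>h. inverse h ^ (n + 1) / exp (inverse h)) \<longlongrightarrow> (0::real)) (at_right 0)"
      by (rule filterlim_compose) (rule filterlim_inverse_at_top_right)
    then have "((\<lambda>h. flat n h / h) \<longlongrightarrow> 0) (at_right 0)"
      by (rule Lim_transform_eventually)
        (auto simp: eventually_at_filter flat_def exp_minus field_simps)
    moreover have "((\<lambda>h. flat n h / h) \<longlongrightarrow> 0) (at_left 0)"
      by (rule Lim_transform_eventually[of "\<lambda>_. 0"]) (auto simp: eventually_at_filter flat_def)
    ultimately have "((\<lambda>h. flat n h / h) \<longlongrightarrow> 0) (at 0)"
      by (simp add: filterlim_split_at)
    then show ?thesis using 3 by (simp add: DERIV_def) (simp add: flat_def)
  qed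
qed

lemma higher_differentiable_on_flat: "higher_differentiable_on UNIV (flat n) k"
proof (induction k arbitrary: n)
  case 0
  then show ?case
    by (auto intro!: continuous_at_imp_continuous_on DERIV_isCont flat_has_real_derivative)
next
  case (Suc k)
  have "higher_differentiable_on UNIV (\<lambda>t. flat (n + 2) t + (- real n) * flat (n + 1) t) k"
    by (intro higher_differentiable_on_add Suc open_UNIV
        higher_differentiable_on_bounded_linear_left[OF bounded_linear_mult_right])
  then show ?case
    by (intro higher_differentiable_on_real_derivative[OF open_UNIV flat_has_real_derivative]) simp
qed

text \<open>With \<open>s\<close> the square of the rescaled norm, the factor \<open>exp (- s * flat 0 (s - 1))\<close> equals 1
  for \<open>s \<le> 1\<close> and decays faster than \<open>1 / s\<close>, so its product with \<open>v\<close> stays bounded.\<close>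

lemma smooth_retraction_to_ball:
  assumes "(r::real) > 0"
  obtains \<beta> :: "'a::euclidean_space \<Rightarrow> 'a" and \<epsilon> where
    "smooth_on \<infinity> UNIV \<beta>" "\<epsilon> > 0" "\<And>v. norm v < \<epsilon> \<Longrightarrow> \<beta> v = v"
    "\<And>v. norm (\<beta> v) < r" "\<And>v. \<exists>c. \<beta> v = c *\<^sub>R v"
proof -
  define \<epsilon> where "\<epsilon> = r / 4"
  define s where "s v = inverse (\<epsilon>\<^sup>2) * (v \<bullet> v)" for v :: 'a
  define \<rho> where "\<rho> t = exp (- (t * flat 0 (t - 1)))" for t
  define \<beta> where "\<beta> v = \<rho> (s v) *\<^sub>R v" for v
  have \<epsilon>: "\<epsilon> > 0" using assms by (simp add: \<epsilon>_def)
  have s: "s v = (norm v / \<epsilon>)\<^sup>2" for v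
    by (simp add: s_def power_divide field_simps dot_square_norm)
  have sm_s: "higher_differentiable_on UNIV s k" for k
    unfolding s_def
    by (intro higher_differentiable_on_bounded_linear_left[OF bounded_linear_mult_right]
        higher_differentiable_on_bilinear[OF bounded_bilinear_inner] open_UNIV
        higher_differentiable_on_bounded_linear[OF bounded_linear_ident])
  have sub: "higher_differentiable_on UNIV (\<lambda>t::real. t - 1) k" for k
    using higher_differentiable_on_add[OF open_UNIV
        higher_differentiable_on_bounded_linear[OF bounded_linear_ident open_UNIV]
        higher_differentiable_on_const[OF open_UNIV, of "-1"]] by simp
  have "higher_differentiable_on UNIV (\<lambda>t::real. t * flat 0 (t - 1)) k" for k
    by (intro higher_differentiable_on_bilinear[OF bounded_bilinear_mult] open_UNIV
        higher_differentiable_on_bounded_linear[OF bounded_linear_ident]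
        higher_differentiable_on_compose[OF coordinates_euclidean _ _ subset_UNIV higher_differentiable_on_flat sub])
  then have "higher_differentiable_on UNIV \<rho> k" for k
    unfolding \<rho>_def
    by (intro higher_differentiable_on_compose[OF coordinates_euclidean _ _ subset_UNIV higher_differentiable_on_exp]
        higher_differentiable_on_bounded_linear_left[OF bounded_linear_minus[OF bounded_linear_ident]] open_UNIV)
  then have "higher_differentiable_on UNIV \<beta> k" for k
    unfolding \<beta>_def
    by (intro higher_differentiable_on_bilinear[OF bounded_bilinear_scaleR] open_UNIV
        higher_differentiable_on_bounded_linear[OF bounded_linear_ident]
        higher_differentiable_on_compose[OF coordinates_euclidean _ _ subset_UNIV _ sm_s])
  then have "smooth_on \<infinity> UNIV \<beta>" by (simp add: smooth_on_def)
  moreover have "\<beta> v = v" if "norm v < \<epsilon>" for v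
  proof -
    have "s v \<le> 1" using that \<epsilon> by (simp add: s power_le_one)
    then show ?thesis by (simp add: \<beta>_def \<rho>_def flat_def)
  qed
  moreover have "norm (\<beta> v) < r" for v
  proof -
    define t where "t = norm v / \<epsilon>"
    have t: "t \<ge> 0" "norm v = \<epsilon> * t" "s v = t\<^sup>2" using \<epsilon> by (auto simp: t_def s)
    have "\<rho> (t\<^sup>2) * t < 4"
    proof (cases "t < 2")
      case True
      have "flat 0 (t\<^sup>2 - 1) \<ge> 0" by (simp add: flat_def)
      then have "\<rho> (t\<^sup>2) \<le> 1" by (simp add: \<rho>_def)
      then have "\<rho> (t\<^sup>2) * t \<le> 1 * t" using t by (intro mult_right_mono)
      then show ?thesis using True by simp
    next
      case False
      have t4: "t\<^sup>2 \<ge> 4" using power_mono[of 2 t 2] False by simp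
      have "1 / 3 \<le> exp (-1 :: real)"
        using e_less_272 by (simp add: exp_minus field_simps)
      also have "\<dots> \<le> exp (- (1 / (t\<^sup>2 - 1)))"
        using t4 by (intro exp_le_cancel_iff[THEN iffD2]) (simp add: field_simps)
      finally have fl: "flat 0 (t\<^sup>2 - 1) \<ge> 1 / 3"
        using t4 by (simp add: flat_def)
      have "t / 3 < t * (t / 3)" using False by (simp add: field_simps)
      also have "\<dots> \<le> t\<^sup>2 * flat 0 (t\<^sup>2 - 1)"
        using mult_left_mono[OF fl, of "t\<^sup>2"] by (simp add: power2_eq_square)
      also have "\<dots> < exp (t\<^sup>2 * flat 0 (t\<^sup>2 - 1))"
        using exp_ge_add_one_self[of "t\<^sup>2 * flat 0 (t\<^sup>2 - 1)"] by linarith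
      finally have "t < 3 * exp (t\<^sup>2 * flat 0 (t\<^sup>2 - 1))" by simp
      then have "\<rho> (t\<^sup>2) * t < 3" by (simp add: \<rho>_def exp_minus field_simps)
      then show ?thesis by simp
    qed
    moreover have "norm (\<beta> v) = \<epsilon> * (\<rho> (t\<^sup>2) * t)"
      unfolding \<beta>_def by (simp add: t \<rho>_def)
    ultimately have "norm (\<beta> v) < \<epsilon> * 4" using \<epsilon> by simp
    then show ?thesis by (simp add: \<epsilon>_def)
  qed
  moreover have "\<exists>c. \<beta> v = c *\<^sub>R v" for v by (auto simp: \<beta>_def)
  ultimately show ?thesis using that \<epsilon> by blast
qed

section \<open>Normed spaces on a carrier\<close>

definition normed :: "'a::real_vector normed_sp \<Rightarrow> bool" where
  "normed X \<longleftrightarrow>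
     subspace (vecs X) \<and>
     (\<forall>u\<in>vecs X. 0 \<le> nrm X u \<and> (nrm X u = 0 \<longleftrightarrow> u = 0)) \<and>
     (\<forall>u\<in>vecs X. \<forall>a. nrm X (a *\<^sub>R u) = \<bar>a\<bar> * nrm X u) \<and>
     (\<forall>u\<in>vecs X. \<forall>v\<in>vecs X. nrm X (u + v) \<le> nrm X u + nrm X v)"

lemma banach_space_imp_normed: "banach_space X \<Longrightarrow> normed X"
  by (simp add: banach_space_def normed_def)

context
  fixes X :: "'a::real_vector normed_sp"
  assumes X: "normed X"
begin

lemma vecs_zero: "0 \<in> vecs X"
  and vecs_add: "u \<in> vecs X \<Longrightarrow> v \<in> vecs X \<Longrightarrow> u + v \<in> vecs X"
  and vecs_scale: "u \<in> vecs X \<Longrightarrow> a *\<^sub>R u \<in> vecs X"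
  and vecs_diff: "u \<in> vecs X \<Longrightarrow> v \<in> vecs X \<Longrightarrow> u - v \<in> vecs X"
  using X unfolding normed_def by (auto simp: subspace_0 subspace_add subspace_scale subspace_diff)

lemma nrm_nonneg: "u \<in> vecs X \<Longrightarrow> 0 \<le> nrm X u"
  and nrm_eq_0: "u \<in> vecs X \<Longrightarrow> nrm X u = 0 \<longleftrightarrow> u = 0"
  and nrm_scale: "u \<in> vecs X \<Longrightarrow> nrm X (a *\<^sub>R u) = \<bar>a\<bar> * nrm X u"
  and nrm_triangle: "u \<in> vecs X \<Longrightarrow> v \<in> vecs X \<Longrightarrow> nrm X (u + v) \<le> nrm X u + nrm X v"
  using X unfolding normed_def by blast+

lemma nrm_zero: "nrm X 0 = 0"
  using nrm_eq_0 vecs_zero by blast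

lemma nrm_minus_commute: "u \<in> vecs X \<Longrightarrow> v \<in> vecs X \<Longrightarrow> nrm X (u - v) = nrm X (v - u)"
  using nrm_scale[of "v - u" "-1"] vecs_diff by simp

lemma nrm_triangle_sub: "u \<in> vecs X \<Longrightarrow> v \<in> vecs X \<Longrightarrow> nrm X (u - v) \<le> nrm X u + nrm X v"
  using nrm_triangle[of u "- v"] nrm_scale[of v "-1"] vecs_scale[of v "-1"] by simp

lemma ndist_metric: "Metric_space (vecs X) (ndist X)"
proof
  fix u v w
  show "0 \<le> ndist X u v" by (simp add: ndist_def nrm_nonneg vecs_diff)
  show "ndist X u v = ndist X v u" by (simp add: ndist_def nrm_minus_commute)
  show "ndist X u v = 0 \<longleftrightarrow> u = v" if "u \<in> vecs X" "v \<in> vecs X"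
    using that by (simp add: ndist_def nrm_eq_0 vecs_diff)
  show "ndist X u w \<le> ndist X u v + ndist X v w" if "u \<in> vecs X" "v \<in> vecs X" "w \<in> vecs X"
    using that nrm_triangle[of "u - v" "v - w"] by (simp add: ndist_def vecs_diff)
qed

lemma openin_ntop:
  "openin (ntop X) W \<longleftrightarrow>
     W \<subseteq> vecs X \<and> (\<forall>u\<in>W. \<exists>d>0. \<forall>h\<in>vecs X. nrm X h < d \<longrightarrow> u + h \<in> W)" (is "_ \<longleftrightarrow> ?R")
proof -
  interpret Metric_space "vecs X" "ndist X" by (rule ndist_metric)
  have "mball u r \<subseteq> W \<longleftrightarrow> (\<forall>h\<in>vecs X. nrm X h < r \<longrightarrow> u + h \<in> W)"
    if u: "u \<in> vecs X" for u r
  proof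
    assume l: "mball u r \<subseteq> W"
    show "\<forall>h\<in>vecs X. nrm X h < r \<longrightarrow> u + h \<in> W"
    proof (intro ballI impI)
      fix h assume h: "h \<in> vecs X" "nrm X h < r"
      then have "u + h \<in> mball u r"
        using u nrm_minus_commute[of u "u + h"] by (simp add: ndist_def vecs_add)
      then show "u + h \<in> W" using l by blast
    qed
  next
    assume r: "\<forall>h\<in>vecs X. nrm X h < r \<longrightarrow> u + h \<in> W"
    show "mball u r \<subseteq> W"
    proof
      fix v assume v: "v \<in> mball u r"
      then have "v - u \<in> vecs X" "nrm X (v - u) < r"
        using u nrm_minus_commute[of u v] by (auto simp: ndist_def vecs_diff)
      then have "u + (v - u) \<in> W" using r by blast
      then show "v \<in> W" by simp
    qed
  qed
  then show ?thesis unfolding ntop_def openin_mtopology by (meson subset_iff)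
qed

lemma openin_ntop_vecs: "openin (ntop X) (vecs X)"
  unfolding openin_ntop using vecs_add by (meson order_refl zero_less_one)

lemma openin_ntop_ball: "openin (ntop X) {u \<in> vecs X. nrm X u < r}"
  unfolding openin_ntop
proof (intro conjI ballI)
  fix u assume u: "u \<in> {u \<in> vecs X. nrm X u < r}"
  have "u + h \<in> {u \<in> vecs X. nrm X u < r}" if h: "h \<in> vecs X" "nrm X h < r - nrm X u" for h
    using u nrm_triangle[of u h] vecs_add[of u h] h by simp
  then show "\<exists>d>0. \<forall>h\<in>vecs X. nrm X h < d \<longrightarrow> u + h \<in> {u \<in> vecs X. nrm X u < r}"
    using u by (intro exI[of _ "r - nrm X u"]) simp
qed auto

end

lemma normed_real_sp: "normed real_sp"
  by (simp add: normed_def real_sp_def abs_mult abs_triangle_ineq)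

lemma vecs_real_sp [simp]: "vecs real_sp = UNIV"
  by (simp add: real_sp_def)

lemma normed_restrict_sp:
  assumes "normed X" "subspace (vecs X \<inter> G)"
  shows "normed (restrict_sp X G)"
  using assms unfolding normed_def restrict_sp_def by simp

section \<open>Bounded linear maps\<close>

context
  fixes X :: "'a::real_vector normed_sp" and Y :: "'b::real_vector normed_sp"
  assumes X: "normed X" and Y: "normed Y"
begin

lemma blin_iff:
  "L \<in> vecs (blin X Y) \<longleftrightarrow> (\<forall>v. v \<notin> vecs X \<longrightarrow> L v = 0) \<and> (\<forall>v\<in>vecs X. L v \<in> vecs Y) \<and>
     (\<forall>v\<in>vecs X. \<forall>w\<in>vecs X. \<forall>a. L (a *\<^sub>R v + w) = a *\<^sub>R L v + L w) \<and>
     (\<exists>K. \<forall>v\<in>vecs X. nrm Y (L v) \<le> K * nrm X v)"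
  by (simp add: blin_def)

lemma blinI:
  assumes "\<And>v. v \<notin> vecs X \<Longrightarrow> L v = 0" "\<And>v. v \<in> vecs X \<Longrightarrow> L v \<in> vecs Y"
    "\<And>v w. v \<in> vecs X \<Longrightarrow> w \<in> vecs X \<Longrightarrow> L (v + w) = L v + L w"
    "\<And>v a. v \<in> vecs X \<Longrightarrow> L (a *\<^sub>R v) = a *\<^sub>R L v"
    "\<And>v. v \<in> vecs X \<Longrightarrow> nrm Y (L v) \<le> K * nrm X v"
  shows "L \<in> vecs (blin X Y)"
  unfolding blin_iff using assms vecs_scale[OF X] by (intro conjI allI impI ballI exI[of _ K]) simp_all

lemma blin_outside: "L \<in> vecs (blin X Y) \<Longrightarrow> v \<notin> vecs X \<Longrightarrow> L v = 0"
  by (simp add: blin_iff)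

lemma blin_zero: 
  assumes "L \<in> vecs (blin X Y)"
  shows "L 0 = 0"
proof -
  have "L (1 *\<^sub>R 0 + 0) = 1 *\<^sub>R L 0 + L 0" using assms vecs_zero[OF X] unfolding blin_iff by blast
  then show ?thesis by simp
qed

lemma blin_add: 
  assumes "L \<in> vecs (blin X Y)" "v \<in> vecs X" "w \<in> vecs X"
  shows "L (v + w) = L v + L w"
proof -
  have "L (1 *\<^sub>R v + w) = 1 *\<^sub>R L v + L w" using assms unfolding blin_iff by blast
  then show ?thesis by simp
qed

lemma blin_scale: 
  assumes "L \<in> vecs (blin X Y)" "v \<in> vecs X"
  shows "L (a *\<^sub>R v) = a *\<^sub>R L v"
proof -
  have "L (a *\<^sub>R v + 0) = a *\<^sub>R L v + L 0" using assms vecs_zero[OF X] unfolding blin_iff by blast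
  then show ?thesis by (simp add: blin_zero[OF assms(1)])
qed

lemma blin_diff: 
  assumes "L \<in> vecs (blin X Y)" "v \<in> vecs X" "w \<in> vecs X"
  shows "L (v - w) = L v - L w"
  using blin_add[OF assms(1), of v "(-1) *\<^sub>R w"] blin_scale[OF assms(1,3), of "-1"] assms vecs_scale[OF X, of w "-1"]
  by simp

lemma blin_in: "L \<in> vecs (blin X Y) \<Longrightarrow> L v \<in> vecs Y"
  using vecs_zero[OF Y] unfolding blin_iff by metis

lemma nrm_blin: "nrm (blin X Y) L = Sup {nrm Y (L v) | v. v \<in> vecs X \<and> nrm X v \<le> 1}"
  by (simp add: blin_def)

lemma nrm_blin_le:
  assumes "\<And>v. v \<in> vecs X \<Longrightarrow> nrm Y (L v) \<le> K * nrm X v" "0 \<le> K"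
  shows "nrm (blin X Y) L \<le> K"
  unfolding nrm_blin
proof (rule cSup_least)
  show "{nrm Y (L v) | v. v \<in> vecs X \<and> nrm X v \<le> 1} \<noteq> {}"
    using vecs_zero[OF X] nrm_zero[OF X] by fastforce
  fix r assume "r \<in> {nrm Y (L v) | v. v \<in> vecs X \<and> nrm X v \<le> 1}"
  then obtain v where v: "r = nrm Y (L v)" "v \<in> vecs X" "nrm X v \<le> 1" by blast
  have "K * nrm X v \<le> K * 1" using v assms(2) by (intro mult_left_mono)
  then show "r \<le> K" using assms(1)[OF v(2)] v(1) by simp
qed

lemma nrm_blin_apply:
  assumes L: "L \<in> vecs (blin X Y)" and v: "v \<in> vecs X"
  shows "nrm Y (L v) \<le> nrm (blin X Y) L * nrm X v"
proof (cases "v = 0")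
  case True
  then show ?thesis using blin_zero[OF L] by (simp add: nrm_zero[OF X] nrm_zero[OF Y])
next
  case False
  then have pos: "nrm X v > 0" using nrm_nonneg[OF X v] nrm_eq_0[OF X v] by simp
  obtain K where K: "\<And>v. v \<in> vecs X \<Longrightarrow> nrm Y (L v) \<le> K * nrm X v" using L unfolding blin_iff by blast
  let ?w = "inverse (nrm X v) *\<^sub>R v"
  have w: "?w \<in> vecs X" "nrm X ?w \<le> 1" using v pos by (simp_all add: vecs_scale[OF X] nrm_scale[OF X])
  have "nrm Y (L ?w) \<le> nrm (blin X Y) L"
    unfolding nrm_blin
  proof (rule cSup_upper)
    show "bdd_above {nrm Y (L v) | v. v \<in> vecs X \<and> nrm X v \<le> 1}"
    proof (rule bdd_aboveI)
      fix r assume "r \<in> {nrm Y (L v) | v. v \<in> vecs X \<and> nrm X v \<le> 1}"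
      then obtain v where v: "r = nrm Y (L v)" "v \<in> vecs X" "nrm X v \<le> 1" by blast
      have "r \<le> K * nrm X v" using K v by simp
      also have "\<dots> \<le> \<bar>K\<bar> * nrm X v" using nrm_nonneg[OF X v(2)] by (intro mult_right_mono) auto
      also have "\<dots> \<le> \<bar>K\<bar> * 1" using v by (intro mult_left_mono) auto
      finally show "r \<le> \<bar>K\<bar>" by simp
    qed
  qed (use w in blast)
  then have "inverse (nrm X v) * nrm Y (L v) \<le> nrm (blin X Y) L"
    using L v pos by (simp add: blin_scale nrm_scale[OF Y] blin_in)
  then show ?thesis using pos by (simp add: field_simps)
qed

lemma nrm_blin_nonneg:
  assumes "L \<in> vecs (blin X Y)"
  shows "0 \<le> nrm (blin X Y) L"
proof (rule ccontr)
  assume neg: "\<not> 0 \<le> nrm (blin X Y) L"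
  have 0: "nrm X v = 0" if v: "v \<in> vecs X" for v
  proof (rule ccontr)
    assume "nrm X v \<noteq> 0"
    then have "nrm (blin X Y) L * nrm X v < 0"
      using neg nrm_nonneg[OF X v] by (simp add: mult_neg_pos)
    then show False using nrm_blin_apply[OF assms v] nrm_nonneg[OF Y blin_in[OF assms, of v]] by simp
  qed
  have "nrm Y (L v) = 0" if "v \<in> vecs X" for v
    using that 0[OF that] nrm_eq_0[OF X that] blin_zero[OF assms] nrm_zero[OF Y] by simp
  then have "{nrm Y (L v) | v. v \<in> vecs X \<and> nrm X v \<le> 1} = {0}"
    using vecs_zero[OF X] nrm_zero[OF X] by fastforce
  then show False using neg by (simp add: nrm_blin)
qed

lemma normed_blin: "normed (blin X Y)"
  unfolding normed_def
proof (intro conjI ballI allI)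
  have add: "L + M \<in> vecs (blin X Y) \<and> nrm (blin X Y) (L + M) \<le> nrm (blin X Y) L + nrm (blin X Y) M"
    if L: "L \<in> vecs (blin X Y)" and M: "M \<in> vecs (blin X Y)" for L M
  proof
    have b: "nrm Y ((L + M) v) \<le> (nrm (blin X Y) L + nrm (blin X Y) M) * nrm X v" if v: "v \<in> vecs X" for v
    proof -
      have "nrm Y ((L + M) v) \<le> nrm Y (L v) + nrm Y (M v)"
        by (simp add: nrm_triangle[OF Y] blin_in L M)
      then show ?thesis using nrm_blin_apply[OF L v] nrm_blin_apply[OF M v] by (simp add: algebra_simps)
    qed
    show "L + M \<in> vecs (blin X Y)"
      by (rule blinI[OF _ _ _ _ b]) (simp_all add: blin_outside[OF L] blin_outside[OF M] blin_in[OF L] blin_in[OF M]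
          blin_add[OF L] blin_add[OF M] blin_scale[OF L] blin_scale[OF M] vecs_add[OF Y] algebra_simps)
    show "nrm (blin X Y) (L + M) \<le> nrm (blin X Y) L + nrm (blin X Y) M"
      by (rule nrm_blin_le[OF b]) (auto simp: nrm_blin_nonneg L M)
  qed
  have scale: "a *\<^sub>R L \<in> vecs (blin X Y) \<and> nrm (blin X Y) (a *\<^sub>R L) \<le> \<bar>a\<bar> * nrm (blin X Y) L"
    if L: "L \<in> vecs (blin X Y)" for a L
  proof
    have b: "nrm Y ((a *\<^sub>R L) v) \<le> (\<bar>a\<bar> * nrm (blin X Y) L) * nrm X v" if v: "v \<in> vecs X" for v
      using mult_left_mono[OF nrm_blin_apply[OF L v], of "\<bar>a\<bar>"]
      by (simp add: scaleR_fun_def nrm_scale[OF Y] blin_in L algebra_simps)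
    show "a *\<^sub>R L \<in> vecs (blin X Y)"
      by (rule blinI[OF _ _ _ _ b]) (simp_all add: scaleR_fun_def blin_outside[OF L] blin_in[OF L]
          blin_add[OF L] blin_scale[OF L] vecs_scale[OF Y] algebra_simps)
    show "nrm (blin X Y) (a *\<^sub>R L) \<le> \<bar>a\<bar> * nrm (blin X Y) L"
      by (rule nrm_blin_le[OF b]) (auto simp: nrm_blin_nonneg L)
  qed
  show "nrm (blin X Y) (L + M) \<le> nrm (blin X Y) L + nrm (blin X Y) M"
    if "L \<in> vecs (blin X Y)" "M \<in> vecs (blin X Y)" for L M
    using add[OF that] by blast
  show "subspace (vecs (blin X Y))"
  proof (rule subspaceI)
    show "0 \<in> vecs (blin X Y)"
      by (rule blinI[of _ 0]) (simp_all add: vecs_zero[OF Y] nrm_zero[OF Y])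
  qed (use add scale in auto)
  show "nrm (blin X Y) (a *\<^sub>R L) = \<bar>a\<bar> * nrm (blin X Y) L" if L: "L \<in> vecs (blin X Y)" for a L
  proof (cases "a = 0")
    case True
    have "nrm (blin X Y) 0 \<le> 0" by (rule nrm_blin_le) (auto simp: nrm_zero[OF Y])
    moreover have "0 \<le> nrm (blin X Y) (a *\<^sub>R L)" using scale[OF L] by (intro nrm_blin_nonneg) simp
    ultimately show ?thesis using True by simp
  next
    case False
    have aL: "a *\<^sub>R L \<in> vecs (blin X Y)" using scale[OF L] by simp
    have "nrm (blin X Y) (inverse a *\<^sub>R (a *\<^sub>R L)) \<le> \<bar>inverse a\<bar> * nrm (blin X Y) (a *\<^sub>R L)"
      by (rule conjunct2[OF scale[OF aL]])
    then have "\<bar>a\<bar> * nrm (blin X Y) L \<le> nrm (blin X Y) (a *\<^sub>R L)"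
      using False by (simp add: field_simps)
    then show ?thesis using scale[OF L, of a] by simp
  qed
  show "nrm (blin X Y) L = 0 \<longleftrightarrow> L = 0" if L: "L \<in> vecs (blin X Y)" for L
  proof
    assume 0: "nrm (blin X Y) L = 0"
    have "L v = 0" for v
    proof (cases "v \<in> vecs X")
      case True
      then have "nrm Y (L v) \<le> 0" using nrm_blin_apply[OF L True] 0 by simp
      then show ?thesis using nrm_eq_0[OF Y blin_in[OF L]] nrm_nonneg[OF Y blin_in[OF L, of v]] by simp
    qed (simp add: blin_outside[OF L])
    then show "L = 0" by (simp add: fun_eq_iff)
  next
    assume "L = 0"
    moreover have "nrm (blin X Y) 0 \<le> 0" by (rule nrm_blin_le) (auto simp: nrm_zero[OF Y])
    ultimately show "nrm (blin X Y) L = 0" using nrm_blin_nonneg[OF L] by simp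
  qed
qed (use nrm_blin_nonneg in auto)

end

lemma blin_compose:
  assumes X: "normed X" and Y: "normed Y" and Z: "normed Z"
    and L: "L \<in> vecs (blin Y Z)" and M: "M \<in> vecs (blin X Y)"
  shows "L \<circ> M \<in> vecs (blin X Z)"
    and "nrm (blin X Z) (L \<circ> M) \<le> nrm (blin Y Z) L * nrm (blin X Y) M"
proof -
  have b: "nrm Z ((L \<circ> M) v) \<le> (nrm (blin Y Z) L * nrm (blin X Y) M) * nrm X v" if v: "v \<in> vecs X" for v
  proof -
    have "nrm Z ((L \<circ> M) v) \<le> nrm (blin Y Z) L * nrm Y (M v)"
      using nrm_blin_apply[OF Y Z L blin_in[OF X Y M]] by simp
    also have "\<dots> \<le> nrm (blin Y Z) L * (nrm (blin X Y) M * nrm X v)"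
      by (intro mult_left_mono nrm_blin_apply[OF X Y M v] nrm_blin_nonneg[OF Y Z L])
    finally show ?thesis by (simp add: algebra_simps)
  qed
  note XY = X Y and YZ = Y Z
  show "L \<circ> M \<in> vecs (blin X Z)"
    by (rule blinI[OF X Z _ _ _ _ b]) (simp_all add: blin_outside[OF XY M] blin_zero[OF YZ L] blin_in[OF YZ L]
        blin_add[OF XY M] blin_scale[OF XY M] blin_in[OF XY M] blin_add[OF YZ L] blin_scale[OF YZ L])
  show "nrm (blin X Z) (L \<circ> M) \<le> nrm (blin Y Z) L * nrm (blin X Y) M"
    by (rule nrm_blin_le[OF X Z b]) (simp_all add: nrm_blin_nonneg[OF XY M] nrm_blin_nonneg[OF YZ L])
qed


section \<open>Derivatives\<close>

lemma has_fderiv_subset: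
  assumes "has_fderiv X Y W F u L" "W' \<subseteq> W"
  shows "has_fderiv X Y W' F u L"
  unfolding has_fderiv_def
proof (intro conjI allI impI)
  show "L \<in> vecs (blin X Y)" using assms(1) by (simp add: has_fderiv_def)
  fix e :: real assume "e > 0"
  then obtain d where "d > 0"
    "\<forall>h\<in>vecs X. u + h \<in> W \<and> nrm X h < d \<longrightarrow> nrm Y (F (u + h) - F u - L h) \<le> e * nrm X h"
    using assms(1) unfolding has_fderiv_def by blast
  then show "\<exists>d>0. \<forall>h\<in>vecs X. u + h \<in> W' \<and> nrm X h < d \<longrightarrow>
      nrm Y (F (u + h) - F u - L h) \<le> e * nrm X h"
    using assms(2) by (intro exI[of _ d]) blast
qed

lemma has_fderiv_superset:
  assumes X: "normed X" and L: "has_fderiv X Y W' F u L" and W': "openin (ntop X) W'" "u \<in> W'"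
  shows "has_fderiv X Y W F u L"
  unfolding has_fderiv_def
proof (intro conjI allI impI)
  show "L \<in> vecs (blin X Y)" using L by (simp add: has_fderiv_def)
  obtain r where r: "r > 0" "\<And>h. h \<in> vecs X \<Longrightarrow> nrm X h < r \<Longrightarrow> u + h \<in> W'"
    using W' unfolding openin_ntop[OF X] by blast
  fix e :: real assume "e > 0"
  then obtain d where "d > 0"
    "\<forall>h\<in>vecs X. u + h \<in> W' \<and> nrm X h < d \<longrightarrow> nrm Y (F (u + h) - F u - L h) \<le> e * nrm X h"
    using L unfolding has_fderiv_def by blast
  then show "\<exists>d>0. \<forall>h\<in>vecs X. u + h \<in> W \<and> nrm X h < d \<longrightarrow>
      nrm Y (F (u + h) - F u - L h) \<le> e * nrm X h"
    using r by (intro exI[of _ "min r d"]) auto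
qed

lemma has_fderiv_cong:
  assumes "has_fderiv X Y W F u L" "u \<in> W" "\<And>v. v \<in> W \<Longrightarrow> F v = G v"
  shows "has_fderiv X Y W G u L"
proof -
  have "(u + h \<in> W \<and> nrm X h < d \<longrightarrow> nrm Y (F (u + h) - F u - L h) \<le> e * nrm X h) \<longleftrightarrow>
      (u + h \<in> W \<and> nrm X h < d \<longrightarrow> nrm Y (G (u + h) - G u - L h) \<le> e * nrm X h)" for h d e
    using assms(2,3) by auto
  then show ?thesis using assms(1) unfolding has_fderiv_def by simp
qed

lemma has_fderiv_unique:
  assumes X: "normed X" and Y: "normed Y" and W: "openin (ntop X) W" "u \<in> W" and F: "F ` W \<subseteq> vecs Y"
    and L: "has_fderiv X Y W F u L" and M: "has_fderiv X Y W F u M"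
  shows "L = M"
proof
  fix v
  have Lb: "L \<in> vecs (blin X Y)" and Mb: "M \<in> vecs (blin X Y)" using L M by (auto simp: has_fderiv_def)
  note XY = X Y
  show "L v = M v"
  proof (cases "v \<in> vecs X")
    case False
    then show ?thesis by (simp add: blin_outside[OF XY Lb] blin_outside[OF XY Mb])
  next
    case v: True
    obtain r where r: "r > 0" "\<And>h. h \<in> vecs X \<Longrightarrow> nrm X h < r \<Longrightarrow> u + h \<in> W"
      using W unfolding openin_ntop[OF X] by blast
    have "nrm Y (L v - M v) \<le> e" if "e > 0" for e
    proof -
      define e' where "e' = e / (2 * nrm X v + 1)"
      have nv: "nrm X v \<ge> 0" by (rule nrm_nonneg[OF X v])
      have e': "e' > 0" "e' * (2 * nrm X v) \<le> e"
        using nv that by (auto simp: e'_def field_simps)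
      obtain d1 where d1: "d1 > 0"
        "\<And>h. h \<in> vecs X \<Longrightarrow> u + h \<in> W \<Longrightarrow> nrm X h < d1 \<Longrightarrow> nrm Y (F (u + h) - F u - L h) \<le> e' * nrm X h"
        using L e' unfolding has_fderiv_def by meson
      obtain d2 where d2: "d2 > 0"
        "\<And>h. h \<in> vecs X \<Longrightarrow> u + h \<in> W \<Longrightarrow> nrm X h < d2 \<Longrightarrow> nrm Y (F (u + h) - F u - M h) \<le> e' * nrm X h"
        using M e' unfolding has_fderiv_def by meson
      define \<delta> where "\<delta> = min r (min d1 d2)"
      define t where "t = \<delta> / (2 * (nrm X v + 1))"
      have \<delta>: "\<delta> > 0" using r d1 d2 by (simp add: \<delta>_def)
      have t: "t > 0" using \<delta> nv by (simp add: t_def)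
      have "0 \<le> \<delta> * nrm X v" using \<delta> nv by (intro mult_nonneg_nonneg) auto
      then have "0 < \<delta> * nrm X v + \<delta> * 2" using \<delta> by linarith
      then have "t * nrm X v < \<delta>"
        using \<delta> nv by (simp add: t_def field_simps)
      then have h: "t *\<^sub>R v \<in> vecs X" "nrm X (t *\<^sub>R v) < \<delta>"
        using v t by (auto simp: vecs_scale[OF X] nrm_scale[OF X])
      then have uh: "u + t *\<^sub>R v \<in> W" using r by (simp add: \<delta>_def)
      let ?\<Delta> = "F (u + t *\<^sub>R v) - F u"
      have \<Delta>: "?\<Delta> \<in> vecs Y" using F uh W by (intro vecs_diff[OF Y]) auto
      have in': "?\<Delta> - L (t *\<^sub>R v) \<in> vecs Y" "?\<Delta> - M (t *\<^sub>R v) \<in> vecs Y"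
        by (intro vecs_diff[OF Y] \<Delta> blin_in[OF XY Lb] blin_in[OF XY Mb])+
      have "nrm Y (t *\<^sub>R (L v - M v)) = nrm Y ((?\<Delta> - M (t *\<^sub>R v)) - (?\<Delta> - L (t *\<^sub>R v)))"
        by (simp add: blin_scale[OF XY Lb v] blin_scale[OF XY Mb v] algebra_simps)
      also have "\<dots> \<le> nrm Y (?\<Delta> - M (t *\<^sub>R v)) + nrm Y (?\<Delta> - L (t *\<^sub>R v))"
        by (rule nrm_triangle_sub[OF Y in'(2,1)])
      also have "\<dots> \<le> e' * nrm X (t *\<^sub>R v) + e' * nrm X (t *\<^sub>R v)"
        using h by (intro add_mono d1(2) d2(2) uh) (simp_all add: \<delta>_def)
      finally have *: "nrm Y (t *\<^sub>R (L v - M v)) \<le> e' * nrm X (t *\<^sub>R v) + e' * nrm X (t *\<^sub>R v)" .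
      have "L v - M v \<in> vecs Y" by (intro vecs_diff[OF Y] blin_in[OF XY Lb] blin_in[OF XY Mb])
      then have "t * nrm Y (L v - M v) \<le> t * (e' * (2 * nrm X v))"
        using * t v by (simp add: nrm_scale[OF X] nrm_scale[OF Y] mult_ac)
      then show ?thesis using t e' by simp
    qed
    then have "nrm Y (L v - M v) \<le> 0" by (rule field_le_epsilon) simp
    moreover have LM: "L v - M v \<in> vecs Y" by (intro vecs_diff[OF Y] blin_in[OF XY Lb] blin_in[OF XY Mb])
    ultimately show ?thesis using nrm_nonneg[OF Y LM] nrm_eq_0[OF Y LM] by simp
  qed
qed

lemma has_fderiv_linear:
  assumes X: "normed X" and Y: "normed Y" and L: "L \<in> vecs (blin X Y)" and u: "u \<in> vecs X"
  shows "has_fderiv X Y W L u L"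
  unfolding has_fderiv_def
proof (intro conjI allI impI L)
  fix e :: real assume "e > 0"
  then show "\<exists>d>0. \<forall>h\<in>vecs X. u + h \<in> W \<and> nrm X h < d \<longrightarrow> nrm Y (L (u + h) - L u - L h) \<le> e * nrm X h"
    using u by (intro exI[of _ 1]) (simp add: blin_add[OF X Y L] nrm_zero[OF Y] nrm_nonneg[OF X])
qed

lemma has_fderiv_const:
  assumes X: "normed X" and Y: "normed Y"
  shows "has_fderiv X Y W (\<lambda>_. c) u 0"
  unfolding has_fderiv_def
proof (intro conjI allI impI)
  show "0 \<in> vecs (blin X Y)" by (rule vecs_zero[OF normed_blin[OF X Y]])
  fix e :: real assume "e > 0"
  then show "\<exists>d>0. \<forall>h\<in>vecs X. u + h \<in> W \<and> nrm X h < d \<longrightarrow> nrm Y (c - c - 0 h) \<le> e * nrm X h"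
    by (intro exI[of _ 1]) (simp add: nrm_zero[OF Y] nrm_nonneg[OF X])
qed

lemma has_fderiv_increment:
  assumes X: "normed X" and Y: "normed Y" and L: "has_fderiv X Y W F u L"
    and F: "F ` W \<subseteq> vecs Y" "u \<in> W" and e: "e > 0"
  obtains d where "d > 0"
    "\<And>h. h \<in> vecs X \<Longrightarrow> u + h \<in> W \<Longrightarrow> nrm X h < d \<Longrightarrow> nrm Y (F (u + h) - F u - L h) \<le> e * nrm X h"
    "\<And>h. h \<in> vecs X \<Longrightarrow> u + h \<in> W \<Longrightarrow> nrm X h < d \<Longrightarrow>
       nrm Y (F (u + h) - F u) \<le> (nrm (blin X Y) L + e) * nrm X h"
proof -
  have Lb: "L \<in> vecs (blin X Y)" using L by (simp add: has_fderiv_def)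
  obtain d where d: "d > 0"
    "\<And>h. h \<in> vecs X \<Longrightarrow> u + h \<in> W \<Longrightarrow> nrm X h < d \<Longrightarrow> nrm Y (F (u + h) - F u - L h) \<le> e * nrm X h"
    using L e unfolding has_fderiv_def by meson
  have "nrm Y (F (u + h) - F u) \<le> (nrm (blin X Y) L + e) * nrm X h"
    if h: "h \<in> vecs X" "u + h \<in> W" "nrm X h < d" for h
  proof -
    have Lh: "L h \<in> vecs Y" by (rule blin_in[OF X Y Lb])
    have "F (u + h) - F u - L h \<in> vecs Y" using F h Lh by (intro vecs_diff[OF Y]) auto
    then have "nrm Y (F (u + h) - F u) \<le> nrm Y (F (u + h) - F u - L h) + nrm Y (L h)"
      using nrm_triangle[OF Y _ Lh] by fastforce
    then show ?thesis using d(2)[OF h] nrm_blin_apply[OF X Y Lb h(1)] by (simp add: algebra_simps)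
  qed
  then show ?thesis using d that by blast
qed

lemma has_fderiv_imp_openin_preimage:
  assumes X: "normed X" and Y: "normed Y" and W: "openin (ntop X) W" and F: "F ` W \<subseteq> vecs Y"
    and dF: "\<And>a. a \<in> W \<Longrightarrow> has_fderiv X Y W F a (dF a)" and V: "openin (ntop Y) V"
  shows "openin (ntop X) {a \<in> W. F a \<in> V}"
  unfolding openin_ntop[OF X]
proof (intro conjI ballI)
  show "{a \<in> W. F a \<in> V} \<subseteq> vecs X" using W unfolding openin_ntop[OF X] by blast
  fix a assume a: "a \<in> {a \<in> W. F a \<in> V}"
  then have aW: "a \<in> W" by simp
  obtain r where r: "r > 0" "\<And>h. h \<in> vecs X \<Longrightarrow> nrm X h < r \<Longrightarrow> a + h \<in> W"
    using W a unfolding openin_ntop[OF X] by blast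
  obtain s where s: "s > 0" "\<And>h. h \<in> vecs Y \<Longrightarrow> nrm Y h < s \<Longrightarrow> F a + h \<in> V"
    using V a unfolding openin_ntop[OF Y] by blast
  obtain d where d: "d > 0" "\<And>h. h \<in> vecs X \<Longrightarrow> a + h \<in> W \<Longrightarrow> nrm X h < d \<Longrightarrow>
       nrm Y (F (a + h) - F a) \<le> (nrm (blin X Y) (dF a) + 1) * nrm X h"
    by (rule has_fderiv_increment[OF X Y dF[OF aW] F aW zero_less_one]) blast
  have K: "nrm (blin X Y) (dF a) \<ge> 0" using dF[OF aW] nrm_blin_nonneg[OF X Y] by (simp add: has_fderiv_def)
  define \<delta> where "\<delta> = min r (min d (s / (nrm (blin X Y) (dF a) + 1)))"
  have "a + h \<in> {a \<in> W. F a \<in> V}" if h: "h \<in> vecs X" "nrm X h < \<delta>" for h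
  proof -
    have ah: "a + h \<in> W" using r h by (simp add: \<delta>_def)
    have "nrm Y (F (a + h) - F a) \<le> (nrm (blin X Y) (dF a) + 1) * nrm X h"
      using d(2)[OF h(1) ah] h by (simp add: \<delta>_def)
    also have "\<dots> < s" using h K by (simp add: \<delta>_def field_simps)
    finally have "F a + (F (a + h) - F a) \<in> V"
      using F aW ah by (intro s(2) vecs_diff[OF Y]) auto
    then show ?thesis using ah by simp
  qed
  moreover have "\<delta> > 0" using r d s K by (simp add: \<delta>_def)
  ultimately show "\<exists>d>0. \<forall>h\<in>vecs X. nrm X h < d \<longrightarrow> a + h \<in> {a \<in> W. F a \<in> V}" by blast
qed

lemma has_fderiv_chain:
  assumes X: "normed X" and Y: "normed Y" and Z: "normed Z"
    and F: "F ` W \<subseteq> V" "F ` W \<subseteq> vecs Y" "u \<in> W" and G: "G ` V \<subseteq> vecs Z"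
    and L: "has_fderiv X Y W F u L" and M: "has_fderiv Y Z V G (F u) M"
  shows "has_fderiv X Z W (G \<circ> F) u (M \<circ> L)"
  unfolding has_fderiv_def
proof (intro conjI allI impI)
  have Lb: "L \<in> vecs (blin X Y)" and Mb: "M \<in> vecs (blin Y Z)" using L M by (auto simp: has_fderiv_def)
  show "M \<circ> L \<in> vecs (blin X Z)" by (rule blin_compose[OF X Y Z Mb Lb])
  fix e :: real assume e: "e > 0"
  define l where "l = nrm (blin X Y) L"
  define m where "m = nrm (blin Y Z) M"
  have lm: "l \<ge> 0" "m \<ge> 0" using nrm_blin_nonneg X Y Z Lb Mb by (auto simp: l_def m_def)
  define e1 where "e1 = e / (2 * (m + 1))"
  define e2 where "e2 = e / (2 * (l + e1 + 1))"
  have e12: "e1 > 0" "e2 > 0" using e lm by (simp_all add: e1_def e2_def add_nonneg_pos)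
  have bound: "e2 * (l + e1) + m * e1 \<le> e"
  proof -
    have "m * e1 \<le> e / 2" using e lm by (simp add: e1_def field_simps)
    moreover have "e2 * (l + e1) \<le> e2 * (l + e1 + 1)" using e12 by simp
    moreover have "e2 * (l + e1 + 1) = e / 2" unfolding e2_def using e12 lm by (simp add: field_simps)
    ultimately show ?thesis by linarith
  qed
  obtain d1 where d1: "d1 > 0"
    "\<And>h. h \<in> vecs X \<Longrightarrow> u + h \<in> W \<Longrightarrow> nrm X h < d1 \<Longrightarrow> nrm Y (F (u + h) - F u - L h) \<le> e1 * nrm X h"
    "\<And>h. h \<in> vecs X \<Longrightarrow> u + h \<in> W \<Longrightarrow> nrm X h < d1 \<Longrightarrow> nrm Y (F (u + h) - F u) \<le> (l + e1) * nrm X h"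
    unfolding l_def by (rule has_fderiv_increment[OF X Y L F(2,3) e12(1)]) blast
  obtain d2 where d2: "d2 > 0"
    "\<And>k. k \<in> vecs Y \<Longrightarrow> F u + k \<in> V \<Longrightarrow> nrm Y k < d2 \<Longrightarrow> nrm Z (G (F u + k) - G (F u) - M k) \<le> e2 * nrm Y k"
    using M e12(2) unfolding has_fderiv_def by meson
  have "nrm Z ((G \<circ> F) (u + h) - (G \<circ> F) u - (M \<circ> L) h) \<le> e * nrm X h"
    if h: "h \<in> vecs X" "u + h \<in> W" "nrm X h < min d1 (d2 / (l + e1))" for h
  proof -
    define k where "k = F (u + h) - F u"
    have k: "k \<in> vecs Y" using F h by (auto simp: k_def intro!: vecs_diff[OF Y])
    have Fk: "F u + k = F (u + h)" by (simp add: k_def)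
    have nk: "nrm Y k \<le> (l + e1) * nrm X h" using d1(3)[OF h(1,2)] h(3) by (simp add: k_def)
    also have "\<dots> < d2" using h(3) lm e12 by (simp add: field_simps)
    finally have nk2: "nrm Y k < d2" .
    have kL: "k - L h \<in> vecs Y" by (intro vecs_diff[OF Y] k blin_in[OF X Y Lb])
    have 1: "nrm Z (G (F u + k) - G (F u) - M k) \<le> e2 * ((l + e1) * nrm X h)"
    proof -
      have "F u + k \<in> V" using F(1) h(2) Fk by auto
      then have "nrm Z (G (F u + k) - G (F u) - M k) \<le> e2 * nrm Y k" by (rule d2(2)[OF k _ nk2])
      also have "\<dots> \<le> e2 * ((l + e1) * nrm X h)" using nk e12 by (intro mult_left_mono) auto
      finally show ?thesis .
    qed
    have "nrm Z (M (k - L h)) \<le> m * nrm Y (k - L h)"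
      unfolding m_def by (rule nrm_blin_apply[OF Y Z Mb kL])
    also have "\<dots> \<le> m * (e1 * nrm X h)"
      using d1(2)[OF h(1,2)] h(3) lm by (intro mult_left_mono) (auto simp: k_def)
    finally have 2: "nrm Z (M (k - L h)) \<le> m * (e1 * nrm X h)" .
    have GF: "G (F u + k) \<in> vecs Z" "G (F u) \<in> vecs Z"
      unfolding Fk using G F(1,3) h(2) by blast+
    have "(G \<circ> F) (u + h) - (G \<circ> F) u - (M \<circ> L) h = (G (F u + k) - G (F u) - M k) + M (k - L h)"
      by (simp add: Fk blin_diff[OF Y Z Mb k blin_in[OF X Y Lb]])
    then have "nrm Z ((G \<circ> F) (u + h) - (G \<circ> F) u - (M \<circ> L) h) \<le>
        nrm Z (G (F u + k) - G (F u) - M k) + nrm Z (M (k - L h))"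
      by (simp only:) (intro nrm_triangle[OF Z] vecs_diff[OF Z] GF blin_in[OF Y Z Mb])
    also have "\<dots> \<le> (e2 * (l + e1) + m * e1) * nrm X h" using 1 2 by (simp add: algebra_simps)
    also have "\<dots> \<le> e * nrm X h" by (rule mult_right_mono[OF bound nrm_nonneg[OF X h(1)]])
    finally show ?thesis .
  qed
  moreover have "min d1 (d2 / (l + e1)) > 0" using d1 d2 lm e12 by simp
  ultimately show "\<exists>d>0. \<forall>h\<in>vecs X. u + h \<in> W \<and> nrm X h < d \<longrightarrow>
      nrm Z ((G \<circ> F) (u + h) - (G \<circ> F) u - (M \<circ> L) h) \<le> e * nrm X h" by blast
qed

lemma has_fderiv_bilinear:
  fixes X :: "'x::real_vector normed_sp" and E :: "'p::real_vector normed_sp"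
    and F :: "'q::real_vector normed_sp" and G :: "'r::real_vector normed_sp"
  assumes X: "normed X" and E: "normed E" and F: "normed F" and G: "normed G"
    and b_in: "\<And>p q. p \<in> vecs E \<Longrightarrow> q \<in> vecs F \<Longrightarrow> b p q \<in> vecs G"
    and b_add1: "\<And>p p' q. p \<in> vecs E \<Longrightarrow> p' \<in> vecs E \<Longrightarrow> q \<in> vecs F \<Longrightarrow> b (p + p') q = b p q + b p' q"
    and b_add2: "\<And>p q q'. p \<in> vecs E \<Longrightarrow> q \<in> vecs F \<Longrightarrow> q' \<in> vecs F \<Longrightarrow> b p (q + q') = b p q + b p q'"
    and b_scale1: "\<And>a p q. p \<in> vecs E \<Longrightarrow> q \<in> vecs F \<Longrightarrow> b (a *\<^sub>R p) q = a *\<^sub>R b p q"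
    and b_scale2: "\<And>a p q. p \<in> vecs E \<Longrightarrow> q \<in> vecs F \<Longrightarrow> b p (a *\<^sub>R q) = a *\<^sub>R b p q"
    and b_norm: "\<And>p q. p \<in> vecs E \<Longrightarrow> q \<in> vecs F \<Longrightarrow> nrm G (b p q) \<le> nrm E p * nrm F q"
    and P: "P ` W \<subseteq> vecs E" "has_fderiv X E W P u P'"
    and Q: "Q ` W \<subseteq> vecs F" "has_fderiv X F W Q u Q'" and u: "u \<in> W"
  shows "has_fderiv X G W (\<lambda>a. b (P a) (Q a)) u (\<lambda>h. b (P' h) (Q u) + b (P u) (Q' h))"
  unfolding has_fderiv_def
proof (intro conjI allI impI)
  have P'b: "P' \<in> vecs (blin X E)" and Q'b: "Q' \<in> vecs (blin X F)"
    using P Q by (auto simp: has_fderiv_def)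
  note P'_in = blin_in[OF X E P'b] and Q'_in = blin_in[OF X F Q'b]
  have Pu: "P u \<in> vecs E" and Qu: "Q u \<in> vecs F" using P Q u by auto
  define p where "p = nrm E (P u)"
  define q where "q = nrm F (Q u)"
  define p' where "p' = nrm (blin X E) P'"
  define q' where "q' = nrm (blin X F) Q'"
  have nonneg: "p \<ge> 0" "q \<ge> 0" "p' \<ge> 0" "q' \<ge> 0"
    using nrm_nonneg[OF E Pu] nrm_nonneg[OF F Qu] nrm_blin_nonneg[OF X E P'b] nrm_blin_nonneg[OF X F Q'b]
    by (simp_all add: p_def q_def p'_def q'_def)
  have b_0: "b 0 y = 0" if "y \<in> vecs F" for y
    using b_scale1[OF vecs_zero[OF E] that, of 0] by simp
  have b_0': "b y 0 = 0" if "y \<in> vecs E" for y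
    using b_scale2[OF that vecs_zero[OF F], of 0] by simp
  let ?D = "\<lambda>h. b (P' h) (Q u) + b (P u) (Q' h)"
  show "?D \<in> vecs (blin X G)"
  proof (rule blinI[OF X G, where K = "p' * q + p * q'"])
    show "?D v = 0" if "v \<notin> vecs X" for v
      using that by (simp add: blin_outside[OF X E P'b] blin_outside[OF X F Q'b] b_0 b_0' Pu Qu)
    show "?D v \<in> vecs G" for v by (intro vecs_add[OF G] b_in P'_in Q'_in Pu Qu)
    show "?D (v + w) = ?D v + ?D w" if "v \<in> vecs X" "w \<in> vecs X" for v w
      using that by (simp add: blin_add[OF X E P'b] blin_add[OF X F Q'b] b_add1 b_add2 P'_in Q'_in Pu Qu)
    show "?D (a *\<^sub>R v) = a *\<^sub>R ?D v" if "v \<in> vecs X" for a v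
      using that by (simp add: blin_scale[OF X E P'b] blin_scale[OF X F Q'b] b_scale1 b_scale2 P'_in Q'_in Pu Qu
          scaleR_add_right)
    show "nrm G (?D v) \<le> (p' * q + p * q') * nrm X v" if v: "v \<in> vecs X" for v
    proof -
      have "nrm G (?D v) \<le> nrm G (b (P' v) (Q u)) + nrm G (b (P u) (Q' v))"
        by (intro nrm_triangle[OF G] b_in P'_in Q'_in Pu Qu)
      also have "\<dots> \<le> nrm E (P' v) * q + p * nrm F (Q' v)"
        unfolding p_def q_def by (intro add_mono b_norm P'_in Q'_in Pu Qu)
      also have "\<dots> \<le> (p' * nrm X v) * q + p * (q' * nrm X v)"
        unfolding p'_def q'_def
        by (intro add_mono mult_left_mono mult_right_mono nrm_blin_apply[OF X E P'b v] nrm_blin_apply[OF X F Q'b v] nonneg)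
      finally show ?thesis by (simp add: algebra_simps)
    qed
  qed
  fix e :: real assume e: "e > 0"
  define e1 where "e1 = e / (3 * (p + q + 1))"
  have e1: "e1 > 0" using e nonneg by (simp add: e1_def)
  define M where "M = (p' + e1) * (q' + e1)"
  have M: "M > 0" using e1 nonneg by (simp add: M_def add_nonneg_pos)
  have bound: "e1 * q + p * e1 \<le> e / 3"
  proof -
    have "e1 * (p + q) \<le> e1 * (p + q + 1)" using e1 by simp
    also have "\<dots> = e / 3" using nonneg by (simp add: e1_def field_simps)
    finally show ?thesis by (simp add: algebra_simps)
  qed
  obtain d1 where d1: "d1 > 0"
    "\<And>h. h \<in> vecs X \<Longrightarrow> u + h \<in> W \<Longrightarrow> nrm X h < d1 \<Longrightarrow> nrm E (P (u + h) - P u - P' h) \<le> e1 * nrm X h"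
    "\<And>h. h \<in> vecs X \<Longrightarrow> u + h \<in> W \<Longrightarrow> nrm X h < d1 \<Longrightarrow> nrm E (P (u + h) - P u) \<le> (p' + e1) * nrm X h"
    unfolding p'_def by (rule has_fderiv_increment[OF X E P(2,1) u e1]) blast
  obtain d2 where d2: "d2 > 0"
    "\<And>h. h \<in> vecs X \<Longrightarrow> u + h \<in> W \<Longrightarrow> nrm X h < d2 \<Longrightarrow> nrm F (Q (u + h) - Q u - Q' h) \<le> e1 * nrm X h"
    "\<And>h. h \<in> vecs X \<Longrightarrow> u + h \<in> W \<Longrightarrow> nrm X h < d2 \<Longrightarrow> nrm F (Q (u + h) - Q u) \<le> (q' + e1) * nrm X h"
    unfolding q'_def by (rule has_fderiv_increment[OF X F Q(2,1) u e1]) blast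
  have "nrm G (b (P (u + h)) (Q (u + h)) - b (P u) (Q u) - ?D h) \<le> e * nrm X h"
    if h: "h \<in> vecs X" "u + h \<in> W" "nrm X h < min d1 (min d2 (e / (2 * M)))" for h
  proof -
    define r where "r = P (u + h) - P u - P' h"
    define s where "s = Q (u + h) - Q u - Q' h"
    define \<Delta>P where "\<Delta>P = P (u + h) - P u"
    define \<Delta>Q where "\<Delta>Q = Q (u + h) - Q u"
    have Ph: "P (u + h) \<in> vecs E" "Q (u + h) \<in> vecs F" using P(1) Q(1) h by auto
    have ins: "r \<in> vecs E" "s \<in> vecs F" "\<Delta>P \<in> vecs E" "\<Delta>Q \<in> vecs F"
      unfolding r_def s_def \<Delta>P_def \<Delta>Q_def
      by (intro vecs_diff[OF E] vecs_diff[OF F] Ph Pu Qu P'_in Q'_in)+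
    have nh: "nrm X h \<ge> 0" by (rule nrm_nonneg[OF X h(1)])
    have eq: "P (u + h) = P u + (P' h + r)" "Q (u + h) = Q u + (Q' h + s)" "\<Delta>P = P' h + r" "\<Delta>Q = Q' h + s"
      by (simp_all add: r_def s_def \<Delta>P_def \<Delta>Q_def)
    have "b (P (u + h)) (Q (u + h)) = b (P u) (Q u) + b (P u) \<Delta>Q + b \<Delta>P (Q u) + b \<Delta>P \<Delta>Q"
    proof -
      have "P (u + h) = P u + \<Delta>P" "Q (u + h) = Q u + \<Delta>Q" by (simp_all add: \<Delta>P_def \<Delta>Q_def)
      then show ?thesis by (simp add: b_add1 b_add2 Pu Qu ins vecs_add[OF E] vecs_add[OF F])
    qed
    moreover have "b (P u) \<Delta>Q = b (P u) (Q' h) + b (P u) s" "b \<Delta>P (Q u) = b (P' h) (Q u) + b r (Q u)"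
      using ins by (simp_all add: eq(3,4) b_add1 b_add2 Pu Qu P'_in Q'_in)
    ultimately have "b (P (u + h)) (Q (u + h)) - b (P u) (Q u) - ?D h =
        (b r (Q u) + b (P u) s) + b \<Delta>P \<Delta>Q"
      by (simp add: algebra_simps)
    then have "nrm G (b (P (u + h)) (Q (u + h)) - b (P u) (Q u) - ?D h) \<le>
        nrm G (b r (Q u) + b (P u) s) + nrm G (b \<Delta>P \<Delta>Q)"
      by (simp only:) (intro nrm_triangle[OF G] vecs_add[OF G] b_in ins Pu Qu)
    also have "nrm G (b r (Q u) + b (P u) s) \<le> nrm G (b r (Q u)) + nrm G (b (P u) s)"
      by (intro nrm_triangle[OF G] b_in ins Pu Qu)
    also have "nrm G (b r (Q u)) \<le> nrm E r * q" unfolding q_def by (intro b_norm ins Qu)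
    also have "nrm E r * q \<le> (e1 * nrm X h) * q"
      using d1(2)[OF h(1,2)] h(3) nonneg by (intro mult_right_mono) (auto simp: r_def)
    also have "nrm G (b (P u) s) \<le> p * nrm F s" unfolding p_def by (intro b_norm ins Pu)
    also have "p * nrm F s \<le> p * (e1 * nrm X h)"
      using d2(2)[OF h(1,2)] h(3) nonneg by (intro mult_left_mono) (auto simp: s_def)
    also have "nrm G (b \<Delta>P \<Delta>Q) \<le> nrm E \<Delta>P * nrm F \<Delta>Q" by (intro b_norm ins)
    also have "\<dots> \<le> ((p' + e1) * nrm X h) * ((q' + e1) * nrm X h)"
    proof (rule mult_mono)
      show "nrm E \<Delta>P \<le> (p' + e1) * nrm X h" unfolding \<Delta>P_def using d1(3)[OF h(1,2)] h(3) by simp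
      show "nrm F \<Delta>Q \<le> (q' + e1) * nrm X h" unfolding \<Delta>Q_def using d2(3)[OF h(1,2)] h(3) by simp
      show "0 \<le> (p' + e1) * nrm X h" using nonneg e1 nh by simp
    qed (rule nrm_nonneg[OF F ins(4)])
    also have "e1 * nrm X h * q + p * (e1 * nrm X h) + (p' + e1) * nrm X h * ((q' + e1) * nrm X h) =
        (e1 * q + p * e1) * nrm X h + (M * nrm X h) * nrm X h"
      by (simp add: M_def algebra_simps)
    also have "\<dots> \<le> e / 3 * nrm X h + e / 2 * nrm X h"
    proof (intro add_mono mult_right_mono bound nh)
      show "M * nrm X h \<le> e / 2" using h(3) M by (simp add: field_simps)
    qed
    also have "\<dots> \<le> e * nrm X h" using e nh by (simp add: field_simps)
    finally show ?thesis by simp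
  qed
  moreover have "min d1 (min d2 (e / (2 * M))) > 0" using d1 d2 e M by simp
  ultimately show "\<exists>d>0. \<forall>h\<in>vecs X. u + h \<in> W \<and> nrm X h < d \<longrightarrow>
      nrm G (b (P (u + h)) (Q (u + h)) - b (P u) (Q u) - ?D h) \<le> e * nrm X h" by blast
qed

section \<open>Second derivatives\<close>

text \<open>Twice differentiability with explicit first and second derivative on an open set, so that
  functions can be composed and restricted before the choice of neighbourhoods is forgotten.\<close>

definition twice_fderiv :: "'a::real_vector normed_sp \<Rightarrow> 'b::real_vector normed_sp \<Rightarrow> 'a set \<Rightarrow>
    ('a \<Rightarrow> 'b) \<Rightarrow> ('a \<Rightarrow> 'a \<Rightarrow> 'b) \<Rightarrow> 'a \<Rightarrow> ('a \<Rightarrow> 'a \<Rightarrow> 'b) \<Rightarrow> bool" where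
  "twice_fderiv X Y W F dF u B \<longleftrightarrow>
     openin (ntop X) W \<and> u \<in> W \<and> F ` W \<subseteq> vecs Y \<and>
     (\<forall>a\<in>W. has_fderiv X Y W F a (dF a)) \<and> has_fderiv X (blin X Y) W dF u B"

lemma twice_fderiv_subset:
  assumes "twice_fderiv X Y W F dF u B" "openin (ntop X) W'" "u \<in> W'" "W' \<subseteq> W"
  shows "twice_fderiv X Y W' F dF u B"
  using assms unfolding twice_fderiv_def by (auto intro: has_fderiv_subset)

lemma twice_fderiv_cong:
  assumes "twice_fderiv X Y W F dF u B" "\<And>v. v \<in> W \<Longrightarrow> F v = G v"
  shows "twice_fderiv X Y W G dF u B"
proof -
  have "has_fderiv X Y W G a (dF a)" if "a \<in> W" for a
    by (rule has_fderiv_cong[OF _ that assms(2)]) (use assms(1) that in \<open>auto simp: twice_fderiv_def\<close>)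
  moreover have "G ` W = F ` W" using assms(2) by (auto simp: image_iff)
  ultimately show ?thesis using assms(1) by (simp add: twice_fderiv_def)
qed

lemma twice_fderiv_linear:
  assumes X: "normed X" and Y: "normed Y" and L: "L \<in> vecs (blin X Y)" and u: "u \<in> vecs X"
  shows "twice_fderiv X Y (vecs X) L (\<lambda>_. L) u 0"
  unfolding twice_fderiv_def
  using u blin_in[OF X Y L] has_fderiv_linear[OF X Y L] has_fderiv_const[OF X normed_blin[OF X Y]]
    openin_ntop_vecs[OF X] by auto

lemma twice_fderiv_chain:
  fixes X :: "'a::real_vector normed_sp" and Y :: "'b::real_vector normed_sp" and Z :: "'c::real_vector normed_sp"
  assumes X: "normed X" and Y: "normed Y" and Z: "normed Z"
    and F: "twice_fderiv X Y W F dF u B" and G: "twice_fderiv Y Z V G dG (F u) A"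
  shows "twice_fderiv X Z {a \<in> W. F a \<in> V} (G \<circ> F) (\<lambda>a. dG (F a) \<circ> dF a) u
      (\<lambda>h. (A (dF u h) \<circ> dF u) + (dG (F u) \<circ> B h))"
proof -
  let ?W = "{a \<in> W. F a \<in> V}"
  have op: "openin (ntop X) ?W"
    by (rule has_fderiv_imp_openin_preimage[OF X Y, where dF = dF]) (use F G in \<open>auto simp: twice_fderiv_def\<close>)
  have u: "u \<in> ?W" using F G by (simp add: twice_fderiv_def)
  have F': "twice_fderiv X Y ?W F dF u B" by (rule twice_fderiv_subset[OF F op u]) simp
  have dF: "dF a \<in> vecs (blin X Y)" if "a \<in> ?W" for a
    using F' that by (simp add: twice_fderiv_def has_fderiv_def)
  have dG: "dG b \<in> vecs (blin Y Z)" if "b \<in> V" for b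
    using G that by (simp add: twice_fderiv_def has_fderiv_def)
  have "has_fderiv X Z ?W (G \<circ> F) a (dG (F a) \<circ> dF a)" if "a \<in> ?W" for a
    by (rule has_fderiv_chain[OF X Y Z, where V = V]) (use F' G that in \<open>auto simp: twice_fderiv_def\<close>)
  moreover have "has_fderiv X (blin X Z) ?W (\<lambda>a. dG (F a) \<circ> dF a) u (\<lambda>h. (A (dF u h) \<circ> dF u) + (dG (F u) \<circ> B h))"
  proof (rule has_fderiv_bilinear[OF X normed_blin[OF Y Z] normed_blin[OF X Y] normed_blin[OF X Z],
        where b = "\<lambda>L M. L \<circ> M" and P = "\<lambda>a. dG (F a)" and P' = "\<lambda>h. A (dF u h)"
          and Q = dF and Q' = B])
    have "has_fderiv X (blin Y Z) ?W (dG \<circ> F) u (A \<circ> dF u)"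
      by (rule has_fderiv_chain[OF X Y normed_blin[OF Y Z], where V = V])
        (use F' G u dG in \<open>auto simp: twice_fderiv_def\<close>)
    then show "has_fderiv X (blin Y Z) ?W (\<lambda>a. dG (F a)) u (\<lambda>h. A (dF u h))" by (simp add: comp_def)
    show "has_fderiv X (blin X Y) ?W dF u B" using F' by (simp add: twice_fderiv_def)
    show "(\<lambda>a. dG (F a)) ` ?W \<subseteq> vecs (blin Y Z)" using dG by auto
    show "dF ` ?W \<subseteq> vecs (blin X Y)" using dF by auto
    show "u \<in> ?W" by (rule u)
    fix L L' M M' and a :: real
    assume L: "L \<in> vecs (blin Y Z)" and M: "M \<in> vecs (blin X Y)"
    show "L \<circ> M \<in> vecs (blin X Z)" "nrm (blin X Z) (L \<circ> M) \<le> nrm (blin Y Z) L * nrm (blin X Y) M"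
      by (rule blin_compose[OF X Y Z L M])+
    show "(a *\<^sub>R L) \<circ> M = a *\<^sub>R (L \<circ> M)" by (simp add: fun_eq_iff scaleR_fun_def)
    show "L \<circ> (a *\<^sub>R M) = a *\<^sub>R (L \<circ> M)"
      by (simp add: fun_eq_iff scaleR_fun_def blin_scale[OF Y Z L] blin_in[OF X Y M])
    show "(L + L') \<circ> M = (L \<circ> M) + (L' \<circ> M)" by (simp add: fun_eq_iff)
    assume M': "M' \<in> vecs (blin X Y)"
    show "L \<circ> (M + M') = (L \<circ> M) + (L \<circ> M')"
      by (simp add: fun_eq_iff blin_add[OF Y Z L] blin_in[OF X Y M] blin_in[OF X Y M'])
  qed
  moreover have "(G \<circ> F) ` ?W \<subseteq> vecs Z" using G by (auto simp: twice_fderiv_def)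
  ultimately show ?thesis using op u by (simp add: twice_fderiv_def)
qed

lemma twice_fderiv_imp_has_second_fderiv:
  assumes X: "normed X" and F: "twice_fderiv X Y W' F dF u B" "W' \<subseteq> W"
  shows "has_second_fderiv X Y W F u B"
  unfolding has_second_fderiv_def
  using F has_fderiv_superset[OF X, of Y W' F _ _ W] by (intro exI[of _ W'] exI[of _ dF]) (auto simp: twice_fderiv_def)

lemma has_second_fderiv_unique:
  assumes X: "normed X" and Y: "normed Y" and F: "F ` W \<subseteq> vecs Y"
    and A: "has_second_fderiv X Y W F u A" and B: "has_second_fderiv X Y W F u B"
  shows "A = B"
proof -
  obtain V dF where V: "openin (ntop X) V" "u \<in> V" "V \<subseteq> W"
    "\<forall>a\<in>V. has_fderiv X Y W F a (dF a)" "has_fderiv X (blin X Y) V dF u A"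
    using A unfolding has_second_fderiv_def by blast
  obtain V' dF' where V': "openin (ntop X) V'" "u \<in> V'" "V' \<subseteq> W"
    "\<forall>a\<in>V'. has_fderiv X Y W F a (dF' a)" "has_fderiv X (blin X Y) V' dF' u B"
    using B unfolding has_second_fderiv_def by blast
  let ?U = "V \<inter> V'"
  have U: "openin (ntop X) ?U" "u \<in> ?U" using V V' by auto
  have "dF a = dF' a" if a: "a \<in> ?U" for a
  proof (rule has_fderiv_unique[OF X Y U(1) a])
    show "F ` ?U \<subseteq> vecs Y" using F V(3) by blast
    show "has_fderiv X Y ?U F a (dF a)" "has_fderiv X Y ?U F a (dF' a)"
      using V(3,4) V'(4) a by (auto intro: has_fderiv_subset[of X Y W])
  qed
  then have eq: "dF' a = dF a" if "a \<in> ?U" for a using that by simp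
  have "has_fderiv X (blin X Y) ?U dF' u B" using V'(5) by (rule has_fderiv_subset) simp
  then have "has_fderiv X (blin X Y) ?U dF u B" using U(2) eq by (rule has_fderiv_cong)
  moreover have "has_fderiv X (blin X Y) ?U dF u A" using V(5) by (rule has_fderiv_subset) simp
  moreover have "dF ` ?U \<subseteq> vecs (blin X Y)" using V(4) by (auto simp: has_fderiv_def)
  ultimately show ?thesis by (intro has_fderiv_unique[OF X normed_blin[OF X Y] U])
qed

lemma second_fderiv_eq:
  assumes "normed X" "normed Y" "F ` W \<subseteq> vecs Y" "has_second_fderiv X Y W F u B"
  shows "second_fderiv X Y W F u = B"
  unfolding second_fderiv_def using assms has_second_fderiv_unique by (intro the_equality) blast+

lemma mlin_1_to_blin:
  assumes X: "normed X" and Y: "normed Y" and A: "A \<in> vecs (mlin 1 X Y)"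
  shows "(\<lambda>v. A [v]) \<in> vecs (blin X Y)"
proof -
  obtain K where K: "\<And>vs. length vs = 1 \<and> set vs \<subseteq> vecs X \<Longrightarrow> nrm Y (A vs) \<le> K * prod_list (map (nrm X) vs)"
    using A unfolding mlin_def by auto
  have out: "A vs = 0" if "\<not> (length vs = 1 \<and> set vs \<subseteq> vecs X)" for vs using A that unfolding mlin_def by simp
  have in': "A vs \<in> vecs Y" if "length vs = 1 \<and> set vs \<subseteq> vecs X" for vs using A that unfolding mlin_def by simp
  have lin: "A (vs[0 := a *\<^sub>R v + w]) = a *\<^sub>R A (vs[0 := v]) + A (vs[0 := w])"
    if "length vs = 1 \<and> set vs \<subseteq> vecs X" "v \<in> vecs X" "w \<in> vecs X" for vs v w a
    using A that unfolding mlin_def by simp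
  show ?thesis
    unfolding blin_iff[OF X Y]
  proof (intro conjI allI ballI impI exI[of _ K])
    show "A [v] = 0" if "v \<notin> vecs X" for v using that by (intro out) simp
    show "A [v] \<in> vecs Y" if "v \<in> vecs X" for v using that by (intro in') simp
    show "A [a *\<^sub>R v + w] = a *\<^sub>R A [v] + A [w]" if "v \<in> vecs X" "w \<in> vecs X" for a v w
      using lin[of "[v]" v w a] that by simp
    show "nrm Y (A [v]) \<le> K * nrm X v" if "v \<in> vecs X" for v using K[of "[v]"] that by simp
  qed
qed

lemma nrm_mlin_1: "nrm (mlin 1 X Y) A = nrm (blin X Y) (\<lambda>v. A [v])"
proof -
  have "{nrm Y (A vs) | vs. length vs = 1 \<and> (\<forall>v\<in>set vs. v \<in> vecs X \<and> nrm X v \<le> 1)} =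
      {nrm Y (A [v]) | v. v \<in> vecs X \<and> nrm X v \<le> 1}"
    by (auto simp: length_Suc_conv)
  then show ?thesis by (simp add: mlin_def blin_def)
qed

lemma nrm_mlin_0: "nrm (mlin 0 X Y) A = nrm Y (A [])"
proof -
  have "{nrm Y (A vs) | vs. length vs = 0 \<and> (\<forall>v\<in>set vs. v \<in> vecs X \<and> nrm X v \<le> 1)} = {nrm Y (A [])}"
    by auto
  then show ?thesis by (simp add: mlin_def)
qed

lemma banach_smooth_imp_twice_fderiv:
  assumes X: "normed X" and Y: "normed Y" and F: "banach_smooth X Y W F" and u: "u \<in> W"
  obtains dF B where "twice_fderiv X Y W F dF u B"
proof -
  obtain D where D0: "\<And>u. u \<in> W \<Longrightarrow> D 0 u = (\<lambda>vs. if vs = [] then F u else 0)"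
    and D: "\<And>k u. u \<in> W \<Longrightarrow> D k u \<in> vecs (mlin k X Y)"
      "\<And>k u. u \<in> W \<Longrightarrow> has_fderiv X (mlin k X Y) W (D k) u (\<lambda>h vs. D (Suc k) u (h # vs))"
    using F unfolding banach_smooth_def by metis
  define dF where "dF u h = D 1 u [h]" for u h
  define B where "B h k = D 2 u [h, k]" for h k
  have dF: "dF a \<in> vecs (blin X Y)" if "a \<in> W" for a
    using mlin_1_to_blin[OF X Y D(1)[OF that]] by (simp add: dF_def[abs_def])
  have "has_fderiv X Y W F a (dF a)" if a: "a \<in> W" for a
    unfolding has_fderiv_def
  proof (intro conjI allI impI dF a)
    fix e :: real assume "e > 0"
    then obtain d where d: "d > 0" "\<And>h. h \<in> vecs X \<Longrightarrow> a + h \<in> W \<Longrightarrow> nrm X h < d \<Longrightarrow>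
        nrm (mlin 0 X Y) (D 0 (a + h) - D 0 a - (\<lambda>vs. D (Suc 0) a (h # vs))) \<le> e * nrm X h"
      using D(2)[OF a, of 0] unfolding has_fderiv_def by meson
    have "nrm Y (F (a + h) - F a - dF a h) \<le> e * nrm X h"
      if "h \<in> vecs X" "a + h \<in> W" "nrm X h < d" for h
      using d(2)[OF that] that a by (simp add: nrm_mlin_0 D0 dF_def)
    then show "\<exists>d>0. \<forall>h\<in>vecs X. a + h \<in> W \<and> nrm X h < d \<longrightarrow>
        nrm Y (F (a + h) - F a - dF a h) \<le> e * nrm X h" using d(1) by blast
  qed
  moreover have "has_fderiv X (blin X Y) W dF u B"
    unfolding has_fderiv_def
  proof (intro conjI allI impI)
    have L: "(\<lambda>h vs. D (Suc 1) u (h # vs)) \<in> vecs (blin X (mlin 1 X Y))"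
      using D(2)[OF u, of 1] unfolding has_fderiv_def by blast
    let ?L = "\<lambda>h vs. D (Suc 1) u (h # vs)"
    have L_out: "?L v = 0" if "v \<notin> vecs X" for v using L that unfolding blin_def by simp
    have L_in: "?L v \<in> vecs (mlin 1 X Y)" if "v \<in> vecs X" for v using L that unfolding blin_def by simp
    have L_lin: "?L (a *\<^sub>R v + w) = a *\<^sub>R ?L v + ?L w" if "v \<in> vecs X" "w \<in> vecs X" for a v w
      using L that unfolding blin_def by simp
    have "\<exists>K. \<forall>v\<in>vecs X. nrm (mlin 1 X Y) (?L v) \<le> K * nrm X v"
      using L unfolding blin_def by simp
    then obtain K where K: "\<And>v. v \<in> vecs X \<Longrightarrow> nrm (mlin 1 X Y) (?L v) \<le> K * nrm X v" by blast
    have BL: "B h = (\<lambda>v. ?L h [v])" for h by (simp add: B_def fun_eq_iff numeral_2_eq_2)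
    show "B \<in> vecs (blin X (blin X Y))"
      unfolding blin_iff[OF X normed_blin[OF X Y]]
    proof (intro conjI allI ballI impI exI[of _ K])
      show "B v = 0" if "v \<notin> vecs X" for v
        using fun_cong[OF L_out[OF that]] unfolding BL by (simp add: fun_eq_iff)
      show "B v \<in> vecs (blin X Y)" if "v \<in> vecs X" for v
        unfolding BL by (rule mlin_1_to_blin[OF X Y L_in[OF that]])
      show "B (a *\<^sub>R v + w) = a *\<^sub>R B v + B w" if "v \<in> vecs X" "w \<in> vecs X" for a v w
        using fun_cong[OF L_lin[OF that]] unfolding BL by (simp add: fun_eq_iff scaleR_fun_def)
      show "nrm (blin X Y) (B v) \<le> K * nrm X v" if "v \<in> vecs X" for v
        using K[OF that] unfolding BL nrm_mlin_1 .
    qed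
    fix e :: real assume "e > 0"
    then obtain d where d: "d > 0" "\<And>h. h \<in> vecs X \<Longrightarrow> u + h \<in> W \<Longrightarrow> nrm X h < d \<Longrightarrow>
        nrm (mlin 1 X Y) (D 1 (u + h) - D 1 u - ?L h) \<le> e * nrm X h"
      using D(2)[OF u, of 1] unfolding has_fderiv_def by meson
    have "dF (u + h) - dF u - B h = (\<lambda>v. (D 1 (u + h) - D 1 u - ?L h) [v])" for h
      by (simp add: fun_eq_iff dF_def BL)
    then show "\<exists>d>0. \<forall>h\<in>vecs X. u + h \<in> W \<and> nrm X h < d \<longrightarrow>
        nrm (blin X Y) (dF (u + h) - dF u - B h) \<le> e * nrm X h"
      using d unfolding nrm_mlin_1 by (intro exI[of _ d]) simp
  qed
  moreover have "openin (ntop X) W" "F ` W \<subseteq> vecs Y" using F by (auto simp: banach_smooth_def)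
  ultimately have "twice_fderiv X Y W F dF u B" using u by (simp add: twice_fderiv_def)
  then show ?thesis by (rule that)
qed

section \<open>Smooth maps between manifolds\<close>

lemma smooth_on_infinity: "smooth_on \<infinity> S f \<longleftrightarrow> (\<forall>k. higher_differentiable_on S f k)"
  by (simp add: smooth_on_def)

lemma smooth_on_imp_continuous_on: "smooth_on \<infinity> S f \<Longrightarrow> continuous_on S f"
  unfolding smooth_on_infinity by (drule spec[of _ 0]) simp

lemma smooth_on_imp_has_derivative:
  assumes "smooth_on \<infinity> S f" "x \<in> S"
  shows "(f has_derivative frechet_derivative f (at x)) (at x)"
  by (rule higher_differentiable_on_has_derivative[OF assms(1)[unfolded smooth_on_infinity, rule_format] assms(2)])

lemma smooth_on_compose:
  fixes g :: "'a::real_normed_vector \<Rightarrow> 'b::real_normed_vector" and B :: "'b set"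
  assumes "coordinates B c" "open S" "open T" "g ` S \<subseteq> T" "smooth_on \<infinity> T f" "smooth_on \<infinity> S g"
  shows "smooth_on \<infinity> S (\<lambda>x. f (g x))"
  unfolding smooth_on_infinity
proof
  fix k
  show "higher_differentiable_on S (\<lambda>x. f (g x)) k"
    by (rule higher_differentiable_on_compose[OF assms(1-4)])
      (use assms(5,6) in \<open>simp_all add: smooth_on_infinity\<close>)
qed

lemma smooth_on_subset: "smooth_on \<infinity> T f \<Longrightarrow> S \<subseteq> T \<Longrightarrow> smooth_on \<infinity> S f"
  unfolding smooth_on_infinity by (intro allI, drule spec) (rule higher_differentiable_on_subset)

lemma smooth_on_cong:
  assumes "smooth_on \<infinity> S f" "open S" "\<And>x. x \<in> S \<Longrightarrow> f x = g x"
  shows "smooth_on \<infinity> S g"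
  unfolding smooth_on_infinity
proof
  fix k
  show "higher_differentiable_on S g k"
    by (rule higher_differentiable_on_cong[of S f]) (use assms in \<open>auto simp: smooth_on_infinity\<close>)
qed

lemma smooth_on_bounded_linear: "bounded_linear L \<Longrightarrow> open S \<Longrightarrow> smooth_on \<infinity> S L"
  unfolding smooth_on_infinity by (intro allI higher_differentiable_on_bounded_linear)

lemma smooth_on_bounded_linear_left:
  assumes "bounded_linear L" "open S" "smooth_on \<infinity> S f"
  shows "smooth_on \<infinity> S (\<lambda>x. L (f x))"
  using assms(3) unfolding smooth_on_infinity
  by (intro allI higher_differentiable_on_bounded_linear_left[OF assms(1,2)]) simp

lemma smooth_on_const: "open S \<Longrightarrow> smooth_on \<infinity> S (\<lambda>x. c)"
  unfolding smooth_on_infinity by (intro allI higher_differentiable_on_const)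

lemma CmapE:
  assumes "Cmap r A B S f" "p \<in> S"
  obtains U c V k Q F where "(U, c) \<in> A" "(V, k) \<in> B" "p \<in> U" "f p \<in> V" "open Q" "c p \<in> Q"
    "smooth_on r Q F" "\<forall>q. q \<in> S \<longrightarrow> q \<in> U \<longrightarrow> c q \<in> Q \<longrightarrow> f q \<in> V \<and> k (f q) = F (c q)"
proof -
  obtain a b where ab: "a \<in> A" "b \<in> B" "case a of (U, c) \<Rightarrow> case b of (V, k) \<Rightarrow> p \<in> U \<and> f p \<in> V \<and>
        (\<exists>Q F. open Q \<and> c p \<in> Q \<and> smooth_on r Q F \<and> (\<forall>q\<in>S \<inter> U. c q \<in> Q \<longrightarrow> f q \<in> V \<and> k (f q) = F (c q)))"
    using assms unfolding Cmap_def by fast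
  obtain U c V k where eq: "a = (U, c)" "b = (V, k)" by fastforce
  then obtain Q F where "open Q" "c p \<in> Q" "smooth_on r Q F"
    "\<forall>q\<in>S \<inter> U. c q \<in> Q \<longrightarrow> f q \<in> V \<and> k (f q) = F (c q)" "p \<in> U" "f p \<in> V"
    using ab(3) by auto
  then show ?thesis using that ab(1,2) eq by blast
qed

lemma CmapI:
  assumes "\<And>p. p \<in> S \<Longrightarrow> \<exists>U c V k Q F. (U, c) \<in> A \<and> (V, k) \<in> B \<and> p \<in> U \<and> f p \<in> V \<and> open Q \<and> c p \<in> Q \<and>
    smooth_on r Q F \<and> (\<forall>q\<in>S \<inter> U. c q \<in> Q \<longrightarrow> f q \<in> V \<and> k (f q) = F (c q))"
  shows "Cmap r A B S f"
  unfolding Cmap_def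
proof
  fix p assume "p \<in> S"
  from assms[OF this] obtain U c V k Q F where *: "(U, c) \<in> A" "(V, k) \<in> B" "p \<in> U" "f p \<in> V"
    "open Q" "c p \<in> Q" "smooth_on r Q F" "\<forall>q\<in>S \<inter> U. c q \<in> Q \<longrightarrow> f q \<in> V \<and> k (f q) = F (c q)"
    by blast
  have "p \<in> U \<and> f p \<in> V \<and>
        (\<exists>Q F. open Q \<and> c p \<in> Q \<and> smooth_on r Q F \<and> (\<forall>q\<in>S \<inter> U. c q \<in> Q \<longrightarrow> f q \<in> V \<and> k (f q) = F (c q)))"
    using * by blast
  then have "\<exists>(V, k)\<in>B. p \<in> U \<and> f p \<in> V \<and>
        (\<exists>Q F. open Q \<and> c p \<in> Q \<and> smooth_on r Q F \<and> (\<forall>q\<in>S \<inter> U. c q \<in> Q \<longrightarrow> f q \<in> V \<and> k (f q) = F (c q)))"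
    using *(2) by (intro bexI[of _ "(V, k)"]) simp_all
  then show "\<exists>(U, c)\<in>A. \<exists>(V, k)\<in>B. p \<in> U \<and> f p \<in> V \<and>
        (\<exists>Q F. open Q \<and> c p \<in> Q \<and> smooth_on r Q F \<and> (\<forall>q\<in>S \<inter> U. c q \<in> Q \<longrightarrow> f q \<in> V \<and> k (f q) = F (c q)))"
    using *(1) by (intro bexI[of _ "(U, c)"]) simp_all
qed

lemma Cmap_subset:
  assumes "Cmap r A B S f" "S' \<subseteq> S"
  shows "Cmap r A B S' f"
proof (rule CmapI)
  fix p assume "p \<in> S'"
  then have "p \<in> S" using assms(2) by blast
  then obtain U c V k Q F where *: "(U, c) \<in> A" "(V, k) \<in> B" "p \<in> U" "f p \<in> V" "open Q" "c p \<in> Q"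
    "smooth_on r Q F" "\<forall>q. q \<in> S \<longrightarrow> q \<in> U \<longrightarrow> c q \<in> Q \<longrightarrow> f q \<in> V \<and> k (f q) = F (c q)"
    by (rule CmapE[OF assms(1)])
  then show "\<exists>U c V k Q F. (U, c) \<in> A \<and> (V, k) \<in> B \<and> p \<in> U \<and> f p \<in> V \<and> open Q \<and> c p \<in> Q \<and>
    smooth_on r Q F \<and> (\<forall>q\<in>S' \<inter> U. c q \<in> Q \<longrightarrow> f q \<in> V \<and> k (f q) = F (c q))"
    using assms(2) by (intro exI[of _ U] exI[of _ c] exI[of _ V] exI[of _ k] exI[of _ Q] exI[of _ F]) auto
qed

context
  fixes A :: "('a::{t2_space,second_countable_topology}, 'e::real_inner) chart set" and n :: nat
  assumes A: "smooth_manifold A n"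
begin

lemma model_coordinates:
  obtains B :: "'e set" and c where "coordinates B c"
proof -
  obtain B :: "'e set" where "finite B" "span B = UNIV" using A unfolding smooth_manifold_def by blast
  then show ?thesis using coordinates_real_inner that by blast
qed

lemma atlas_cover: obtains U c where "(U, c) \<in> A" "p \<in> U"
  using A unfolding smooth_manifold_def by blast

lemma
  assumes "(U, c) \<in> A"
  shows chart_open: "open U" and chart_open_image: "open (c ` U)"
    and chart_homeomorphism: "homeomorphism U (c ` U) c (inv_into U c)"
    and chart_transition: "(V, k) \<in> A \<Longrightarrow> smooth_on \<infinity> (c ` (U \<inter> V)) (k \<circ> inv_into U c)"
  using A assms unfolding smooth_manifold_def by blast+

lemma chart_inv: "(U, c) \<in> A \<Longrightarrow> p \<in> U \<Longrightarrow> inv_into U c (c p) = p"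
  using homeomorphism_apply1[OF chart_homeomorphism] .

lemma chart_inj: "(U, c) \<in> A \<Longrightarrow> inj_on c U"
  by (metis chart_inv inj_onI)

lemma chart_image_open:
  assumes "(U, c) \<in> A" "open S"
  shows "open (c ` (U \<inter> S))"
proof -
  have "openin (top_of_set (c ` U)) (c ` (U \<inter> S))"
    by (rule homeomorphism_imp_open_map[OF chart_homeomorphism[OF assms(1)]]) (simp add: assms(2) openin_open_Int)
  then show ?thesis using chart_open_image[OF assms(1)] openin_open_trans by blast
qed

end

lemma Cmap_compose:
  fixes B :: "('b::{t2_space,second_countable_topology}, 'f::real_inner) chart set"
  assumes B: "smooth_manifold B n" and f: "Cmap \<infinity> A B S f" and g: "Cmap \<infinity> B D T g" and sub: "f ` S \<subseteq> T"
  shows "Cmap \<infinity> A D S (g \<circ> f)"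
proof (rule CmapI)
  fix p assume p: "p \<in> S"
  obtain E :: "'f set" and e where E: "coordinates E e" by (rule model_coordinates[OF B])
  obtain U c V k Q F where f': "(U, c) \<in> A" "(V, k) \<in> B" "p \<in> U" "f p \<in> V" "open Q" "c p \<in> Q"
    "smooth_on \<infinity> Q F" "\<forall>q. q \<in> S \<longrightarrow> q \<in> U \<longrightarrow> c q \<in> Q \<longrightarrow> f q \<in> V \<and> k (f q) = F (c q)"
    by (rule CmapE[OF f p])
  have "f p \<in> T" using p sub by blast
  then obtain V' k' Z l Q' G where g': "(V', k') \<in> B" "(Z, l) \<in> D" "f p \<in> V'" "g (f p) \<in> Z"
    "open Q'" "k' (f p) \<in> Q'" "smooth_on \<infinity> Q' G"
    "\<forall>q. q \<in> T \<longrightarrow> q \<in> V' \<longrightarrow> k' q \<in> Q' \<longrightarrow> g q \<in> Z \<and> l (g q) = G (k' q)"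
    by (rule CmapE[OF g])
  define \<tau> where "\<tau> = k' \<circ> inv_into V k"
  have \<tau>: "smooth_on \<infinity> (k ` (V \<inter> V')) \<tau>" unfolding \<tau>_def by (rule chart_transition[OF B f'(2) g'(1)])
  have \<tau>_eq: "\<tau> (k q) = k' q" if "q \<in> V" for q using chart_inv[OF B f'(2) that] by (simp add: \<tau>_def)
  have VV: "open (k ` (V \<inter> V'))" by (rule chart_image_open[OF B f'(2) chart_open[OF B g'(1)]])
  define R where "R = k ` (V \<inter> V') \<inter> \<tau> -` Q'"
  have R: "open R" unfolding R_def
    by (rule continuous_open_preimage[OF smooth_on_imp_continuous_on[OF \<tau>] VV g'(5)])
  define P where "P = Q \<inter> F -` R"
  have P: "open P" unfolding P_def
    by (rule continuous_open_preimage[OF smooth_on_imp_continuous_on[OF f'(7)] f'(5) R])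
  have "smooth_on \<infinity> R (\<lambda>a. G (\<tau> a))"
    by (rule smooth_on_compose[OF E R g'(5) _ g'(7)]) (auto simp: R_def intro: smooth_on_subset[OF \<tau>])
  then have sm: "smooth_on \<infinity> P (\<lambda>a. G (\<tau> (F a)))"
    by (rule smooth_on_compose[OF E P R, where f = "\<lambda>a. G (\<tau> a)" and g = F, rotated])
      (auto simp: P_def intro: smooth_on_subset[OF f'(7)])
  have kf: "k (f p) = F (c p)" using f'(8)[rule_format, OF p f'(3,6)] by simp
  have cp: "c p \<in> P"
    using f'(4,6) g'(3,6) \<tau>_eq[OF f'(4)] kf[symmetric] by (auto simp: P_def R_def)
  have "g (f q) \<in> Z \<and> l (g (f q)) = G (\<tau> (F (c q)))" if q: "q \<in> S" "q \<in> U" "c q \<in> P" for q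
  proof -
    have fq: "f q \<in> V" "k (f q) = F (c q)" using f'(8)[rule_format, OF q(1,2)] q(3) by (auto simp: P_def)
    have "k (f q) \<in> k ` (V \<inter> V')" "\<tau> (k (f q)) \<in> Q'" using q(3) fq by (auto simp: P_def R_def)
    then have "f q \<in> V'" "k' (f q) \<in> Q'"
      using chart_inj[OF B f'(2)] fq(1) \<tau>_eq[OF fq(1)] by (auto simp: inj_on_def)
    then show ?thesis using g'(8)[rule_format, of "f q"] q(1) sub fq \<tau>_eq[OF fq(1)] by auto
  qed
  then show "\<exists>U c V k Q F. (U, c) \<in> A \<and> (V, k) \<in> D \<and> p \<in> U \<and> (g \<circ> f) p \<in> V \<and> open Q \<and> c p \<in> Q \<and>
    smooth_on \<infinity> Q F \<and> (\<forall>q\<in>S \<inter> U. c q \<in> Q \<longrightarrow> (g \<circ> f) q \<in> V \<and> k ((g \<circ> f) q) = F (c q))"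
    using f'(1,3) g'(2,4) P cp sm
    by (intro exI[of _ U] exI[of _ c] exI[of _ Z] exI[of _ l] exI[of _ P] exI[of _ "\<lambda>a. G (\<tau> (F a))"]) auto
qed

lemma Cmap_in_chart:
  fixes A :: "('a::{t2_space,second_countable_topology}, 'e::real_inner) chart set"
  assumes A: "smooth_manifold A n" and f: "Cmap \<infinity> A B S f" and S: "open S"
    and chart: "(U, c) \<in> A" and p: "p \<in> U" "p \<in> S"
  obtains V k R where "(V, k) \<in> B" "open R" "c p \<in> R" "R \<subseteq> c ` (U \<inter> S)"
    "\<And>a. a \<in> R \<Longrightarrow> f (inv_into U c a) \<in> V" "smooth_on \<infinity> R (k \<circ> f \<circ> inv_into U c)"
proof -
  obtain E :: "'e set" and e where E: "coordinates E e" by (rule model_coordinates[OF A])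
  obtain U0 c0 V k Q F where f': "(U0, c0) \<in> A" "(V, k) \<in> B" "p \<in> U0" "f p \<in> V" "open Q" "c0 p \<in> Q"
    "smooth_on \<infinity> Q F" "\<forall>q. q \<in> S \<longrightarrow> q \<in> U0 \<longrightarrow> c0 q \<in> Q \<longrightarrow> f q \<in> V \<and> k (f q) = F (c0 q)"
    by (rule CmapE[OF f p(2)])
  define \<tau> where "\<tau> = c0 \<circ> inv_into U c"
  let ?O = "c ` (U \<inter> (U0 \<inter> S))"
  have \<tau>: "smooth_on \<infinity> ?O \<tau>"
    unfolding \<tau>_def by (rule smooth_on_subset[OF chart_transition[OF A chart f'(1)]]) auto
  have \<tau>_eq: "\<tau> (c q) = c0 q" if "q \<in> U" for q using chart_inv[OF A chart that] by (simp add: \<tau>_def)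
  have O: "open ?O" by (rule chart_image_open[OF A chart open_Int[OF chart_open[OF A f'(1)] S]])
  define R where "R = ?O \<inter> \<tau> -` Q"
  have R: "open R" unfolding R_def
    by (rule continuous_open_preimage[OF smooth_on_imp_continuous_on[OF \<tau>] O f'(5)])
  have loc: "f (inv_into U c a) \<in> V \<and> k (f (inv_into U c a)) = F (\<tau> a)" if a: "a \<in> R" for a
  proof -
    obtain q where q: "a = c q" "q \<in> U" "q \<in> U0" "q \<in> S" "\<tau> a \<in> Q"
      using a by (auto simp: R_def)
    then show ?thesis using f'(8)[rule_format, OF q(4,3)] \<tau>_eq[OF q(2)] chart_inv[OF A chart q(2)] by simp
  qed
  have "smooth_on \<infinity> R (\<lambda>a. F (\<tau> a))"
    by (rule smooth_on_compose[OF E R f'(5) _ f'(7)]) (auto simp: R_def intro: smooth_on_subset[OF \<tau>])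
  then have "smooth_on \<infinity> R (k \<circ> f \<circ> inv_into U c)"
    by (rule smooth_on_cong[OF _ R]) (simp add: loc)
  moreover have "c p \<in> R" using p f'(3,6) \<tau>_eq[OF p(1)] by (auto simp: R_def)
  ultimately show ?thesis using that[OF f'(2) R] loc by (auto simp: R_def)
qed

lemma Cmap_std_in_chart:
  assumes A: "smooth_manifold A n" and f: "Cmap \<infinity> A std_atlas UNIV f" and chart: "(U, c) \<in> A"
  shows "smooth_on \<infinity> (c ` U) (f \<circ> inv_into U c)"
proof -
  have "\<exists>T. open T \<and> a \<in> T \<and> higher_differentiable_on T (f \<circ> inv_into U c) j" if a: "a \<in> c ` U" for a j
  proof -
    obtain p where p: "a = c p" "p \<in> U" using a by blast
    obtain V k R where VR: "(V, k) \<in> std_atlas" "open R" "c p \<in> R" "smooth_on \<infinity> R (k \<circ> f \<circ> inv_into U c)"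
      by (rule Cmap_in_chart[OF A f open_UNIV chart p(2) UNIV_I])
    then have "smooth_on \<infinity> R (f \<circ> inv_into U c)" by (simp add: std_atlas_def)
    then show ?thesis using VR(2,3) p(1) by (auto simp: smooth_on_infinity)
  qed
  then show ?thesis
    unfolding smooth_on_infinity using higher_differentiable_on_local by metis
qed

section \<open>Tangent spaces and bundles\<close>

lemma frechet_derivative_compose_range:
  assumes "open R" "a \<in> R" "\<And>b. b \<in> R \<Longrightarrow> h b = F (G b)"
    and G: "G differentiable (at a)" and F: "F differentiable (at (G a))"
  shows "range (frechet_derivative h (at a)) \<subseteq> range (frechet_derivative F (at (G a)))"
proof -
  have "frechet_derivative h (at a) = frechet_derivative (\<lambda>b. F (G b)) (at a)"
    by (rule frechet_derivative_cong_open[OF assms(1-3)])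
  also have "\<dots> = frechet_derivative F (at (G a)) \<circ> frechet_derivative G (at a)"
    using frechet_derivative_compose[of G a F] G F by (simp add: comp_def)
  finally show ?thesis by auto
qed

lemma tangent_image_eq:
  assumes A: "smooth_manifold A n" and h: "Cmap \<infinity> A std_atlas UNIV h" and chart: "(U, c) \<in> A" "p \<in> U"
  shows "tangent_image A h p = range (frechet_derivative (h \<circ> inv_into U c) (at (c p)))"
proof -
  have sub: "range (frechet_derivative (h \<circ> inv_into V k) (at (k p))) \<subseteq>
      range (frechet_derivative (h \<circ> inv_into U c) (at (c p)))"
    if V: "(V, k) \<in> A" "p \<in> V" for V k
  proof -
    let ?\<tau> = "c \<circ> inv_into V k"
    have \<tau>p: "?\<tau> (k p) = c p" using chart_inv[OF A V] by simp
    have "range (frechet_derivative (h \<circ> inv_into V k) (at (k p))) \<subseteq>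
      range (frechet_derivative (h \<circ> inv_into U c) (at (?\<tau> (k p))))"
    proof (rule frechet_derivative_compose_range)
      show "open (k ` (V \<inter> U))" by (rule chart_image_open[OF A V(1) chart_open[OF A chart(1)]])
      show "k p \<in> k ` (V \<inter> U)" using V chart by blast
      show "(h \<circ> inv_into V k) b = (h \<circ> inv_into U c) (?\<tau> b)" if "b \<in> k ` (V \<inter> U)" for b
        using that chart_inv[OF A V(1)] chart_inv[OF A chart(1)] by auto
      show "?\<tau> differentiable (at (k p))"
        using smooth_on_imp_has_derivative[OF chart_transition[OF A V(1) chart(1)], of "k p"] V chart
        by (auto simp: differentiable_def)
      show "(h \<circ> inv_into U c) differentiable (at (?\<tau> (k p)))"
        unfolding \<tau>p using smooth_on_imp_has_derivative[OF Cmap_std_in_chart[OF A h chart(1)], of "c p"] chart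
        by (auto simp: differentiable_def)
    qed
    then show ?thesis unfolding \<tau>p .
  qed
  show ?thesis
  proof
    show "tangent_image A h p \<subseteq> range (frechet_derivative (h \<circ> inv_into U c) (at (c p)))"
      using sub unfolding tangent_image_def by fast
    show "range (frechet_derivative (h \<circ> inv_into U c) (at (c p))) \<subseteq> tangent_image A h p"
      using chart unfolding tangent_image_def by blast
  qed
qed

lemma subspace_tangent_image:
  assumes A: "smooth_manifold A n" and h: "Cmap \<infinity> A std_atlas UNIV h"
  shows "subspace (tangent_image A h p)"
proof -
  obtain U c where chart: "(U, c) \<in> A" "p \<in> U" by (rule atlas_cover[OF A])
  have "linear (frechet_derivative (h \<circ> inv_into U c) (at (c p)))"
    using smooth_on_imp_has_derivative[OF Cmap_std_in_chart[OF A h chart(1)], of "c p"] chart(2)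
    by (auto intro: has_derivative_linear)
  then show ?thesis
    unfolding tangent_image_eq[OF A h chart] by (simp add: linear_subspace_image)
qed

lemma tangent_image_compose:
  assumes A: "smooth_manifold A m" and B: "smooth_manifold B n"
    and h: "Cmap \<infinity> B std_atlas UNIV h" and x: "Cmap \<infinity> A B UNIV x"
  shows "tangent_image A (h \<circ> x) p \<subseteq> tangent_image B h (x p)"
proof -
  obtain U c where chart: "(U, c) \<in> A" "p \<in> U" by (rule atlas_cover[OF A])
  obtain V k R where VR: "(V, k) \<in> B" "open R" "c p \<in> R" "R \<subseteq> c ` (U \<inter> UNIV)"
    "\<And>a. a \<in> R \<Longrightarrow> x (inv_into U c a) \<in> V" "smooth_on \<infinity> R (k \<circ> x \<circ> inv_into U c)"
    by (rule Cmap_in_chart[OF A x open_UNIV chart UNIV_I]) blast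
  have xp: "x p \<in> V" using VR(5)[OF VR(3)] chart_inv[OF A chart] by simp
  have hx: "Cmap \<infinity> A std_atlas UNIV (h \<circ> x)" by (rule Cmap_compose[OF B x h]) simp
  let ?G = "k \<circ> x \<circ> inv_into U c"
  have Gp: "?G (c p) = k (x p)" using chart_inv[OF A chart] by simp
  have "range (frechet_derivative (h \<circ> x \<circ> inv_into U c) (at (c p))) \<subseteq>
      range (frechet_derivative (h \<circ> inv_into V k) (at (?G (c p))))"
  proof (rule frechet_derivative_compose_range[OF VR(2,3)])
    show "(h \<circ> x \<circ> inv_into U c) b = (h \<circ> inv_into V k) (?G b)" if "b \<in> R" for b
      using VR(5)[OF that] chart_inv[OF B VR(1)] by simp
    show "?G differentiable (at (c p))"
      using smooth_on_imp_has_derivative[OF VR(6,3)] by (auto simp: differentiable_def)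
    show "(h \<circ> inv_into V k) differentiable (at (?G (c p)))"
      unfolding Gp using smooth_on_imp_has_derivative[OF Cmap_std_in_chart[OF B h VR(1)], of "k (x p)"] xp
      by (auto simp: differentiable_def)
  qed
  then show ?thesis
    unfolding Gp tangent_image_eq[OF A hx chart] tangent_image_eq[OF B h VR(1) xp] .
qed

lemma Cmap_const_std:
  assumes A: "smooth_manifold A n"
  shows "Cmap \<infinity> A std_atlas S (\<lambda>_. v)"
proof (rule CmapI)
  fix p
  obtain U c where "(U, c) \<in> A" "p \<in> U" by (rule atlas_cover[OF A])
  then show "\<exists>U c V k Q F. (U, c) \<in> A \<and> (V, k) \<in> std_atlas \<and> p \<in> U \<and> v \<in> V \<and> open Q \<and> c p \<in> Q \<and>
    smooth_on \<infinity> Q F \<and> (\<forall>q\<in>S \<inter> U. c q \<in> Q \<longrightarrow> v \<in> V \<and> k v = F (c q))"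
    by (intro exI[of _ U] exI[of _ c] exI[of _ UNIV] exI[of _ id] exI[of _ "\<lambda>_. v"])
      (simp add: std_atlas_def smooth_on_const)
qed

lemma smooth_bundle_frame:
  fixes E :: "'m::topological_space \<Rightarrow> 'd::real_normed_vector set"
  assumes "\<And>p. \<exists>Q (s :: 'b \<Rightarrow> 'm \<Rightarrow> 'd) B. open Q \<and> p \<in> Q \<and> finite B \<and> (\<forall>b\<in>B. Cmap \<infinity> A std_atlas Q (s b)) \<and>
    (\<forall>q\<in>Q. inj_on (\<lambda>b. s b q) B \<and> independent ((\<lambda>b. s b q) ` B) \<and> span ((\<lambda>b. s b q) ` B) = E q)"
  shows "smooth_bundle A E"
  unfolding smooth_bundle_def
proof
  fix p
  obtain Q B and s :: "'b \<Rightarrow> 'm \<Rightarrow> 'd" where Q: "open Q" "p \<in> Q" "finite B" "\<forall>b\<in>B. Cmap \<infinity> A std_atlas Q (s b)"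
    "\<forall>q\<in>Q. inj_on (\<lambda>b. s b q) B \<and> independent ((\<lambda>b. s b q) ` B) \<and> span ((\<lambda>b. s b q) ` B) = E q"
    using assms[of p] by blast
  obtain e where e: "bij_betw e {..<card B} B"
    using ex_bij_betw_nat_finite[OF Q(3)] by (auto simp: atLeast0LessThan)
  then have eB: "e ` {..<card B} = B" "inj_on e {..<card B}" by (auto simp: bij_betw_def)
  show "\<exists>Q r (s :: nat \<Rightarrow> 'm \<Rightarrow> 'd). open Q \<and> p \<in> Q \<and> (\<forall>i<r. Cmap \<infinity> A std_atlas Q (s i)) \<and>
        (\<forall>q\<in>Q. inj_on (\<lambda>i. s i q) {..<r} \<and> independent ((\<lambda>i. s i q) ` {..<r}) \<and>
           span ((\<lambda>i. s i q) ` {..<r}) = E q)"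
  proof (intro exI conjI ballI allI impI)
    show "Cmap \<infinity> A std_atlas Q (s (e i))" if "i < card B" for i using Q(4) eB that by auto
    fix q assume q: "q \<in> Q"
    have "(\<lambda>i. s (e i) q) ` {..<card B} = (\<lambda>b. s b q) ` (e ` {..<card B})" by (simp add: image_image)
    then have im: "(\<lambda>i. s (e i) q) ` {..<card B} = (\<lambda>b. s b q) ` B" by (simp only: eB(1))
    show "inj_on (\<lambda>i. s (e i) q) {..<card B}"
      using comp_inj_on[OF eB(2), of "\<lambda>b. s b q"] Q(5) q by (simp add: eB comp_def)
    show "independent ((\<lambda>i. s (e i) q) ` {..<card B})" "span ((\<lambda>i. s (e i) q) ` {..<card B}) = E q"
      unfolding im using Q(5) q by auto
  qed (use Q in auto)
qed

lemma smooth_bundle_trivial: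
  assumes A: "smooth_manifold A n"
  shows "smooth_bundle A (\<lambda>_. UNIV :: 'd::euclidean_space set)"
proof (rule smooth_bundle_frame)
  fix p
  show "\<exists>Q (s :: 'd \<Rightarrow> _ \<Rightarrow> 'd) B. open Q \<and> p \<in> Q \<and> finite B \<and> (\<forall>b\<in>B. Cmap \<infinity> A std_atlas Q (s b)) \<and>
    (\<forall>q\<in>Q. inj_on (\<lambda>b. s b q) B \<and> independent ((\<lambda>b. s b q) ` B) \<and> span ((\<lambda>b. s b q) ` B) = UNIV)"
    by (intro exI[of _ UNIV] exI[of _ "\<lambda>b _. b"] exI[of _ Basis])
      (auto simp: Cmap_const_std[OF A] independent_Basis)
qed

lemma Cembedding_imp_Cmap: "Cembedding r A B y \<Longrightarrow> Cmap r A B UNIV y"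
  by (simp add: Cembedding_def)

lemma Cembedding_imp_homeomorphism: "Cembedding r A B y \<Longrightarrow> \<exists>z. homeomorphism UNIV (range y) y z"
  by (simp add: Cembedding_def)

lemma Cembedding_imp_inj:
  assumes "Cembedding r A B y"
  shows "inj y"
proof -
  obtain z where "homeomorphism UNIV (range y) y z" using Cembedding_imp_homeomorphism[OF assms] by blast
  then show ?thesis by (metis UNIV_I homeomorphism_apply1 inj_onI)
qed

lemma Cembedding_imp_continuous:
  assumes "Cembedding r A B y"
  shows "continuous_on UNIV y"
  using Cembedding_imp_homeomorphism[OF assms] by (auto simp: homeomorphism_def)

lemma smooth_bundle_pullback_TN:
  fixes AN :: "('n::{t2_space,second_countable_topology}, 'f::real_inner) chart set"
  assumes N: "smooth_manifold AN n" and phi: "Cembedding \<infinity> AN std_atlas \<phi>"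
    and x: "Cembedding \<infinity> AM AN x"
  shows "smooth_bundle AM (pullback_TN AN \<phi> x)"
proof (rule smooth_bundle_frame)
  fix p
  obtain V k where chart: "(V, k) \<in> AN" "x p \<in> V" by (rule atlas_cover[OF N])
  obtain B :: "'f set" where B: "finite B" "independent B" "span B = UNIV"
    using N unfolding smooth_manifold_def by blast
  let ?D = "\<lambda>a. frechet_derivative (\<phi> \<circ> inv_into V k) (at a)"
  have \<phi>: "Cmap \<infinity> AN std_atlas UNIV \<phi>" by (rule Cembedding_imp_Cmap[OF phi])
  have sm: "smooth_on \<infinity> (k ` V) (\<phi> \<circ> inv_into V k)" by (rule Cmap_std_in_chart[OF N \<phi> chart(1)])
  let ?Q = "x -` V"
  have Q: "open ?Q" using open_vimage[OF chart_open[OF N chart(1)] Cembedding_imp_continuous[OF x]] .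
  have "Cmap \<infinity> AM std_atlas ?Q (\<lambda>q. ?D (k (x q)) b)" for b
  proof -
    have D: "smooth_on \<infinity> (k ` V) (\<lambda>a. ?D a b)"
      unfolding smooth_on_infinity
    proof
      fix j
      have "higher_differentiable_on (k ` V) (\<phi> \<circ> inv_into V k) (Suc j)" using sm by (simp only: smooth_on_infinity)
      then show "higher_differentiable_on (k ` V) (\<lambda>a. ?D a b) j" by simp
    qed
    have "Cmap \<infinity> AN std_atlas V (\<lambda>r. ?D (k r) b)"
    proof (rule CmapI)
      fix r assume "r \<in> V"
      then show "\<exists>U c W l Q F. (U, c) \<in> AN \<and> (W, l) \<in> std_atlas \<and> r \<in> U \<and> ?D (k r) b \<in> W \<and> open Q \<and> c r \<in> Q \<and>
        smooth_on \<infinity> Q F \<and> (\<forall>q\<in>V \<inter> U. c q \<in> Q \<longrightarrow> ?D (k q) b \<in> W \<and> l (?D (k q) b) = F (c q))"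
        using D chart(1) chart_open_image[OF N chart(1)]
        by (intro exI[of _ V] exI[of _ k] exI[of _ UNIV] exI[of _ id] exI[of _ "k ` V"] exI[of _ "\<lambda>a. ?D a b"])
          (simp add: std_atlas_def)
    qed
    then have "Cmap \<infinity> AM std_atlas ?Q ((\<lambda>r. ?D (k r) b) \<circ> x)"
      by (rule Cmap_compose[OF N Cmap_subset[OF Cembedding_imp_Cmap[OF x] subset_UNIV]]) auto
    then show ?thesis by (simp add: comp_def)
  qed
  moreover have "inj_on (\<lambda>b. ?D (k (x q)) b) B \<and> independent ((\<lambda>b. ?D (k (x q)) b) ` B) \<and>
      span ((\<lambda>b. ?D (k (x q)) b) ` B) = pullback_TN AN \<phi> x q" if q: "q \<in> ?Q" for q
  proof -
    have xq: "x q \<in> V" using q by simp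
    have lin: "linear (?D (k (x q)))"
      using smooth_on_imp_has_derivative[OF sm, of "k (x q)"] xq by (auto intro: has_derivative_linear)
    have "\<forall>(U, c)\<in>AN. \<forall>(W, l)\<in>std_atlas. \<forall>p\<in>U. \<phi> p \<in> W \<longrightarrow>
        inj (frechet_derivative (l \<circ> \<phi> \<circ> inv_into U c) (at (c p)))"
      using phi unfolding Cembedding_def by blast
    from bspec[OF this chart(1)] have inj: "inj (?D (k (x q)))"
      using xq by (simp add: std_atlas_def)
    have "span (?D (k (x q)) ` B) = range (?D (k (x q)))"
      using linear_span_image[OF lin, of B] B(3) by simp
    then have "span (?D (k (x q)) ` B) = pullback_TN AN \<phi> x q"
      unfolding pullback_TN_def tangent_image_eq[OF N \<phi> chart(1) xq] .
    moreover have "independent (?D (k (x q)) ` B)"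
      by (rule linear_independent_injective_image[OF lin B(2)]) (rule inj_on_subset[OF inj], simp)
    moreover have "inj_on (?D (k (x q))) B" by (rule inj_on_subset[OF inj]) simp
    ultimately show ?thesis by blast
  qed
  ultimately show "\<exists>Q (s :: 'f \<Rightarrow> _) B. open Q \<and> p \<in> Q \<and> finite B \<and> (\<forall>b\<in>B. Cmap \<infinity> AM std_atlas Q (s b)) \<and>
    (\<forall>q\<in>Q. inj_on (\<lambda>b. s b q) B \<and> independent ((\<lambda>b. s b q) ` B) \<and> span ((\<lambda>b. s b q) ` B) = pullback_TN AN \<phi> x q)"
    using Q chart(2) B(1) by (intro exI[of _ ?Q] exI[of _ "\<lambda>b q. ?D (k (x q)) b"] exI[of _ B]) simp
qed

lemma subspace_normal_bundle:
  assumes M: "smooth_manifold AM m" and N: "smooth_manifold AN n" and \<phi>: "Cmap \<infinity> AN std_atlas UNIV \<phi>"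
    and x: "Cmap \<infinity> AM AN UNIV x" and g: "riemannian_metric AN \<phi> g"
  shows "subspace (normal_bundle AM AN \<phi> g x p)"
proof -
  let ?T = "tangent_image AN \<phi> (x p)"
  have T: "subspace ?T" by (rule subspace_tangent_image[OF N \<phi>])
  have lin: "g (x p) (a *\<^sub>R u + v) w = a * g (x p) u w + g (x p) v w"
    if "u \<in> ?T" "v \<in> ?T" "w \<in> ?T" for u v w a
    using g that unfolding riemannian_metric_def by blast
  have w: "w \<in> ?T" if "w \<in> tangent_image AM (\<phi> \<circ> x) p" for w
    using tangent_image_compose[OF M N \<phi> x] that by blast
  have zero: "g (x p) 0 w = 0" if "w \<in> ?T" for w
    using lin[of 0 0 w 1] that subspace_0[OF T] by simp
  show ?thesis
    unfolding normal_bundle_def pullback_TN_def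
  proof (rule subspaceI)
    show "0 \<in> {v \<in> ?T. \<forall>w\<in>tangent_image AM (\<phi> \<circ> x) p. g (x p) v w = 0}"
      using subspace_0[OF T] zero w by simp
    fix u v and a :: real
    assume u: "u \<in> {v \<in> ?T. \<forall>w\<in>tangent_image AM (\<phi> \<circ> x) p. g (x p) v w = 0}"
    show "a *\<^sub>R u \<in> {v \<in> ?T. \<forall>w\<in>tangent_image AM (\<phi> \<circ> x) p. g (x p) v w = 0}"
      using u lin[of u 0 _ a] subspace_0[OF T] subspace_scale[OF T] zero w by simp
    assume v: "v \<in> {v \<in> ?T. \<forall>w\<in>tangent_image AM (\<phi> \<circ> x) p. g (x p) v w = 0}"
    show "u + v \<in> {v \<in> ?T. \<forall>w\<in>tangent_image AM (\<phi> \<circ> x) p. g (x p) v w = 0}"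
      using u v lin[of u v _ 1] subspace_add[OF T] w by simp
  qed
qed

section \<open>Spaces of sections\<close>

lemma regularity_class_sup_bound:
  assumes M: "smooth_manifold AM m" "compact (UNIV :: 'm set)"
    and C: "regularity_class AM (C :: ('m::{t2_space,second_countable_topology} \<Rightarrow> real) normed_sp)"
  obtains b where "0 \<le> b" "\<forall>h\<in>vecs C. \<forall>p. \<bar>h p\<bar> \<le> b * nrm C h"
proof -
  have C_norm: "normed C" using C by (intro banach_space_imp_normed) (simp add: regularity_class_def)
  have "\<exists>V b. open V \<and> p \<in> V \<and> (\<forall>h\<in>vecs C. \<forall>q\<in>V. \<bar>h q\<bar> \<le> b * nrm C h)" for p
  proof -
    obtain U c where chart: "(U, c) \<in> AM" "p \<in> U" by (rule atlas_cover[OF M(1)])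
    have "compact_space (euclidean :: 'm topology)" using M(2) by (simp add: compact_space_def)
    then have "regular_space (euclidean :: 'm topology)"
      by (rule compact_Hausdorff_imp_regular_space)
        (use hausdorff in \<open>fastforce simp: Hausdorff_space_def disjnt_def\<close>)
    moreover have "closedin euclidean (- U)" using chart_open[OF M(1) chart(1)] by (simp add: closed_Compl)
    moreover have "p \<in> topspace euclidean - (- U)" using chart(2) by simp
    ultimately have "\<exists>V Z. openin euclidean V \<and> openin euclidean Z \<and> p \<in> V \<and> - U \<subseteq> Z \<and> disjnt V Z"
      unfolding regular_space_def by (elim allE[of _ "- U"] allE[of _ p]) (rule mp, assumption, rule conjI)
    then obtain V Z where VZ: "open V" "open Z" and VZ': "p \<in> V" "- U \<subseteq> Z" "disjnt V Z"
      by (auto simp: open_openin[symmetric])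
    have K: "compact (- Z) \<and> - Z \<subseteq> U"
      using VZ(2) VZ'(2) compact_Int_closed[OF M(2), of "- Z"] by auto
    have "\<forall>(U, c)\<in>AM. \<forall>K. compact K \<and> K \<subseteq> U \<longrightarrow>
        (\<exists>b. \<forall>h\<in>vecs C. \<forall>p\<in>K. \<bar>h p\<bar> \<le> b * nrm C h \<and>
           onorm (frechet_derivative (h \<circ> inv_into U c) (at (c p))) \<le> b * nrm C h)"
      using C unfolding regularity_class_def by blast
    from bspec[OF this chart(1)] have "\<forall>K. compact K \<and> K \<subseteq> U \<longrightarrow>
        (\<exists>b. \<forall>h\<in>vecs C. \<forall>p\<in>K. \<bar>h p\<bar> \<le> b * nrm C h \<and>
           onorm (frechet_derivative (h \<circ> inv_into U c) (at (c p))) \<le> b * nrm C h)"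
      by simp
    from mp[OF spec[OF this] K] obtain b where "\<forall>h\<in>vecs C. \<forall>q\<in>- Z. \<bar>h q\<bar> \<le> b * nrm C h"
      by auto
    moreover have "V \<subseteq> - Z" using VZ'(3) by (auto simp: disjnt_def)
    ultimately show ?thesis using VZ(1) VZ'(1) by blast
  qed
  then have "\<forall>p. \<exists>Vb. open (fst Vb) \<and> p \<in> fst Vb \<and> (\<forall>h\<in>vecs C. \<forall>q\<in>fst Vb. \<bar>h q\<bar> \<le> snd Vb * nrm C h)"
    by simp
  then obtain Vb where "\<forall>p. open (fst (Vb p)) \<and> p \<in> fst (Vb p) \<and>
      (\<forall>h\<in>vecs C. \<forall>q\<in>fst (Vb p). \<bar>h q\<bar> \<le> snd (Vb p) * nrm C h)"
    by (rule choice[THEN exE])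
  then obtain V b where Vb: "\<And>p. open (V p)" "\<And>p. p \<in> V p"
    "\<And>p h q. h \<in> vecs C \<Longrightarrow> q \<in> V p \<Longrightarrow> \<bar>h q\<bar> \<le> b p * nrm C h"
    by (rule_tac that[of "\<lambda>p. fst (Vb p)" "\<lambda>p. snd (Vb p)"]) blast+
  obtain D where D: "finite D" "UNIV \<subseteq> (\<Union>p\<in>D. V p)"
    by (rule compactE_image[OF M(2), of UNIV V]) (use Vb in auto)
  have "\<bar>h q\<bar> \<le> (\<Sum>p\<in>D. \<bar>b p\<bar>) * nrm C h" if h: "h \<in> vecs C" for h q
  proof -
    obtain p where p: "p \<in> D" "q \<in> V p" using D by blast
    have "\<bar>h q\<bar> \<le> b p * nrm C h" by (rule Vb(3)[OF h p(2)])
    also have "\<dots> \<le> (\<Sum>p\<in>D. \<bar>b p\<bar>) * nrm C h"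
      using nrm_nonneg[OF C_norm h] member_le_sum[OF p(1), of "\<lambda>p. \<bar>b p\<bar>"] D(1)
      by (intro mult_right_mono) auto
    finally show ?thesis .
  qed
  moreover have "0 \<le> (\<Sum>p\<in>D. \<bar>b p\<bar>)" by (simp add: sum_nonneg)
  ultimately show ?thesis using that by blast
qed

lemma vecs_vec_class: "h \<in> vecs (vec_class C) \<longleftrightarrow> (\<forall>b\<in>Basis. (\<lambda>p. h p \<bullet> b) \<in> vecs C)"
  by (simp add: vec_class_def)

lemma nrm_vec_class: "nrm (vec_class C) h = (\<Sum>b\<in>Basis. nrm C (\<lambda>p. h p \<bullet> b))"
  by (simp add: vec_class_def)

lemma normed_vec_class:
  fixes C :: "('m \<Rightarrow> real) normed_sp"
  assumes C: "normed C"
  shows "normed (vec_class C :: ('m \<Rightarrow> 'd::euclidean_space) normed_sp)" (is "normed ?V")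
proof -
  have plus: "(\<lambda>p. (u + v) p \<bullet> b) = (\<lambda>p. u p \<bullet> b) + (\<lambda>p. v p \<bullet> b)" for u v :: "'m \<Rightarrow> 'd" and b
    by (simp add: fun_eq_iff inner_add_left)
  have scale: "(\<lambda>p. (a *\<^sub>R u) p \<bullet> b) = a *\<^sub>R (\<lambda>p. u p \<bullet> b)" for u :: "'m \<Rightarrow> 'd" and a b
    by (simp add: fun_eq_iff scaleR_fun_def)
  have zero: "(\<lambda>p. (0 :: 'm \<Rightarrow> 'd) p \<bullet> b) = 0" for b by (simp add: fun_eq_iff)
  show ?thesis
    unfolding normed_def
  proof (intro conjI ballI allI)
    show "subspace (vecs ?V)"
      by (rule subspaceI)
        (simp_all only: vecs_vec_class plus scale zero, simp_all add: vecs_zero[OF C] vecs_add[OF C] vecs_scale[OF C])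
    fix u :: "'m \<Rightarrow> 'd" assume u: "u \<in> vecs ?V"
    then have ub: "(\<lambda>p. u p \<bullet> b) \<in> vecs C" if "b \<in> Basis" for b using that by (simp add: vecs_vec_class)
    show "0 \<le> nrm ?V u" unfolding nrm_vec_class by (intro sum_nonneg nrm_nonneg[OF C] ub)
    show "nrm ?V u = 0 \<longleftrightarrow> u = 0"
    proof
      assume "nrm ?V u = 0"
      then have "\<forall>b\<in>Basis. nrm C (\<lambda>p. u p \<bullet> b) = 0"
        unfolding nrm_vec_class by (subst (asm) sum_nonneg_eq_0_iff) (auto intro: nrm_nonneg[OF C] ub)
      then have z: "(\<lambda>p. u p \<bullet> b) = 0" if "b \<in> Basis" for b using that nrm_eq_0[OF C ub] by blast
      have "u p \<bullet> b = 0" if "b \<in> Basis" for b p using fun_cong[OF z[OF that], of p] by simp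
      then have "u p = 0" for p by (simp add: euclidean_eq_iff[of "u p"])
      then show "u = 0" by (simp add: fun_eq_iff)
    next
      assume "u = 0"
      then show "nrm ?V u = 0" unfolding nrm_vec_class by (simp add: nrm_zero[OF C] flip: zero_fun_def)
    qed
    show "nrm ?V (a *\<^sub>R u) = \<bar>a\<bar> * nrm ?V u" for a
      unfolding nrm_vec_class scale sum_distrib_left by (rule sum.cong[OF refl]) (rule nrm_scale[OF C ub])
    fix v :: "'m \<Rightarrow> 'd" assume v: "v \<in> vecs ?V"
    then have vb: "(\<lambda>p. v p \<bullet> b) \<in> vecs C" if "b \<in> Basis" for b using that by (simp add: vecs_vec_class)
    show "nrm ?V (u + v) \<le> nrm ?V u + nrm ?V v"
      unfolding nrm_vec_class plus sum.distrib[symmetric] by (intro sum_mono nrm_triangle[OF C] ub vb)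
  qed
qed

lemma vecs_sections: "vecs (sections C E) = {u \<in> vecs (vec_class C). \<forall>p. u p \<in> E p}"
  by (auto simp: sections_def restrict_sp_def)

lemma nrm_sections: "nrm (sections C E) = nrm (vec_class C)"
  by (simp add: sections_def restrict_sp_def)

lemma sections_UNIV: "sections C (\<lambda>_. UNIV) = vec_class C"
  by (simp add: sections_def restrict_sp_def)

lemma normed_sections:
  assumes C: "normed C" and E: "\<And>p. subspace (E p)"
  shows "normed (sections C E)"
  unfolding sections_def
proof (rule normed_restrict_sp[OF normed_vec_class[OF C]])
  have "subspace {u. \<forall>p. u p \<in> E p}"
    by (rule subspaceI) (simp_all add: scaleR_fun_def subspace_0[OF E] subspace_add[OF E] subspace_scale[OF E])
  then show "subspace (vecs (vec_class C) \<inter> {u. \<forall>p. u p \<in> E p})"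
    by (rule subspace_inter[OF normed_def[THEN iffD1, OF normed_vec_class[OF C], THEN conjunct1]])
qed

lemma vec_class_norm_bound:
  assumes b: "\<forall>h\<in>vecs C. \<forall>p. \<bar>h p\<bar> \<le> b * nrm C h" and u: "u \<in> vecs (vec_class C)"
  shows "norm (u p) \<le> b * nrm (vec_class C) u"
proof -
  have "norm (u p) \<le> (\<Sum>i\<in>Basis. \<bar>u p \<bullet> i\<bar>)" by (rule norm_le_l1)
  also have "\<dots> \<le> (\<Sum>i\<in>Basis. b * nrm C (\<lambda>p. u p \<bullet> i))"
    using u by (intro sum_mono b[rule_format, of "\<lambda>p. u p \<bullet> _"]) (simp add: vecs_vec_class)
  finally show ?thesis by (simp add: nrm_vec_class sum_distrib_left)
qed

section \<open>Functions on submanifolds of a Banach space\<close>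

lemma twice_fderiv_inclusion:
  assumes X: "normed X" and X1: "normed X\<^sub>1" and Y: "normed Y"
    and sub: "vecs X\<^sub>1 \<subseteq> vecs X" "\<And>v. v \<in> vecs X\<^sub>1 \<Longrightarrow> nrm X\<^sub>1 v = nrm X v"
    and F: "twice_fderiv X Y W F dF u B" and u: "u \<in> vecs X\<^sub>1"
  obtains dF\<^sub>1 B\<^sub>1 where "twice_fderiv X\<^sub>1 Y (W \<inter> vecs X\<^sub>1) F dF\<^sub>1 u B\<^sub>1"
    "\<And>h k. h \<in> vecs X\<^sub>1 \<Longrightarrow> k \<in> vecs X\<^sub>1 \<Longrightarrow> B\<^sub>1 h k = B h k"
proof -
  define \<iota> where "\<iota> v = (if v \<in> vecs X\<^sub>1 then v else 0)" for v
  have \<iota>: "\<iota> \<in> vecs (blin X\<^sub>1 X)"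
    by (rule blinI[OF X1 X, where K = 1])
      (use sub in \<open>auto simp: \<iota>_def vecs_add[OF X1] vecs_scale[OF X1]\<close>)
  have \<iota>u: "\<iota> u = u" using u by (simp add: \<iota>_def)
  let ?W = "{a \<in> vecs X\<^sub>1. \<iota> a \<in> W}"
  have W_eq: "?W = W \<inter> vecs X\<^sub>1" by (auto simp: \<iota>_def)
  let ?B = "\<lambda>h. (B (\<iota> h) \<circ> \<iota>) + (dF (\<iota> u) \<circ> 0 h)"
  have "twice_fderiv X\<^sub>1 Y ?W (F \<circ> \<iota>) (\<lambda>a. dF (\<iota> a) \<circ> \<iota>) u ?B"
    by (rule twice_fderiv_chain[OF X1 X Y twice_fderiv_linear[OF X1 X \<iota> u]]) (use F in \<open>simp add: \<iota>u\<close>)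
  then have "twice_fderiv X\<^sub>1 Y ?W F (\<lambda>a. dF (\<iota> a) \<circ> \<iota>) u ?B"
    by (rule twice_fderiv_cong) (simp add: \<iota>_def)
  moreover have "?B h k = B h k" if "h \<in> vecs X\<^sub>1" "k \<in> vecs X\<^sub>1" for h k
  proof -
    have "dF u \<in> vecs (blin X Y)" using F by (simp add: twice_fderiv_def has_fderiv_def)
    then show ?thesis using that blin_zero[OF X Y] by (simp add: \<iota>_def u)
  qed
  ultimately show ?thesis using that unfolding W_eq by blast
qed

lemma complemented_projection:
  assumes X: "normed X" and G: "complemented X G"
  obtains P where "P \<in> vecs (blin X (restrict_sp X G))" "\<And>v. v \<in> G \<Longrightarrow> P v = v"
    "normed (restrict_sp X G)" "G \<subseteq> vecs X"
proof -
  obtain P where P: "P \<in> vecs (blin X X)" "P ` vecs X = G" "\<And>v. v \<in> G \<Longrightarrow> P v = v"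
    using G unfolding complemented_def by blast
  have sub: "G \<subseteq> vecs X" using P(2) blin_in[OF X X P(1)] by blast
  have "subspace G"
  proof (rule subspaceI)
    show "0 \<in> G" using P(2) blin_zero[OF X X P(1)] vecs_zero[OF X] by (metis image_eqI)
    fix u v and a :: real assume u: "u \<in> G"
    then have "P (a *\<^sub>R u) = a *\<^sub>R u" using sub by (simp add: blin_scale[OF X X P(1)] P(3) subset_iff)
    then show "a *\<^sub>R u \<in> G" using P(2) u sub vecs_scale[OF X] by (metis image_eqI subsetD)
    assume v: "v \<in> G"
    have "P (u + v) = u + v" using sub u v by (simp add: blin_add[OF X X P(1)] P(3) subset_iff)
    then show "u + v \<in> G" using P(2) u v sub vecs_add[OF X] by (metis image_eqI subsetD)
  qed
  then have N: "normed (restrict_sp X G)"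
    using sub by (intro normed_restrict_sp[OF X]) (simp add: Int_absorb1)
  obtain K where K: "\<And>v. v \<in> vecs X \<Longrightarrow> nrm X (P v) \<le> K * nrm X v"
    using P(1) unfolding blin_iff[OF X X] by blast
  have "P \<in> vecs (blin X (restrict_sp X G))"
    by (rule blinI[OF X N, where K = K])
      (use P sub K in \<open>auto simp: restrict_sp_def blin_outside[OF X X P(1)] blin_add[OF X X P(1)] blin_scale[OF X X P(1)]\<close>)
  then show ?thesis using that P(3) N sub by blast
qed

text \<open>In a slice chart with projection \<open>P\<close> onto the slice, the function is smooth after composition
  with \<open>P\<close>, so no derivative of a map into the slice is needed.\<close>

lemma smooth_on_submanifold_compose:
  assumes X: "normed X" and Y: "normed Y" and f: "smooth_on_submanifold Y S T f"
    and K: "twice_fderiv X Y W K dK u B" and KS: "\<And>a. a \<in> W \<Longrightarrow> K a \<in> S" and u: "K u \<in> T"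
  obtains W' dF A where "W' \<subseteq> W" "twice_fderiv X real_sp W' (f \<circ> K) dF u A"
proof -
  obtain V \<kappa> G where V: "slice_chart Y S V \<kappa> G" "K u \<in> V"
    and f': "banach_smooth (restrict_sp Y G) real_sp (\<kappa> ` V \<inter> G) (f \<circ> inv_into V \<kappa>)"
    using f u unfolding smooth_on_submanifold_def by blast
  have \<kappa>: "banach_smooth Y Y V \<kappa>" "inj_on \<kappa> V" "complemented Y G" "\<kappa> ` (V \<inter> S) = \<kappa> ` V \<inter> G"
    using V(1) by (auto simp: slice_chart_def)
  obtain P where P: "P \<in> vecs (blin Y (restrict_sp Y G))" "\<And>v. v \<in> G \<Longrightarrow> P v = v"
    "normed (restrict_sp Y G)" "G \<subseteq> vecs Y"
    by (rule complemented_projection[OF Y \<kappa>(3)]) blast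
  have uW: "u \<in> W" using K by (simp add: twice_fderiv_def)
  have slice: "\<kappa> (K a) \<in> \<kappa> ` V \<inter> G" if "a \<in> W" "K a \<in> V" for a
    using \<kappa>(4) KS[OF that(1)] that(2) by blast
  obtain d\<kappa> B1 where 1: "twice_fderiv Y Y V \<kappa> d\<kappa> (K u) B1"
    by (rule banach_smooth_imp_twice_fderiv[OF Y Y \<kappa>(1) V(2)])
  obtain W1 d1 A1 where A1: "twice_fderiv X Y W1 (\<kappa> \<circ> K) d1 u A1" "W1 \<subseteq> W" "\<And>a. a \<in> W1 \<Longrightarrow> K a \<in> V"
    using twice_fderiv_chain[OF X Y Y K 1] by blast
  have uV: "\<kappa> (K u) \<in> \<kappa> ` V \<inter> G" by (rule slice[OF uW V(2)])
  have 2: "twice_fderiv Y (restrict_sp Y G) (vecs Y) P (\<lambda>_. P) ((\<kappa> \<circ> K) u) 0"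
    by (rule twice_fderiv_linear[OF Y P(3,1)]) (use uV P(4) in auto)
  obtain W2 d2 A2 where A2: "twice_fderiv X (restrict_sp Y G) W2 (P \<circ> (\<kappa> \<circ> K)) d2 u A2" "W2 \<subseteq> W1"
    using twice_fderiv_chain[OF X Y P(3) A1(1) 2] by blast
  have "(P \<circ> (\<kappa> \<circ> K)) u \<in> \<kappa> ` V \<inter> G" using uV P(2) by simp
  then obtain df B3 where 3: "twice_fderiv (restrict_sp Y G) real_sp (\<kappa> ` V \<inter> G) (f \<circ> inv_into V \<kappa>) df ((\<kappa> \<circ> K) u) B3"
    using banach_smooth_imp_twice_fderiv[OF P(3) normed_real_sp f' uV] by (metis comp_apply)
  have Pu: "(P \<circ> (\<kappa> \<circ> K)) u = (\<kappa> \<circ> K) u" using uV P(2) by simp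
  obtain W3 d3 A3 where A3: "twice_fderiv X real_sp W3 ((f \<circ> inv_into V \<kappa>) \<circ> (P \<circ> (\<kappa> \<circ> K))) d3 u A3" "W3 \<subseteq> W2"
    using twice_fderiv_chain[OF X P(3) normed_real_sp A2(1) 3[folded Pu]] by blast
  have "twice_fderiv X real_sp W3 (f \<circ> K) d3 u A3"
  proof (rule twice_fderiv_cong[OF A3(1)])
    fix a assume "a \<in> W3"
    then have a: "a \<in> W" "K a \<in> V" using A1 A2(2) A3(2) by auto
    then show "(f \<circ> inv_into V \<kappa> \<circ> (P \<circ> (\<kappa> \<circ> K))) a = (f \<circ> K) a"
      using slice[OF a] P(2) \<kappa>(2) by simp
  qed
  then show ?thesis using that A1(2) A2(2) A3(2) by blast
qed

section \<open>The charts\<close>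

lemma Cmap_snd:
  fixes BN :: "('n::topological_space, 'f::real_normed_vector) chart set"
  assumes "Cmap \<infinity> A (prod_atlas BM BN) S f"
  shows "Cmap \<infinity> A BN S (snd \<circ> f)"
proof (rule CmapI)
  fix p assume p: "p \<in> S"
  obtain U c VV kk Q F where *: "(U, c) \<in> A" "(VV, kk) \<in> prod_atlas BM BN" "p \<in> U" "f p \<in> VV" "open Q" "c p \<in> Q"
    "smooth_on \<infinity> Q F" "\<forall>q. q \<in> S \<longrightarrow> q \<in> U \<longrightarrow> c q \<in> Q \<longrightarrow> f q \<in> VV \<and> kk (f q) = F (c q)"
    by (rule CmapE[OF assms p])
  obtain V k V' k' where VV: "VV = V' \<times> V" "kk = map_prod k' k" "(V, k) \<in> BN"
    using *(2) by (auto simp: prod_atlas_def)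
  have "smooth_on \<infinity> Q (\<lambda>a. snd (F a))"
    by (rule smooth_on_bounded_linear_left[OF bounded_linear_snd *(5,7)])
  moreover have "snd (f q) \<in> V \<and> k (snd (f q)) = snd (F (c q))" if "q \<in> S" "q \<in> U" "c q \<in> Q" for q
  proof -
    have "f q \<in> V' \<times> V" "map_prod k' k (f q) = F (c q)" using *(8) that VV by auto
    then show ?thesis by (metis mem_Times_iff snd_map_prod)
  qed
  moreover have "snd (f p) \<in> V" using *(4) VV(1) by auto
  ultimately show "\<exists>U c V k Q F. (U, c) \<in> A \<and> (V, k) \<in> BN \<and> p \<in> U \<and> (snd \<circ> f) p \<in> V \<and> open Q \<and> c p \<in> Q \<and>
    smooth_on \<infinity> Q F \<and> (\<forall>q\<in>S \<inter> U. c q \<in> Q \<longrightarrow> (snd \<circ> f) q \<in> V \<and> k ((snd \<circ> f) q) = F (c q))"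
    using *(1,3,5,6) VV(3)
    by (intro exI[of _ U] exI[of _ c] exI[of _ V] exI[of _ k] exI[of _ Q] exI[of _ "\<lambda>a. snd (F a)"]) simp
qed

lemma Cmap_fibre_precompose:
  fixes A :: "('a::{t2_space,second_countable_topology}, 'e::real_inner) chart set"
    and \<beta> :: "'d::euclidean_space \<Rightarrow> 'd"
  assumes A: "smooth_manifold A n" and f: "Cmap \<infinity> (prod_atlas A std_atlas) D S f"
    and \<beta>: "smooth_on \<infinity> UNIV \<beta>" and S': "\<And>p v. (p, v) \<in> S' \<Longrightarrow> (p, \<beta> v) \<in> S"
  shows "Cmap \<infinity> (prod_atlas A std_atlas) D S' (\<lambda>(p, v). f (p, \<beta> v))"
proof (rule CmapI)
  fix z assume z: "z \<in> S'"
  obtain E :: "'e set" and e where E: "coordinates E e" by (rule model_coordinates[OF A])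
  obtain E' :: "('e \<times> 'd) set" and e' where E': "coordinates E' e'"
    by (rule coordinates_prod[OF E coordinates_euclidean])
  define \<beta>' :: "'e \<times> 'd \<Rightarrow> 'e \<times> 'd" where "\<beta>' a = (fst a, \<beta> (snd a))" for a
  have "smooth_on \<infinity> UNIV (\<lambda>a :: 'e \<times> 'd. \<beta> (snd a))"
    by (rule smooth_on_compose[OF coordinates_euclidean open_UNIV open_UNIV _ \<beta>])
      (simp_all add: smooth_on_bounded_linear[OF bounded_linear_snd])
  then have "higher_differentiable_on UNIV (\<lambda>a :: 'e \<times> 'd. (fst a, 0) + (0, \<beta> (snd a))) k" for k
    by (intro higher_differentiable_on_add[OF open_UNIV]
        higher_differentiable_on_bounded_linear[OF bounded_linear_Pair[OF bounded_linear_fst bounded_linear_zero] open_UNIV]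
        higher_differentiable_on_bounded_linear_left[OF bounded_linear_Pair[OF bounded_linear_zero bounded_linear_ident] open_UNIV])
      (simp add: smooth_on_infinity)
  then have \<beta>': "smooth_on \<infinity> UNIV \<beta>'" by (simp add: smooth_on_infinity \<beta>'_def[abs_def])
  obtain p v where pv: "z = (p, v)" by fastforce
  obtain UU cc V k Q F where *: "(UU, cc) \<in> prod_atlas A std_atlas" "(V, k) \<in> D" "(p, \<beta> v) \<in> UU" "f (p, \<beta> v) \<in> V"
    "open Q" "cc (p, \<beta> v) \<in> Q" "smooth_on \<infinity> Q F"
    "\<forall>q. q \<in> S \<longrightarrow> q \<in> UU \<longrightarrow> cc q \<in> Q \<longrightarrow> f q \<in> V \<and> k (f q) = F (cc q)"
    by (rule CmapE[OF f S'[OF z[unfolded pv]]])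
  obtain U c where UU: "UU = U \<times> UNIV" "cc = map_prod c id"
    using *(1) by (auto simp: prod_atlas_def std_atlas_def)
  have cc: "cc (q, \<beta> w) = \<beta>' (cc (q, w))" for q w by (simp add: UU \<beta>'_def)
  define Q' where "Q' = UNIV \<inter> \<beta>' -` Q"
  have Q': "open Q'" unfolding Q'_def
    by (rule continuous_open_preimage[OF smooth_on_imp_continuous_on[OF \<beta>'] open_UNIV *(5)])
  have "smooth_on \<infinity> Q' (\<lambda>a. F (\<beta>' a))"
    by (rule smooth_on_compose[OF E' Q' *(5) _ *(7) smooth_on_subset[OF \<beta>']]) (auto simp: Q'_def)
  moreover have "cc (p, v) \<in> Q'" using *(6) by (simp add: Q'_def cc)
  moreover have "f (q, \<beta> w) \<in> V \<and> k (f (q, \<beta> w)) = F (\<beta>' (cc (q, w)))"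
    if "(q, w) \<in> S'" "(q, w) \<in> UU" "cc (q, w) \<in> Q'" for q w
    using *(8)[rule_format, of "(q, \<beta> w)"] S'[OF that(1)] that(2,3) by (auto simp: UU(1) Q'_def cc)
  moreover have "(p, v) \<in> UU" using *(3) by (simp add: UU(1))
  ultimately show "\<exists>U c V k Q F. (U, c) \<in> prod_atlas A std_atlas \<and> (V, k) \<in> D \<and> z \<in> U \<and>
      (case z of (p, v) \<Rightarrow> f (p, \<beta> v)) \<in> V \<and> open Q \<and> c z \<in> Q \<and> smooth_on \<infinity> Q F \<and>
      (\<forall>q\<in>S' \<inter> U. c q \<in> Q \<longrightarrow> (case q of (p, v) \<Rightarrow> f (p, \<beta> v)) \<in> V \<and> k (case q of (p, v) \<Rightarrow> f (p, \<beta> v)) = F (c q))"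
    using *(1,2,4) Q'
    by (intro exI[of _ UU] exI[of _ cc] exI[of _ V] exI[of _ k] exI[of _ Q'] exI[of _ "\<lambda>a. F (\<beta>' a)"])
      (auto simp: pv)
qed

lemma open_zero_section_tube:
  fixes E :: "'m::topological_space \<Rightarrow> 'd::real_normed_vector set"
  assumes "compact (UNIV :: 'm set)" "openin (top_of_set (total E)) Q" "UNIV \<times> {0} \<subseteq> Q"
  obtains r where "r > 0" "\<And>p v. v \<in> E p \<Longrightarrow> norm v < r \<Longrightarrow> (p, v) \<in> Q"
proof -
  obtain O' where O': "open O'" "Q = total E \<inter> O'" using assms(2) by (auto simp: openin_open)
  have op: "open (prod.swap -` O')" by (rule open_vimage[OF O'(1) continuous_on_swap])
  have "{0} \<times> UNIV \<subseteq> prod.swap -` O'" using assms(3) O'(2) by auto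
  from Elementary_Topology.tube_lemma[OF assms(1) op this]
  obtain X where X: "0 \<in> X" "open X" "X \<times> UNIV \<subseteq> prod.swap -` O'" by blast
  obtain r where r: "r > 0" "ball 0 r \<subseteq> X" using X(1,2) open_contains_ball by blast
  have "(p, v) \<in> Q" if "v \<in> E p" "norm v < r" for p v
  proof -
    have "v \<in> X" using r(2) that(2) by auto
    then have "(v, p) \<in> prod.swap -` O'" using X(3) by blast
    then show ?thesis using that(1) O'(2) by simp
  qed
  then show ?thesis using that r(1) by blast
qed

lemma emb_equiv_refl:
  assumes "smooth_manifold AM m"
  shows "emb_equiv AM x x"
proof -
  have "Cmap 1 AM AM UNIV id"
  proof (rule CmapI)
    fix p
    obtain U c where "(U, c) \<in> AM" "p \<in> U" by (rule atlas_cover[OF assms])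
    moreover have "smooth_on 1 UNIV (\<lambda>a. a)"
      by (simp add: smooth_on_def higher_differentiable_on_bounded_linear[OF bounded_linear_ident open_UNIV])
    ultimately show "\<exists>U c V k Q F. (U, c) \<in> AM \<and> (V, k) \<in> AM \<and> p \<in> U \<and> id p \<in> V \<and> open Q \<and> c p \<in> Q \<and>
      smooth_on 1 Q F \<and> (\<forall>q\<in>UNIV \<inter> U. c q \<in> Q \<longrightarrow> id q \<in> V \<and> k (id q) = F (c q))"
      by (intro exI[of _ U] exI[of _ c] exI[of _ U] exI[of _ c] exI[of _ UNIV] exI[of _ "\<lambda>a. a"]) simp
  qed
  then have "Cdiffeo 1 AM AM UNIV UNIV id" by (simp add: Cdiffeo_def inv_id)
  then show ?thesis unfolding emb_equiv_def by (intro exI[of _ id]) simp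
qed

lemma on_classes_emb_class:
  assumes "smooth_manifold AM m" "diff_invariant AM AN C \<phi> f" "y \<in> Emb AM AN C \<phi>"
  shows "on_classes f (emb_class AM AN C \<phi> y) = f y"
proof -
  have "y \<in> emb_class AM AN C \<phi> y" using assms emb_equiv_refl by (simp add: emb_class_def)
  moreover have "f z = f y" if "z \<in> emb_class AM AN C \<phi> y" for z
    using that assms(2,3) unfolding emb_class_def diff_invariant_def by auto
  ultimately have "f ` emb_class AM AN C \<phi> y = {f y}" by blast
  then show ?thesis by (simp add: on_classes_def)
qed

text \<open>The cutoff turns \<open>exp\<close> into a fibre map defined on all of the pullback bundle, which agrees with
  \<open>exp\<close> near the zero section.\<close>

lemma twice_fderiv_Psi:
  fixes AM :: "('m::{t2_space,second_countable_topology}, 'e::real_inner) chart set"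
    and AN :: "('n::{t2_space,second_countable_topology}, 'f::real_inner) chart set"
    and \<phi> :: "'n \<Rightarrow> 'd::euclidean_space"
  assumes M: "smooth_manifold AM m" "compact (UNIV :: 'm set)"
    and N: "smooth_manifold AN n"
    and phi: "Cembedding \<infinity> AN std_atlas \<phi>"
    and C: "regularity_class AM C"
    and fibre_maps: "\<And>(E :: 'm \<Rightarrow> 'd set) (F :: 'm \<Rightarrow> 'd set) (\<Theta> :: 'm \<times> 'd \<Rightarrow> 'd).
        smooth_bundle AM E \<Longrightarrow> smooth_bundle AM F \<Longrightarrow>
        (\<forall>(p, v)\<in>total E. \<Theta> (p, v) \<in> F p) \<Longrightarrow>
        Cmap \<infinity> (prod_atlas AM std_atlas) std_atlas (total E) \<Theta> \<Longrightarrow>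
        banach_smooth (sections C E) (sections C F) (vecs (sections C E)) (\<lambda>u p. \<Theta> (p, u p))"
    and x: "Cembedding \<infinity> AM AN x"
    and chart: "emb_chart AM AN C \<phi> g x W"
  obtains W' dF B where "W' \<subseteq> W"
    "twice_fderiv (sections C (pullback_TN AN \<phi> x)) (vec_class C) W' (\<lambda>u. \<phi> \<circ> Psi AN \<phi> g x u) dF 0 B"
proof -
  let ?E = "pullback_TN AN \<phi> x"
  let ?X = "sections C ?E"
  let ?e = "\<lambda>(p, v). (p, exp_map AN \<phi> g (x p) v)"
  have \<phi>: "Cmap \<infinity> AN std_atlas UNIV \<phi>" by (rule Cembedding_imp_Cmap[OF phi])
  have Cn: "normed C" using C by (intro banach_space_imp_normed) (simp add: regularity_class_def)
  have E_sub: "subspace (?E p)" for p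
    unfolding pullback_TN_def by (rule subspace_tangent_image[OF N \<phi>])
  have X: "normed ?X" by (rule normed_sections[OF Cn E_sub])
  obtain Q T where Q: "openin (top_of_set (total ?E)) Q" "UNIV \<times> {0} \<subseteq> Q"
      "Cdiffeo \<infinity> (prod_atlas AM std_atlas) (prod_atlas AM AN) Q T ?e"
    using chart unfolding emb_chart_def by auto
  obtain r where r: "r > 0" "\<And>p v. v \<in> ?E p \<Longrightarrow> norm v < r \<Longrightarrow> (p, v) \<in> Q"
    by (rule open_zero_section_tube[OF M(2) Q(1,2)]) blast
  obtain \<beta> :: "'d \<Rightarrow> 'd" and \<epsilon> where \<beta>: "smooth_on \<infinity> UNIV \<beta>" "\<epsilon> > 0" "\<And>v. norm v < \<epsilon> \<Longrightarrow> \<beta> v = v"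
    "\<And>v. norm (\<beta> v) < r" "\<And>v. \<exists>c. \<beta> v = c *\<^sub>R v"
    by (rule smooth_retraction_to_ball[OF r(1)]) blast
  have \<beta>_in: "(p, \<beta> v) \<in> Q" if "(p, v) \<in> total ?E" for p v
  proof -
    have "\<beta> v \<in> ?E p" using that \<beta>(5)[of v] subspace_scale[OF E_sub] by fastforce
    then show ?thesis using r(2) \<beta>(4) by blast
  qed
  define \<Theta> where "\<Theta> = (\<lambda>(p, v). (\<phi> \<circ> (snd \<circ> ?e)) (p, \<beta> v))"
  have "Cmap \<infinity> (prod_atlas AM std_atlas) (prod_atlas AM AN) Q ?e" using Q(3) by (simp add: Cdiffeo_def)
  then have "Cmap \<infinity> (prod_atlas AM std_atlas) std_atlas Q (\<phi> \<circ> (snd \<circ> ?e))"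
    by (rule Cmap_compose[OF N Cmap_snd \<phi> subset_UNIV])
  then have "Cmap \<infinity> (prod_atlas AM std_atlas) std_atlas (total ?E) \<Theta>"
    unfolding \<Theta>_def using \<beta>(1) \<beta>_in by (rule Cmap_fibre_precompose[OF M(1)])
  then have "banach_smooth ?X (sections C (\<lambda>_. UNIV)) (vecs ?X) (\<lambda>u p. \<Theta> (p, u p))"
    by (intro fibre_maps smooth_bundle_pullback_TN[OF N phi x] smooth_bundle_trivial[OF M(1)]) auto
  then have "banach_smooth ?X (vec_class C) (vecs ?X) (\<lambda>u p. \<Theta> (p, u p))" by (simp only: sections_UNIV)
  then obtain dF B where K: "twice_fderiv ?X (vec_class C) (vecs ?X) (\<lambda>u p. \<Theta> (p, u p)) dF 0 B"
    using banach_smooth_imp_twice_fderiv[OF X normed_vec_class[OF Cn] _ vecs_zero[OF X]] by blast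
  obtain b where b: "0 \<le> b" "\<forall>h\<in>vecs C. \<forall>p. \<bar>h p\<bar> \<le> b * nrm C h"
    by (rule regularity_class_sup_bound[OF M C]) blast
  define W' where "W' = W \<inter> {u \<in> vecs ?X. nrm ?X u < \<epsilon> / (b + 1)}"
  have W: "openin (ntop ?X) W" "0 \<in> W" using chart by (auto simp: emb_chart_def)
  have "openin (ntop ?X) W'" unfolding W'_def by (intro openin_Int W openin_ntop_ball[OF X])
  moreover have "0 \<in> W'" using W(2) \<beta>(2) b(1) by (simp add: W'_def vecs_zero[OF X] nrm_zero[OF X])
  moreover have "W' \<subseteq> vecs ?X" by (auto simp: W'_def)
  ultimately have "twice_fderiv ?X (vec_class C) W' (\<lambda>u p. \<Theta> (p, u p)) dF 0 B"
    by (rule twice_fderiv_subset[OF K])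
  then have "twice_fderiv ?X (vec_class C) W' (\<lambda>u. \<phi> \<circ> Psi AN \<phi> g x u) dF 0 B"
  proof (rule twice_fderiv_cong)
    fix u assume u: "u \<in> W'"
    have "\<beta> (u p) = u p" for p
    proof (rule \<beta>(3))
      have "u \<in> vecs (vec_class C)" using u by (simp add: W'_def vecs_sections)
      then have "norm (u p) \<le> b * nrm (vec_class C) u" by (rule vec_class_norm_bound[OF b(2)])
      also have "\<dots> \<le> (b + 1) * nrm (vec_class C) u"
        using u nrm_nonneg[OF X, of u] by (intro mult_right_mono) (auto simp: W'_def nrm_sections)
      also have "\<dots> < \<epsilon>" using u b(1) by (simp add: W'_def nrm_sections field_simps)
      finally show "norm (u p) < \<epsilon>" .
    qed
    then show "(\<lambda>p. \<Theta> (p, u p)) = \<phi> \<circ> Psi AN \<phi> g x u"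
      by (simp add: \<Theta>_def Psi_def fun_eq_iff)
  qed
  moreover have "W' \<subseteq> W" by (simp add: W'_def)
  ultimately show ?thesis using that by blast
qed

theorem proposition4p7:
  fixes AM :: "('m::{t2_space,second_countable_topology}, 'e::real_inner) chart set"
    and AN :: "('n::{t2_space,second_countable_topology}, 'f::real_inner) chart set"
    and m n :: nat
    and \<phi> :: "'n \<Rightarrow> 'd::euclidean_space"
    and g :: "'n \<Rightarrow> 'd \<Rightarrow> 'd \<Rightarrow> real"
    and C :: "('m \<Rightarrow> real) normed_sp"
    and f :: "('m \<Rightarrow> 'n) \<Rightarrow> real"
    and x :: "'m \<Rightarrow> 'n"
    and W W\<^sub>1 :: "('m \<Rightarrow> 'd) set"
  assumes M: "smooth_manifold AM m" "compact (UNIV :: 'm set)"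
    and N: "smooth_manifold AN n"
    and dims: "m < n"
    and phi: "Cembedding \<infinity> AN std_atlas \<phi>"
    and g: "riemannian_metric AN \<phi> g"
    and C: "regularity_class AM C"
    and fibre_maps: "\<And>(E :: 'm \<Rightarrow> 'd set) (F :: 'm \<Rightarrow> 'd set) (\<Theta> :: 'm \<times> 'd \<Rightarrow> 'd).
        smooth_bundle AM E \<Longrightarrow> smooth_bundle AM F \<Longrightarrow>
        (\<forall>(p, v)\<in>total E. \<Theta> (p, v) \<in> F p) \<Longrightarrow>
        Cmap \<infinity> (prod_atlas AM std_atlas) std_atlas (total E) \<Theta> \<Longrightarrow>
        banach_smooth (sections C E) (sections C F) (vecs (sections C E)) (\<lambda>u p. \<Theta> (p, u p))"
    and f_smooth: "smooth_on_Emb AM AN C \<phi> f"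
    and f_inv: "diff_invariant AM AN C \<phi> f"
    and x: "Cembedding \<infinity> AM AN x"
    and crit: "critical_class AM AN C \<phi> g f (emb_class AM AN C \<phi> x)"
    and chart: "emb_chart AM AN C \<phi> g x W"
    and chart\<^sub>1: "class_chart AM AN C \<phi> g x W\<^sub>1"
  shows "(\<exists>B. has_second_fderiv (sections C (pullback_TN AN \<phi> x)) real_sp W
            (f \<circ> Psi AN \<phi> g x) 0 B) \<and>
         (\<exists>B. has_second_fderiv (sections C (normal_bundle AM AN \<phi> g x)) real_sp W\<^sub>1
            (on_classes f \<circ> Psi_tilde AM AN C \<phi> g x) 0 B) \<and>
         (\<forall>u\<in>vecs (sections C (normal_bundle AM AN \<phi> g x)).
          \<forall>v\<in>vecs (sections C (normal_bundle AM AN \<phi> g x)).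
            second_fderiv (sections C (normal_bundle AM AN \<phi> g x)) real_sp W\<^sub>1
              (on_classes f \<circ> Psi_tilde AM AN C \<phi> g x) 0 u v =
            second_fderiv (sections C (pullback_TN AN \<phi> x)) real_sp W
              (f \<circ> Psi AN \<phi> g x) 0 u v)"
proof -
  let ?E = "pullback_TN AN \<phi> x"
  let ?E1 = "normal_bundle AM AN \<phi> g x"
  let ?X = "sections C ?E"
  let ?X1 = "sections C ?E1"
  let ?F = "f \<circ> Psi AN \<phi> g x"
  let ?F1 = "on_classes f \<circ> Psi_tilde AM AN C \<phi> g x"
  have \<phi>: "Cmap \<infinity> AN std_atlas UNIV \<phi>" by (rule Cembedding_imp_Cmap[OF phi])
  have x': "Cmap \<infinity> AM AN UNIV x" by (rule Cembedding_imp_Cmap[OF x])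
  have Cn: "normed C" using C by (intro banach_space_imp_normed) (simp add: regularity_class_def)
  have X: "normed ?X"
    by (rule normed_sections[OF Cn]) (unfold pullback_TN_def, rule subspace_tangent_image[OF N \<phi>])
  have X1: "normed ?X1"
    by (rule normed_sections[OF Cn subspace_normal_bundle[OF M(1) N \<phi> x' g]])
  have Emb: "Psi AN \<phi> g x u \<in> Emb AM AN C \<phi>" if "u \<in> W" for u
    using chart that unfolding emb_chart_def open_in_Emb_def by blast
  obtain V dK B0 where V: "V \<subseteq> W" "twice_fderiv ?X (vec_class C) V (\<lambda>u. \<phi> \<circ> Psi AN \<phi> g x u) dK 0 B0"
    by (rule twice_fderiv_Psi[OF M N phi C fibre_maps x chart]) blast
  obtain V' dF B where V': "V' \<subseteq> V"
    "twice_fderiv ?X real_sp V' ((\<lambda>h. f (inv \<phi> \<circ> h)) \<circ> (\<lambda>u. \<phi> \<circ> Psi AN \<phi> g x u)) dF 0 B"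
  proof (rule smooth_on_submanifold_compose[OF X normed_vec_class[OF Cn] f_smooth[unfolded smooth_on_Emb_def] V(2)])
    show "\<phi> \<circ> Psi AN \<phi> g x u \<in> {h \<in> vecs (vec_class C). range h \<subseteq> range \<phi>}" if "u \<in> V" for u
      using Emb[of u] that V(1) by (auto simp: Emb_def class_maps_def)
    show "\<phi> \<circ> Psi AN \<phi> g x 0 \<in> (\<circ>) \<phi> ` Emb AM AN C \<phi>"
      using Emb[of 0] chart by (auto simp: emb_chart_def)
  qed blast
  have "inv \<phi> \<circ> (\<phi> \<circ> y) = y" for y :: "'m \<Rightarrow> 'n"
    using inv_o_cancel[OF Cembedding_imp_inj[OF phi]] by (simp add: o_assoc)
  then have F: "twice_fderiv ?X real_sp V' ?F dF 0 B" using V'(2) by (simp add: comp_def)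
  have sub: "vecs ?X1 \<subseteq> vecs ?X" by (auto simp: vecs_sections normal_bundle_def)
  obtain dF1 B1 where F1: "twice_fderiv ?X1 real_sp (V' \<inter> vecs ?X1) ?F dF1 0 B1"
    and B1: "\<And>h k. h \<in> vecs ?X1 \<Longrightarrow> k \<in> vecs ?X1 \<Longrightarrow> B1 h k = B h k"
    by (rule twice_fderiv_inclusion[OF X X1 normed_real_sp sub _ F vecs_zero[OF X1]]) (simp add: nrm_sections, blast)
  have W1: "openin (ntop ?X1) W\<^sub>1" "0 \<in> W\<^sub>1" "Psi AN \<phi> g x ` W\<^sub>1 \<subseteq> Emb AM AN C \<phi>"
    using chart\<^sub>1 unfolding class_chart_def by blast+
  have "twice_fderiv ?X1 real_sp (V' \<inter> vecs ?X1 \<inter> W\<^sub>1) ?F dF1 0 B1"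
    by (rule twice_fderiv_subset[OF F1]) (use F1 W1 in \<open>auto simp: twice_fderiv_def\<close>)
  then have "twice_fderiv ?X1 real_sp (V' \<inter> vecs ?X1 \<inter> W\<^sub>1) ?F1 dF1 0 B1"
  proof (rule twice_fderiv_cong)
    fix u assume "u \<in> V' \<inter> vecs ?X1 \<inter> W\<^sub>1"
    then have "Psi AN \<phi> g x u \<in> Emb AM AN C \<phi>" using W1(3) by blast
    then show "?F u = ?F1 u" by (simp add: Psi_tilde_def on_classes_emb_class[OF M(1) f_inv])
  qed
  then have 1: "has_second_fderiv ?X1 real_sp W\<^sub>1 ?F1 0 B1"
    by (rule twice_fderiv_imp_has_second_fderiv[OF X1]) blast
  have 2: "has_second_fderiv ?X real_sp W ?F 0 B"
    by (rule twice_fderiv_imp_has_second_fderiv[OF X F]) (use V V' in blast)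
  have "second_fderiv ?X1 real_sp W\<^sub>1 ?F1 0 = B1" "second_fderiv ?X real_sp W ?F 0 = B"
    by (rule second_fderiv_eq[OF X1 normed_real_sp _ 1] second_fderiv_eq[OF X normed_real_sp _ 2]; simp)+
  then show ?thesis using 1 2 B1 by auto
qed

end
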